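(* Let $\mathcal{C}$ be a fusion category over $k$ with universal grading group $U(\mathcal{C})$. Then: (i) Let $n \in \mathbb{N}$ and suppose that the order of $X$ divides $n$ for every simple object $X$ of $\mathcal{C}$. Then the exponent of $U(\mathcal{C})$ divides $n$. In particular, if all simple objects of $\mathcal{C}$ are self-dual, then $U(\mathcal{C})$ is an elementary abelian $2$-group. (ii) Let $p$ be a prime number. Suppose that $\mathcal{C}$ is nilpotent and the order of $X$ is a power of $p$ for every simple object $X$ of $\mathcal{C}$. Then $\operatorname{FPdim}\mathcal{C} = p^m$ for some $m \geq 0$.
   Context: $k$ is an algebraically closed field of characteristic zero. A fusion category over $k$ is a $k$-linear semisimple rigid tensor category with finitely many isomorphism classes of simple objects, finite-dimensional Hom spaces and simple unit object $\mathbf{1}$. The adjoint subcategory $\mathcal{C}_{\mathrm{ad}}$ is the fusion subcategory (full tensor subcategory stable under direct sums and subobjects) generated by $X \otimes X^*$, $X$ running over the simple objects of $\mathcal{C}$. Set $\mathcal{C}^{(0)} = \mathcal{C}$ and $\mathcal{C}^{(n)} = (\mathcal{C}^{(n-1)})_{\mathrm{ad}}$ for $n \geq 1$; $\mathcal{C}$ is nilpotent if $\mathcal{C}^{(n)} = \mathrm{Vec}_k$ for some $n\ge 0$. A grading of $\mathcal{C}$ by a group $G$ is a decomposition $\mathcal{C} = \oplus_{g\in G}\mathcal{C}_g$ into full abelian subcategories with $\mathcal{C}_g^* = \mathcal{C}_{g^{-1}}$ and $\otimes$ mapping $\mathcal{C}_g\times \mathcal{C}_h$ to $\mathcal{C}_{gh}$;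 it is faithful if all $\mathcal{C}_g \neq 0$. Every fusion category has a canonical faithful grading, the universal grading, by a group $U(\mathcal{C})$ (the universal grading group), with trivial component $\mathcal{C}_e = \mathcal{C}_{\mathrm{ad}}$; every grading of $\mathcal{C}$ by a group $G$ is obtained from it through a unique group homomorphism $U(\mathcal{C}) \to G$. The order of a nonzero object $X$ is the smallest integer $n \geq 1$ such that $\mathbf{1}$ occurs with positive multiplicity in $X^{\otimes n}$. A simple object $X$ is self-dual if $X\simeq X^*$. The trivial group counts as an elementary abelian $2$-group, and $1 = p^0$ counts as a power of $p$. *)

theory Defs
  imports
    "HOL-Computational_Algebra.Polynomial"
    "HOL-Algebra.Multiplicative_Group"
    "Jordan_Normal_Form.Char_Poly"
begin

section \<open>Linear monoidal categories\<close>

text \<open>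
  All data of a \<open>k\<close>-linear monoidal category. Objects and arrows are carved out of the
  types by the sets \<open>obj\<close> and \<open>arr\<close>; the operations are only constrained there.
  Composition is written in the usual order, \<open>g \<cdot> f\<close> being ``first \<open>f\<close>, then \<open>g\<close>'', and
  \<open>assoc X Y Z\<close> goes from \<open>(X \<boxtimes> Y) \<boxtimes> Z\<close> to \<open>X \<boxtimes> (Y \<boxtimes> Z)\<close>.
\<close>

record ('o, 'm, 'k) lin_tensor_cat =
  obj :: "'o set"
  arr :: "'m set"
  src :: "'m \<Rightarrow> 'o"
  tgt :: "'m \<Rightarrow> 'o"
  idn :: "'o \<Rightarrow> 'm"
  cmp :: "'m \<Rightarrow> 'm \<Rightarrow> 'm" (infixr "\<cdot>\<index>" 70)
  hadd :: "'m \<Rightarrow> 'm \<Rightarrow> 'm" (infixl "\<boxplus>\<index>" 65)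
  hzero :: "'o \<Rightarrow> 'o \<Rightarrow> 'm"
  hscale :: "'k \<Rightarrow> 'm \<Rightarrow> 'm"
  tobj :: "'o \<Rightarrow> 'o \<Rightarrow> 'o" (infixl "\<boxtimes>\<index>" 75)
  tarr :: "'m \<Rightarrow> 'm \<Rightarrow> 'm" (infixl "\<star>\<index>" 75)
  unit_obj :: "'o"
  assoc :: "'o \<Rightarrow> 'o \<Rightarrow> 'o \<Rightarrow> 'm"
  lun :: "'o \<Rightarrow> 'm"
  run :: "'o \<Rightarrow> 'm"

definition Mor :: "('o, 'm, 'k) lin_tensor_cat \<Rightarrow> 'o \<Rightarrow> 'o \<Rightarrow> 'm set" where
  "Mor C X Y = {f \<in> arr C. src C f = X \<and> tgt C f = Y}"

locale category =
  fixes C :: "('o, 'm, 'k) lin_tensor_cat" (structure)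
  assumes src_obj: "f \<in> arr C \<Longrightarrow> src C f \<in> obj C"
    and tgt_obj: "f \<in> arr C \<Longrightarrow> tgt C f \<in> obj C"
    and idn_Mor: "X \<in> obj C \<Longrightarrow> idn C X \<in> Mor C X X"
    and cmp_Mor: "f \<in> Mor C X Y \<Longrightarrow> g \<in> Mor C Y Z \<Longrightarrow> g \<cdot> f \<in> Mor C X Z"
    and cmp_assoc: "f \<in> Mor C W X \<Longrightarrow> g \<in> Mor C X Y \<Longrightarrow> h \<in> Mor C Y Z \<Longrightarrow>
          (h \<cdot> g) \<cdot> f = h \<cdot> (g \<cdot> f)"
    and idn_left: "f \<in> Mor C X Y \<Longrightarrow> idn C Y \<cdot> f = f"
    and idn_right: "f \<in> Mor C X Y \<Longrightarrow> f \<cdot> idn C X = f"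

definition is_inverse :: "('o, 'm, 'k) lin_tensor_cat \<Rightarrow> 'm \<Rightarrow> 'm \<Rightarrow> bool" where
  "is_inverse C f g \<longleftrightarrow> f \<in> arr C \<and> g \<in> Mor C (tgt C f) (src C f) \<and>
     g \<cdot>\<^bsub>C\<^esub> f = idn C (src C f) \<and> f \<cdot>\<^bsub>C\<^esub> g = idn C (tgt C f)"

definition is_iso :: "('o, 'm, 'k) lin_tensor_cat \<Rightarrow> 'm \<Rightarrow> bool" where
  "is_iso C f \<longleftrightarrow> (\<exists>g. is_inverse C f g)"

definition inv_arr :: "('o, 'm, 'k) lin_tensor_cat \<Rightarrow> 'm \<Rightarrow> 'm" where
  "inv_arr C f = (THE g. is_inverse C f g)"

definition isomorphic :: "('o, 'm, 'k) lin_tensor_cat \<Rightarrow> 'o \<Rightarrow> 'o \<Rightarrow> bool" where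
  "isomorphic C X Y \<longleftrightarrow> (\<exists>f \<in> Mor C X Y. is_iso C f)"

definition is_mono :: "('o, 'm, 'k) lin_tensor_cat \<Rightarrow> 'm \<Rightarrow> bool" where
  "is_mono C f \<longleftrightarrow> f \<in> arr C \<and>
     (\<forall>W. \<forall>g \<in> Mor C W (src C f). \<forall>h \<in> Mor C W (src C f). f \<cdot>\<^bsub>C\<^esub> g = f \<cdot>\<^bsub>C\<^esub> h \<longrightarrow> g = h)"

definition is_epi :: "('o, 'm, 'k) lin_tensor_cat \<Rightarrow> 'm \<Rightarrow> bool" where
  "is_epi C f \<longleftrightarrow> f \<in> arr C \<and>
     (\<forall>Z. \<forall>g \<in> Mor C (tgt C f) Z. \<forall>h \<in> Mor C (tgt C f) Z. g \<cdot>\<^bsub>C\<^esub> f = h \<cdot>\<^bsub>C\<^esub> f \<longrightarrow> g = h)"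

locale linear_category = category C
  for C :: "('o, 'm, 'k::field) lin_tensor_cat" (structure) +
  assumes hadd_Mor: "f \<in> Mor C X Y \<Longrightarrow> g \<in> Mor C X Y \<Longrightarrow> f \<boxplus> g \<in> Mor C X Y"
    and hadd_assoc: "f \<in> Mor C X Y \<Longrightarrow> g \<in> Mor C X Y \<Longrightarrow> h \<in> Mor C X Y \<Longrightarrow>
          (f \<boxplus> g) \<boxplus> h = f \<boxplus> (g \<boxplus> h)"
    and hadd_comm: "f \<in> Mor C X Y \<Longrightarrow> g \<in> Mor C X Y \<Longrightarrow> f \<boxplus> g = g \<boxplus> f"
    and hzero_Mor: "X \<in> obj C \<Longrightarrow> Y \<in> obj C \<Longrightarrow> hzero C X Y \<in> Mor C X Y"
    and hadd_zero: "f \<in> Mor C X Y \<Longrightarrow> f \<boxplus> hzero C X Y = f"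
    and hadd_neg: "f \<in> Mor C X Y \<Longrightarrow> \<exists>g \<in> Mor C X Y. f \<boxplus> g = hzero C X Y"
    and hscale_Mor: "f \<in> Mor C X Y \<Longrightarrow> hscale C a f \<in> Mor C X Y"
    and hscale_one: "f \<in> Mor C X Y \<Longrightarrow> hscale C 1 f = f"
    and hscale_mult: "f \<in> Mor C X Y \<Longrightarrow> hscale C (a * b) f = hscale C a (hscale C b f)"
    and hscale_add_left: "f \<in> Mor C X Y \<Longrightarrow> hscale C (a + b) f = hscale C a f \<boxplus> hscale C b f"
    and hscale_add_right: "f \<in> Mor C X Y \<Longrightarrow> g \<in> Mor C X Y \<Longrightarrow>
          hscale C a (f \<boxplus> g) = hscale C a f \<boxplus> hscale C a g"
    and cmp_add_left: "f \<in> Mor C X Y \<Longrightarrow> g \<in> Mor C Y Z \<Longrightarrow> h \<in> Mor C Y Z \<Longrightarrow>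
          (g \<boxplus> h) \<cdot> f = (g \<cdot> f) \<boxplus> (h \<cdot> f)"
    and cmp_add_right: "f \<in> Mor C X Y \<Longrightarrow> g \<in> Mor C X Y \<Longrightarrow> h \<in> Mor C Y Z \<Longrightarrow>
          h \<cdot> (f \<boxplus> g) = (h \<cdot> f) \<boxplus> (h \<cdot> g)"
    and cmp_scale_left: "f \<in> Mor C X Y \<Longrightarrow> g \<in> Mor C Y Z \<Longrightarrow>
          hscale C a g \<cdot> f = hscale C a (g \<cdot> f)"
    and cmp_scale_right: "f \<in> Mor C X Y \<Longrightarrow> g \<in> Mor C Y Z \<Longrightarrow>
          g \<cdot> hscale C a f = hscale C a (g \<cdot> f)"

inductive_set lin_span ::
    "('o, 'm, 'k) lin_tensor_cat \<Rightarrow> 'o \<Rightarrow> 'o \<Rightarrow> 'm set \<Rightarrow> 'm set"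
  for C X Y B where
  zero: "hzero C X Y \<in> lin_span C X Y B"
| base: "f \<in> B \<Longrightarrow> f \<in> lin_span C X Y B"
| add: "f \<in> lin_span C X Y B \<Longrightarrow> g \<in> lin_span C X Y B \<Longrightarrow> f \<boxplus>\<^bsub>C\<^esub> g \<in> lin_span C X Y B"
| scale: "f \<in> lin_span C X Y B \<Longrightarrow> hscale C a f \<in> lin_span C X Y B"

definition finite_spanning ::
    "('o, 'm, 'k) lin_tensor_cat \<Rightarrow> 'o \<Rightarrow> 'o \<Rightarrow> 'm set \<Rightarrow> bool" where
  "finite_spanning C X Y B \<longleftrightarrow> finite B \<and> B \<subseteq> Mor C X Y \<and> lin_span C X Y B = Mor C X Y"

definition dim_Mor :: "('o, 'm, 'k) lin_tensor_cat \<Rightarrow> 'o \<Rightarrow> 'o \<Rightarrow> nat" where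
  "dim_Mor C X Y = (LEAST n. \<exists>B. finite_spanning C X Y B \<and> card B = n)"


section \<open>Abelian and semisimple categories\<close>

definition is_zero_obj :: "('o, 'm, 'k) lin_tensor_cat \<Rightarrow> 'o \<Rightarrow> bool" where
  "is_zero_obj C Z \<longleftrightarrow> Z \<in> obj C \<and>
     (\<forall>X \<in> obj C. (\<exists>!f. f \<in> Mor C X Z) \<and> (\<exists>!f. f \<in> Mor C Z X))"

definition is_biproduct :: "('o, 'm, 'k) lin_tensor_cat \<Rightarrow> 'o \<Rightarrow> 'o \<Rightarrow> 'o \<Rightarrow> bool" where
  "is_biproduct C Z X Y \<longleftrightarrow>
     (\<exists>i \<in> Mor C X Z. \<exists>j \<in> Mor C Y Z. \<exists>p \<in> Mor C Z X. \<exists>q \<in> Mor C Z Y.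
        p \<cdot>\<^bsub>C\<^esub> i = idn C X \<and> q \<cdot>\<^bsub>C\<^esub> j = idn C Y \<and>
        p \<cdot>\<^bsub>C\<^esub> j = hzero C Y X \<and> q \<cdot>\<^bsub>C\<^esub> i = hzero C X Y \<and>
        (i \<cdot>\<^bsub>C\<^esub> p) \<boxplus>\<^bsub>C\<^esub> (j \<cdot>\<^bsub>C\<^esub> q) = idn C Z)"

primrec direct_sum :: "('o, 'm, 'k) lin_tensor_cat \<Rightarrow> 'o \<Rightarrow> 'o list \<Rightarrow> bool" where
  "direct_sum C Z [] \<longleftrightarrow> is_zero_obj C Z"
| "direct_sum C Z (X # Xs) = (\<exists>Y. is_biproduct C Z X Y \<and> direct_sum C Y Xs)"

definition is_kernel :: "('o, 'm, 'k) lin_tensor_cat \<Rightarrow> 'm \<Rightarrow> 'm \<Rightarrow> bool" where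
  "is_kernel C f k \<longleftrightarrow> f \<in> arr C \<and> k \<in> Mor C (src C k) (src C f) \<and>
     f \<cdot>\<^bsub>C\<^esub> k = hzero C (src C k) (tgt C f) \<and>
     (\<forall>W. \<forall>h \<in> Mor C W (src C f). f \<cdot>\<^bsub>C\<^esub> h = hzero C W (tgt C f) \<longrightarrow>
        (\<exists>!u. u \<in> Mor C W (src C k) \<and> k \<cdot>\<^bsub>C\<^esub> u = h))"

definition is_cokernel :: "('o, 'm, 'k) lin_tensor_cat \<Rightarrow> 'm \<Rightarrow> 'm \<Rightarrow> bool" where
  "is_cokernel C f c \<longleftrightarrow> f \<in> arr C \<and> c \<in> Mor C (tgt C f) (tgt C c) \<and>
     c \<cdot>\<^bsub>C\<^esub> f = hzero C (src C f) (tgt C c) \<and>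
     (\<forall>W. \<forall>h \<in> Mor C (tgt C f) W. h \<cdot>\<^bsub>C\<^esub> f = hzero C (src C f) W \<longrightarrow>
        (\<exists>!u. u \<in> Mor C (tgt C c) W \<and> u \<cdot>\<^bsub>C\<^esub> c = h))"

locale abelian_category = linear_category C
  for C :: "('o, 'm, 'k::field) lin_tensor_cat" (structure) +
  assumes ex_zero_obj: "\<exists>Z. is_zero_obj C Z"
    and ex_biproduct: "X \<in> obj C \<Longrightarrow> Y \<in> obj C \<Longrightarrow> \<exists>Z. is_biproduct C Z X Y"
    and ex_kernel: "f \<in> arr C \<Longrightarrow> \<exists>k. is_kernel C f k"
    and ex_cokernel: "f \<in> arr C \<Longrightarrow> \<exists>c. is_cokernel C f c"
    and mono_normal: "is_mono C f \<Longrightarrow> \<exists>g. is_kernel C g f"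
    and epi_normal: "is_epi C f \<Longrightarrow> \<exists>g. is_cokernel C g f"

definition simple :: "('o, 'm, 'k) lin_tensor_cat \<Rightarrow> 'o \<Rightarrow> bool" where
  "simple C X \<longleftrightarrow> X \<in> obj C \<and> \<not> is_zero_obj C X \<and>
     (\<forall>m. is_mono C m \<and> tgt C m = X \<longrightarrow> is_zero_obj C (src C m) \<or> is_iso C m)"

locale semisimple_category = abelian_category C
  for C :: "('o, 'm, 'k::field) lin_tensor_cat" (structure) +
  assumes semisimple: "X \<in> obj C \<Longrightarrow> \<exists>Xs. (\<forall>S \<in> set Xs. simple C S) \<and> direct_sum C X Xs"


section \<open>Tensor product and duals\<close>

locale linear_monoidal_category = linear_category C
  for C :: "('o, 'm, 'k::field) lin_tensor_cat" (structure) +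
  assumes unit_obj: "unit_obj C \<in> obj C"
    and tobj_obj: "X \<in> obj C \<Longrightarrow> Y \<in> obj C \<Longrightarrow> X \<boxtimes> Y \<in> obj C"
    and tarr_Mor: "f \<in> Mor C X X' \<Longrightarrow> g \<in> Mor C Y Y' \<Longrightarrow> f \<star> g \<in> Mor C (X \<boxtimes> Y) (X' \<boxtimes> Y')"
    and tarr_idn: "X \<in> obj C \<Longrightarrow> Y \<in> obj C \<Longrightarrow> idn C X \<star> idn C Y = idn C (X \<boxtimes> Y)"
    and tarr_cmp: "f \<in> Mor C X X' \<Longrightarrow> f' \<in> Mor C X' X'' \<Longrightarrow> g \<in> Mor C Y Y' \<Longrightarrow> g' \<in> Mor C Y' Y'' \<Longrightarrow>
          (f' \<cdot> f) \<star> (g' \<cdot> g) = (f' \<star> g') \<cdot> (f \<star> g)"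
    and tarr_add_left: "f \<in> Mor C X X' \<Longrightarrow> f' \<in> Mor C X X' \<Longrightarrow> g \<in> Mor C Y Y' \<Longrightarrow>
          (f \<boxplus> f') \<star> g = (f \<star> g) \<boxplus> (f' \<star> g)"
    and tarr_add_right: "f \<in> Mor C X X' \<Longrightarrow> g \<in> Mor C Y Y' \<Longrightarrow> g' \<in> Mor C Y Y' \<Longrightarrow>
          f \<star> (g \<boxplus> g') = (f \<star> g) \<boxplus> (f \<star> g')"
    and tarr_scale_left: "f \<in> Mor C X X' \<Longrightarrow> g \<in> Mor C Y Y' \<Longrightarrow>
          hscale C a f \<star> g = hscale C a (f \<star> g)"
    and tarr_scale_right: "f \<in> Mor C X X' \<Longrightarrow> g \<in> Mor C Y Y' \<Longrightarrow>
          f \<star> hscale C a g = hscale C a (f \<star> g)"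
    and assoc_Mor: "X \<in> obj C \<Longrightarrow> Y \<in> obj C \<Longrightarrow> Z \<in> obj C \<Longrightarrow>
          assoc C X Y Z \<in> Mor C ((X \<boxtimes> Y) \<boxtimes> Z) (X \<boxtimes> (Y \<boxtimes> Z))"
    and assoc_iso: "X \<in> obj C \<Longrightarrow> Y \<in> obj C \<Longrightarrow> Z \<in> obj C \<Longrightarrow> is_iso C (assoc C X Y Z)"
    and assoc_natural: "f \<in> Mor C X X' \<Longrightarrow> g \<in> Mor C Y Y' \<Longrightarrow> h \<in> Mor C Z Z' \<Longrightarrow>
          assoc C X' Y' Z' \<cdot> ((f \<star> g) \<star> h) = (f \<star> (g \<star> h)) \<cdot> assoc C X Y Z"
    and lun_Mor: "X \<in> obj C \<Longrightarrow> lun C X \<in> Mor C (unit_obj C \<boxtimes> X) X"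
    and lun_iso: "X \<in> obj C \<Longrightarrow> is_iso C (lun C X)"
    and lun_natural: "f \<in> Mor C X Y \<Longrightarrow> lun C Y \<cdot> (idn C (unit_obj C) \<star> f) = f \<cdot> lun C X"
    and run_Mor: "X \<in> obj C \<Longrightarrow> run C X \<in> Mor C (X \<boxtimes> unit_obj C) X"
    and run_iso: "X \<in> obj C \<Longrightarrow> is_iso C (run C X)"
    and run_natural: "f \<in> Mor C X Y \<Longrightarrow> run C Y \<cdot> (f \<star> idn C (unit_obj C)) = f \<cdot> run C X"
    and pentagon: "W \<in> obj C \<Longrightarrow> X \<in> obj C \<Longrightarrow> Y \<in> obj C \<Longrightarrow> Z \<in> obj C \<Longrightarrow>
          (idn C W \<star> assoc C X Y Z) \<cdot> (assoc C W (X \<boxtimes> Y) Z \<cdot> (assoc C W X Y \<star> idn C Z)) =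
          assoc C W X (Y \<boxtimes> Z) \<cdot> assoc C (W \<boxtimes> X) Y Z"
    and triangle: "X \<in> obj C \<Longrightarrow> Y \<in> obj C \<Longrightarrow>
          (idn C X \<star> lun C Y) \<cdot> assoc C X (unit_obj C) Y = run C X \<star> idn C Y"

text \<open>
  \<open>is_dual C X Y\<close> says that \<open>Y\<close> is a (left) dual \<open>X\<^sup>*\<close> of \<open>X\<close>, with evaluation
  \<open>Y \<boxtimes> X \<rightarrow> \<one>\<close> and coevaluation \<open>\<one> \<rightarrow> X \<boxtimes> Y\<close>; equivalently, \<open>X\<close> is a right dual of \<open>Y\<close>.
  Duals are unique up to isomorphism, so everything below quantifies over this relation
  instead of fixing a choice of dual objects.
\<close>

definition is_dual :: "('o, 'm, 'k) lin_tensor_cat \<Rightarrow> 'o \<Rightarrow> 'o \<Rightarrow> bool" where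
  "is_dual C X Y \<longleftrightarrow> X \<in> obj C \<and> Y \<in> obj C \<and>
     (\<exists>ev \<in> Mor C (Y \<boxtimes>\<^bsub>C\<^esub> X) (unit_obj C). \<exists>coev \<in> Mor C (unit_obj C) (X \<boxtimes>\<^bsub>C\<^esub> Y).
        run C X \<cdot>\<^bsub>C\<^esub> (idn C X \<star>\<^bsub>C\<^esub> ev) \<cdot>\<^bsub>C\<^esub> assoc C X Y X \<cdot>\<^bsub>C\<^esub> (coev \<star>\<^bsub>C\<^esub> idn C X)
          \<cdot>\<^bsub>C\<^esub> inv_arr C (lun C X) = idn C X \<and>
        lun C Y \<cdot>\<^bsub>C\<^esub> (ev \<star>\<^bsub>C\<^esub> idn C Y) \<cdot>\<^bsub>C\<^esub> inv_arr C (assoc C Y X Y) \<cdot>\<^bsub>C\<^esub> (idn C Y \<star>\<^bsub>C\<^esub> coev)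
          \<cdot>\<^bsub>C\<^esub> inv_arr C (run C Y) = idn C Y)"

definition self_dual :: "('o, 'm, 'k) lin_tensor_cat \<Rightarrow> 'o \<Rightarrow> bool" where
  "self_dual C X \<longleftrightarrow> (\<exists>Y. is_dual C X Y \<and> isomorphic C X Y)"


section \<open>Fusion categories\<close>

locale fusion_category =
  semisimple_category C + linear_monoidal_category C
  for C :: "('o, 'm, 'k::{alg_closed_field, field_char_0}) lin_tensor_cat" (structure) +
  assumes left_rigid: "X \<in> obj C \<Longrightarrow> \<exists>Y. is_dual C X Y"
    and right_rigid: "X \<in> obj C \<Longrightarrow> \<exists>Y. is_dual C Y X"
    and finite_simples: "\<exists>F. finite F \<and> (\<forall>X. simple C X \<longrightarrow> (\<exists>Y \<in> F. isomorphic C X Y))"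
    and finite_dim_Mor: "X \<in> obj C \<Longrightarrow> Y \<in> obj C \<Longrightarrow> \<exists>B. finite_spanning C X Y B"
    and simple_unit: "simple C (unit_obj C)"

text \<open>The multiplicity of the simple object \<open>S\<close> in \<open>X\<close>.\<close>

definition mult_in :: "('o, 'm, 'k) lin_tensor_cat \<Rightarrow> 'o \<Rightarrow> 'o \<Rightarrow> nat" where
  "mult_in C S X = dim_Mor C S X"

primrec tensor_power :: "('o, 'm, 'k) lin_tensor_cat \<Rightarrow> 'o \<Rightarrow> nat \<Rightarrow> 'o" where
  "tensor_power C X 0 = unit_obj C"
| "tensor_power C X (Suc n) = tensor_power C X n \<boxtimes>\<^bsub>C\<^esub> X"

text \<open>
  Every nonzero object of a fusion category has a finite order, so the value \<open>0\<close> is never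
  taken there; it plays the role of an infinite order, as for group elements.
\<close>

definition obj_order :: "('o, 'm, 'k) lin_tensor_cat \<Rightarrow> 'o \<Rightarrow> nat" where
  "obj_order C X =
     (if \<exists>n\<ge>1. mult_in C (unit_obj C) (tensor_power C X n) > 0
      then LEAST n. n \<ge> 1 \<and> mult_in C (unit_obj C) (tensor_power C X n) > 0
      else 0)"


section \<open>Fusion subcategories, the adjoint subcategory and nilpotency\<close>

text \<open>
  Full subcategories are given by sets of objects. Stability under subobjects includes
  stability under isomorphisms.
\<close>

definition fusion_subcategory :: "('o, 'm, 'k) lin_tensor_cat \<Rightarrow> 'o set \<Rightarrow> bool" where
  "fusion_subcategory C D \<longleftrightarrow> D \<subseteq> obj C \<and> unit_obj C \<in> D \<and>
     (\<forall>X \<in> D. \<forall>Y \<in> D. X \<boxtimes>\<^bsub>C\<^esub> Y \<in> D) \<and>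
     (\<forall>X \<in> D. \<forall>Y \<in> D. \<forall>Z. is_biproduct C Z X Y \<longrightarrow> Z \<in> D) \<and>
     (\<forall>m. is_mono C m \<and> tgt C m \<in> D \<longrightarrow> src C m \<in> D)"

definition adjoint_objs :: "('o, 'm, 'k) lin_tensor_cat \<Rightarrow> 'o set" where
  "adjoint_objs C =
     \<Inter> {D. fusion_subcategory C D \<and> (\<forall>X Y. simple C X \<and> is_dual C X Y \<longrightarrow> X \<boxtimes>\<^bsub>C\<^esub> Y \<in> D)}"

definition full_subcategory ::
    "('o, 'm, 'k) lin_tensor_cat \<Rightarrow> 'o set \<Rightarrow> ('o, 'm, 'k) lin_tensor_cat" where
  "full_subcategory C D = C\<lparr>obj := D, arr := {f \<in> arr C. src C f \<in> D \<and> tgt C f \<in> D}\<rparr>"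

definition adjoint_subcategory ::
    "('o, 'm, 'k) lin_tensor_cat \<Rightarrow> ('o, 'm, 'k) lin_tensor_cat" where
  "adjoint_subcategory C = full_subcategory C (adjoint_objs C)"

primrec iterated_adjoint ::
    "('o, 'm, 'k) lin_tensor_cat \<Rightarrow> nat \<Rightarrow> ('o, 'm, 'k) lin_tensor_cat" where
  "iterated_adjoint C 0 = C"
| "iterated_adjoint C (Suc n) = adjoint_subcategory (iterated_adjoint C n)"

text \<open>A fusion category is \<open>Vec\<^sub>k\<close> if all its objects are multiples of the unit object.\<close>

definition is_Vec :: "('o, 'm, 'k) lin_tensor_cat \<Rightarrow> bool" where
  "is_Vec C \<longleftrightarrow> (\<forall>X \<in> obj C. \<exists>n. direct_sum C X (replicate n (unit_obj C)))"

definition nilpotent_category :: "('o, 'm, 'k) lin_tensor_cat \<Rightarrow> bool" where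
  "nilpotent_category C \<longleftrightarrow> (\<exists>n. is_Vec (iterated_adjoint C n))"


section \<open>Gradings\<close>

definition full_abelian_subcategory :: "('o, 'm, 'k) lin_tensor_cat \<Rightarrow> 'o set \<Rightarrow> bool" where
  "full_abelian_subcategory C D \<longleftrightarrow> D \<subseteq> obj C \<and>
     (\<forall>X \<in> D. \<forall>Y. isomorphic C X Y \<longrightarrow> Y \<in> D) \<and>
     (\<forall>Z. is_zero_obj C Z \<longrightarrow> Z \<in> D) \<and>
     (\<forall>X \<in> D. \<forall>Y \<in> D. \<forall>Z. is_biproduct C Z X Y \<longrightarrow> Z \<in> D) \<and>
     (\<forall>X \<in> D. \<forall>Y \<in> D. \<forall>f \<in> Mor C X Y.
        (\<forall>k. is_kernel C f k \<longrightarrow> src C k \<in> D) \<and> (\<forall>c. is_cokernel C f c \<longrightarrow> tgt C c \<in> D))"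

text \<open>The objects that are direct sums of objects \<open>F g\<close> of \<open>D g\<close>, for finitely many \<open>g \<in> S\<close>.\<close>

definition sum_of_components ::
    "('o, 'm, 'k) lin_tensor_cat \<Rightarrow> ('g \<Rightarrow> 'o set) \<Rightarrow> 'g set \<Rightarrow> 'o set" where
  "sum_of_components C D S =
     {X \<in> obj C. \<exists>gs F. distinct gs \<and> set gs \<subseteq> S \<and> (\<forall>g \<in> set gs. F g \<in> D g) \<and>
        direct_sum C X (map F gs)}"

definition grading ::
    "('o, 'm, 'k) lin_tensor_cat \<Rightarrow> 'g monoid \<Rightarrow> ('g \<Rightarrow> 'o set) \<Rightarrow> bool" where
  "grading C G D \<longleftrightarrow> group G \<and>
     (\<forall>g \<in> carrier G. full_abelian_subcategory C (D g)) \<and>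
     sum_of_components C D (carrier G) = obj C \<and>
     (\<forall>g \<in> carrier G. \<forall>h \<in> carrier G. g \<noteq> h \<longrightarrow>
        (\<forall>X \<in> D g. \<forall>Y \<in> D h. Mor C X Y = {hzero C X Y})) \<and>
     (\<forall>g \<in> carrier G. {Y. \<exists>X \<in> D g. is_dual C X Y} = D (inv\<^bsub>G\<^esub> g)) \<and>
     (\<forall>g \<in> carrier G. \<forall>h \<in> carrier G. \<forall>X \<in> D g. \<forall>Y \<in> D h. X \<boxtimes>\<^bsub>C\<^esub> Y \<in> D (g \<otimes>\<^bsub>G\<^esub> h))"

definition faithful_grading ::
    "('o, 'm, 'k) lin_tensor_cat \<Rightarrow> 'g monoid \<Rightarrow> ('g \<Rightarrow> 'o set) \<Rightarrow> bool" where
  "faithful_grading C G D \<longleftrightarrow> grading C G D \<and>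
     (\<forall>g \<in> carrier G. \<exists>X \<in> D g. \<not> is_zero_obj C X)"

text \<open>
  \<open>universal_grading C U D\<close> says that \<open>U\<close> is the universal grading group \<open>U(C)\<close> and \<open>D\<close> the
  universal grading. Test groups \<open>H\<close> with carrier in \<open>nat\<close> suffice: the degrees of the finitely
  many simple objects generate a countable subgroup of \<open>H\<close>, outside of which a grading
  vanishes, and by faithfulness any homomorphism from \<open>U\<close> inducing the grading has its values
  in this subgroup.
\<close>

definition universal_grading ::
    "('o, 'm, 'k) lin_tensor_cat \<Rightarrow> 'g monoid \<Rightarrow> ('g \<Rightarrow> 'o set) \<Rightarrow> bool" where
  "universal_grading C U D \<longleftrightarrow> faithful_grading C U D \<and> D \<one>\<^bsub>U\<^esub> = adjoint_objs C \<and>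
     (\<forall>(H :: nat monoid) E. grading C H E \<longrightarrow>
        (\<exists>\<phi> \<in> hom U H.
           (\<forall>h \<in> carrier H. E h = sum_of_components C D {g \<in> carrier U. \<phi> g = h}) \<and>
           (\<forall>\<psi> \<in> hom U H.
              (\<forall>h \<in> carrier H. E h = sum_of_components C D {g \<in> carrier U. \<psi> g = h}) \<longrightarrow>
              (\<forall>g \<in> carrier U. \<psi> g = \<phi> g))))"

definition group_exponent :: "('g, 'b) monoid_scheme \<Rightarrow> nat" where
  "group_exponent G =
     (if \<exists>n::nat\<ge>1. \<forall>x \<in> carrier G. x [^]\<^bsub>G\<^esub> n = \<one>\<^bsub>G\<^esub>
      then LEAST n::nat. n \<ge> 1 \<and> (\<forall>x \<in> carrier G. x [^]\<^bsub>G\<^esub> n = \<one>\<^bsub>G\<^esub>)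
      else 0)"

definition elementary_abelian_2_group :: "('g, 'b) monoid_scheme \<Rightarrow> bool" where
  "elementary_abelian_2_group G \<longleftrightarrow>
     comm_group G \<and> (\<forall>x \<in> carrier G. x \<otimes>\<^bsub>G\<^esub> x = \<one>\<^bsub>G\<^esub>)"


section \<open>Frobenius-Perron dimension\<close>

definition is_irr_list :: "('o, 'm, 'k) lin_tensor_cat \<Rightarrow> 'o list \<Rightarrow> bool" where
  "is_irr_list C Xs \<longleftrightarrow> (\<forall>X \<in> set Xs. simple C X) \<and>
     (\<forall>i < length Xs. \<forall>j < length Xs. isomorphic C (Xs ! i) (Xs ! j) \<longrightarrow> i = j) \<and>
     (\<forall>X. simple C X \<longrightarrow> (\<exists>Y \<in> set Xs. isomorphic C X Y))"

text \<open>
  A choice of representatives of the isomorphism classes of simple objects. Another choice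
  permutes the rows and columns of the matrices below, which does not affect eigenvalues.
\<close>

definition irr_list :: "('o, 'm, 'k) lin_tensor_cat \<Rightarrow> 'o list" where
  "irr_list C = (SOME Xs. is_irr_list C Xs)"

text \<open>The matrix of left multiplication by \<open>X\<close> on the Grothendieck ring.\<close>

definition fusion_matrix :: "('o, 'm, 'k) lin_tensor_cat \<Rightarrow> 'o \<Rightarrow> real mat" where
  "fusion_matrix C X =
     (let Xs = irr_list C in
        mat (length Xs) (length Xs) (\<lambda>(i, j). real (mult_in C (Xs ! i) (X \<boxtimes>\<^bsub>C\<^esub> (Xs ! j)))))"

definition FPdim_obj :: "('o, 'm, 'k) lin_tensor_cat \<Rightarrow> 'o \<Rightarrow> real" where
  "FPdim_obj C X = Max {r. r \<ge> 0 \<and> eigenvalue (fusion_matrix C X) r}"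

definition FPdim :: "('o, 'm, 'k) lin_tensor_cat \<Rightarrow> real" where
  "FPdim C = (\<Sum>X \<leftarrow> irr_list C. (FPdim_obj C X)\<^sup>2)"

end

theory Submission
  imports
    Defs
    "HOL-Analysis.Function_Topology"
    "HOL-Algebra.Sylow"
begin

text \<open>
  For part (i), let \<open>g\<close> be an element of the grading group. The component
  of degree \<open>g\<close> contains a nonzero object \<open>X\<close>, and \<open>X\<close> has a simple direct summand \<open>S\<close>. If \<open>\<one>\<close> occurs in
  \<open>S\<^sup>m\<close>, then it occurs in \<open>X\<^sup>m\<close>, which has degree \<open>g\<^sup>m\<close>; since there are no nonzero morphisms between
  components of different degrees and \<open>\<one>\<close> has degree \<open>1\<close>, this forces \<open>g\<^sup>m = 1\<close>
  (\<open>degree_one_if_unit_occurs\<close>). Taking for \<open>m\<close> the order of \<open>S\<close> gives the statement on the exponent.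
  If \<open>S\<close> is self-dual, then \<open>\<one>\<close> occurs in \<open>S \<otimes> S\<close>, so that \<open>g\<^sup>2 = 1\<close>.

  For part (ii) one shows \<open>FPdim C = |G| \<cdot> FPdim C\<^sub>a\<^sub>d\<close> for a group \<open>G\<close> in which the order of every element
  divides the order of a simple object, and then descends along the adjoint series. All of this takes
  place in the Grothendieck ring, a finite based ring with nonnegative structure constants \<open>N\<close>.

  The sum of all basis elements acts on the ring by a symmetric matrix with positive entries. Its top
  eigenvector is positive and unique up to a scalar (\<open>positive_symmetric_eigenvector\<close>), and right
  multiplications commute with this action, so each of them rescales the eigenvector. The scalars form a
  positive character \<open>d\<close> of the ring (\<open>ex_dim_character\<close>), and \<open>d\<close> is the Frobenius-Perron dimension
  (\<open>FPdim_obj_eq\<close>). Let \<open>S\<close> be a based subring and \<open>A\<close> its adjoint subring, generated by the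
  constituents of all \<open>z z\<^sup>*\<close>. Then \<open>A\<close> is normal in \<open>S\<close>, the cosets \<open>A x\<close> form a group under the product
  of supports (\<open>group_coset_group\<close>), and every coset has the same total dimension
  \<open>\<Sum>(d k)\<^sup>2\<close> (\<open>coset_dimension\<close>). If \<open>\<one>\<close> occurs in \<open>x\<^sup>n\<close>, then the coset of \<open>x\<close> has order dividing \<open>n\<close>.
  So if all orders are powers of \<open>p\<close>, then the group of cosets is a \<open>p\<close>-group by Cauchy's theorem, and
  the dimensions of \<open>S\<close> and of \<open>A\<close> differ by a power of \<open>p\<close> (\<open>dimension_prime_power_multiple\<close>).
  For a nilpotent category the series ends with the trivial subring, whose dimension is \<open>1\<close>.

  The category enters through the dimensions of its Hom spaces. Every function on objects that is
  additive on biproducts is determined by its values on simple objects (\<open>additive_decomposition\<close>), and by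
  Schur's lemma the coefficients are dimensions of Hom spaces. This yields the associativity of \<open>N\<close> and,
  together with the adjunction between \<open>X\<^sup>* \<otimes> -\<close> and \<open>X \<otimes> -\<close> (\<open>dual_adjunction\<close>), the symmetry
  \<open>N i j k = N i\<^sup>* k j\<close>, from which all other properties of the duality follow. A fusion subcategory is
  determined by the simple objects in it, and the adjoint subcategory corresponds to the adjoint subring
  (\<open>simples_in_adjoint\<close>).
\<close>

section \<open>Groups with restrictions on the orders of elements\<close>

text \<open>
  If \<open>m\<close> is the least exponent, then \<open>n mod m\<close> is again an exponent and smaller than \<open>m\<close>, so it vanishes.
  For \<open>n = 0\<close> the conclusion is trivial.
\<close>

lemma (in group) exponent_dvd:
  assumes "\<And>x. x \<in> carrier G \<Longrightarrow> x [^] (n::nat) = \<one>"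
  shows "group_exponent G dvd n"
proof (cases "n = 0")
  case False
  let ?P = "\<lambda>m::nat. m \<ge> 1 \<and> (\<forall>x \<in> carrier G. x [^] m = \<one>)"
  define m where "m = group_exponent G"
  have ex: "\<exists>m. ?P m" using assms False by (intro exI[of _ n]) auto
  then have m: "m = (LEAST m. ?P m)" by (simp add: m_def group_exponent_def)
  have Pm: "?P m" unfolding m using ex by (rule LeastI_ex)
  have "x [^] (n mod m) = \<one>" if x: "x \<in> carrier G" for x
  proof -
    have "x [^] n = x [^] (m * (n div m) + n mod m)" by simp
    also have "\<dots> = (x [^] m) [^] (n div m) \<otimes> x [^] (n mod m)"
      using x by (simp only: nat_pow_mult[symmetric] nat_pow_pow)
    finally show ?thesis using x Pm assms[OF x] by simp
  qed
  moreover have "n mod m < m" using Pm by simp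
  ultimately have "\<not> n mod m \<ge> 1" using not_less_Least[of "n mod m" ?P] m by auto
  then have "n mod m = 0" by simp
  then show ?thesis unfolding m_def[symmetric] by (simp only: dvd_eq_mod_eq_0)
qed simp

lemma (in group) elementary_abelian_2_groupI:
  assumes sq: "\<And>x. x \<in> carrier G \<Longrightarrow> x \<otimes> x = \<one>"
  shows "elementary_abelian_2_group G"
proof -
  have inv: "inv x = x" if "x \<in> carrier G" for x using that sq by (intro inv_equality)
  have "x \<otimes> y = y \<otimes> x" if xy: "x \<in> carrier G" "y \<in> carrier G" for x y
    using inv[of "x \<otimes> y"] inv_mult_group[OF xy] inv[OF xy(1)] inv[OF xy(2)] xy by simp
  then have "comm_group G" by (rule group_comm_groupI)
  then show ?thesis using sq by (simp add: elementary_abelian_2_group_def)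
qed

text \<open>
  Cauchy's argument: a prime divisor \<open>q \<noteq> p\<close> of the order would give a subgroup of order \<open>q\<close>, hence a
  nontrivial element whose order divides both \<open>q\<close> and a power of \<open>p\<close>.
\<close>

lemma (in group) order_prime_power:
  assumes p: "prime (p::nat)" and fin: "finite (carrier G)"
    and ppow: "\<And>x. x \<in> carrier G \<Longrightarrow> \<exists>a. x [^] (p ^ a) = \<one>"
  shows "\<exists>m. Coset.order G = p ^ m"
proof -
  have "Coset.order G > 0" using fin by (simp add: order_gt_0_iff_finite)
  then obtain m n where n: "Coset.order G = p ^ m * n" "\<not> p dvd n"
    using multiplicity_decompose'[of "Coset.order G" p] p by (metis mult.commute not_prime_unit neq0_conv)
  have "n = 1"
  proof (rule ccontr)
    assume "n \<noteq> 1"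
    then obtain q where q: "prime q" "q dvd n" using prime_factor_nat by blast
    have "q \<noteq> p" using q n by blast
    obtain l where "Coset.order G = q ^ 1 * l" using n q by (auto simp: dvd_def mult_ac)
    then obtain H where H: "subgroup H G" "card H = q"
      using sylow_thm[of q G 1 l] q(1) fin is_group by auto
    interpret H: group "G\<lparr>carrier := H\<rparr>" using H(1) subgroup_imp_group by blast
    have "H \<noteq> {\<one>}" using H(2) q(1) by auto
    then obtain x where x: "x \<in> H" "x \<noteq> \<one>" using subgroup.one_closed[OF H(1)] by blast
    have xG: "x \<in> carrier G" using x subgroup.mem_carrier[OF H(1)] by blast
    have "x [^] q = \<one>"
      using H.pow_order_eq_1[of x] x H by (simp add: Coset.order_def nat_pow_consistent[symmetric])
    then have "ord x dvd q" using xG pow_eq_id by blast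
    moreover obtain a where "x [^] (p ^ a) = \<one>" using ppow xG by blast
    then have "ord x dvd p ^ a" using xG pow_eq_id by blast
    moreover have "coprime q (p ^ a)"
      using q p \<open>q \<noteq> p\<close> by (simp add: primes_coprime)
    ultimately have "ord x = 1" by (meson coprime_common_divisor_nat nat_dvd_1_iff_1 coprime_def)
    then show False using x xG ord_eq_1 by blast
  qed
  then show ?thesis using n by auto
qed

section \<open>Positive symmetric matrices\<close>

text \<open>
  In the product topology on functions, the unit sphere of those supported in \<open>I\<close> is a closed subset of a product of
  compact intervals, one for each index, with a single point at the indices outside \<open>I\<close>.
\<close>

lemma compact_unit_sphere_functions:
  fixes I :: "'a set"
  assumes fin: "finite I"
  shows "compact {w :: 'a \<Rightarrow> real. (\<forall>i. i \<notin> I \<longrightarrow> w i = 0) \<and> (\<Sum>i\<in>I. (w i)\<^sup>2) = 1}"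
    (is "compact ?K")
proof -
  let ?box = "Pi\<^sub>E (UNIV :: 'a set) (\<lambda>i. if i \<in> I then {-1..1} else {0 :: real})"
  have "compactin (product_topology (\<lambda>i::'a. euclidean :: real topology) UNIV) ?box"
    unfolding compactin_PiE by auto
  then have box: "compact ?box"
    by (simp add: euclidean_product_topology)
  have "closed {w :: 'a \<Rightarrow> real. (\<Sum>i\<in>I. (w i)\<^sup>2) = 1}"
    by (intro closed_Collect_eq continuous_intros continuous_on_product_coordinates)
  then have cp: "compact (?box \<inter> {w. (\<Sum>i\<in>I. (w i)\<^sup>2) = 1})"
    by (rule compact_Int_closed[OF box])
  have bound: "\<bar>w i\<bar> \<le> 1" if "(\<Sum>i\<in>I. (w i)\<^sup>2) = 1" "i \<in> I" for w :: "'a \<Rightarrow> real" and i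
  proof -
    have "(w i)\<^sup>2 \<le> (\<Sum>i\<in>I. (w i)\<^sup>2)"
      by (rule member_le_sum) (use fin that in auto)
    then show ?thesis using that(1) by (simp add: abs_square_le_1)
  qed
  have "?K = ?box \<inter> {w. (\<Sum>i\<in>I. (w i)\<^sup>2) = 1}"
  proof (intro equalityI subsetI)
    fix w assume w: "w \<in> ?K"
    then have "w i \<in> {-1..1}" if "i \<in> I" for i
      using bound[of w i] that by (simp add: abs_le_iff)
    then show "w \<in> ?box \<inter> {w. (\<Sum>i\<in>I. (w i)\<^sup>2) = 1}"
      using w by (simp add: PiE_iff)
  next
    fix w assume w: "w \<in> ?box \<inter> {w. (\<Sum>i\<in>I. (w i)\<^sup>2) = 1}"
    then have "w i \<in> (if i \<in> I then {-1..1} else {0})" for i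
      by (simp add: PiE_iff)
    then have "w i = 0" if "i \<notin> I" for i
      using that by (metis singletonD)
    then show "w \<in> ?K" using w by simp
  qed
  then show ?thesis using cp by simp
qed

text \<open>
  The symmetric case of the Perron-Frobenius theorem, by Rayleigh quotients. The quadratic form \<open>q\<close>
  attains a maximum \<open>\<mu>\<close> on the unit sphere, and every vector where \<open>q w = \<mu> s w\<close> is an eigenvector.
  Passing to absolute values does not decrease \<open>q\<close>, so \<open>\<bar>w\<bar>\<close> is maximal as well, hence an eigenvector;
  since \<open>L\<close> has positive entries, a nonzero maximal vector has no zero entry at all. This gives positivity of
  \<open>v\<close>, and uniqueness, because subtracting a multiple of \<open>v\<close> produces an entry \<open>0\<close>.
\<close>

lemma positive_symmetric_eigenvector:
  fixes L :: "'a \<Rightarrow> 'a \<Rightarrow> real"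
  assumes fin: "finite I" and ne: "I \<noteq> {}"
    and sym: "\<And>i j. i \<in> I \<Longrightarrow> j \<in> I \<Longrightarrow> L i j = L j i"
    and pos: "\<And>i j. i \<in> I \<Longrightarrow> j \<in> I \<Longrightarrow> L i j > 0"
  shows "\<exists>\<mu> v. (\<forall>i\<in>I. v i > 0) \<and> (\<forall>i\<in>I. (\<Sum>j\<in>I. L i j * v j) = \<mu> * v i) \<and>
    (\<forall>w. (\<forall>i\<in>I. (\<Sum>j\<in>I. L i j * w j) = \<mu> * w i) \<longrightarrow> (\<exists>c. \<forall>i\<in>I. w i = c * v i))"
proof -
  define q where "q w = (\<Sum>i\<in>I. \<Sum>j\<in>I. L i j * w i * w j)" for w
  define s where "s w = (\<Sum>i\<in>I. (w i)\<^sup>2)" for w :: "'a \<Rightarrow> real"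
  define ap where "ap w i = (\<Sum>j\<in>I. L i j * w j)" for w i
  define K where "K = {w :: 'a \<Rightarrow> real. (\<forall>i. i \<notin> I \<longrightarrow> w i = 0) \<and> s w = 1}"
  have q_ap: "q w = (\<Sum>i\<in>I. w i * ap w i)" for w
    by (simp add: q_def ap_def sum_distrib_left mult_ac)
  obtain i0 where i0: "i0 \<in> I" using ne by blast
  have "compact K"
    unfolding K_def s_def by (rule compact_unit_sphere_functions[OF fin])
  moreover have "(\<lambda>i. if i = i0 then 1 else 0) \<in> K"
    using i0 fin by (auto simp: K_def s_def power2_eq_square if_distrib cong: if_cong)
  moreover have "continuous_on K q"
    unfolding q_def
    by (intro continuous_intros continuous_on_subset[OF continuous_on_product_coordinates subset_UNIV])
  ultimately obtain w0 where w0: "w0 \<in> K" and max: "\<And>w. w \<in> K \<Longrightarrow> q w \<le> q w0"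
    using continuous_attains_sup[of K q] by blast
  define \<mu> where "\<mu> = q w0"
  have s_nonneg: "s w \<ge> 0" for w unfolding s_def by (simp add: sum_nonneg)
  have s_zero: "s w = 0 \<longleftrightarrow> (\<forall>i\<in>I. w i = 0)" for w
    unfolding s_def using fin by (simp add: sum_nonneg_eq_0_iff)
  have rayleigh: "q w \<le> \<mu> * s w" for w
  proof (cases "s w = 0")
    case True
    then have "q w = 0" unfolding q_def using s_zero by (simp add: sum.neutral)
    then show ?thesis using True by simp
  next
    case False
    then have sp: "s w > 0" using s_nonneg[of w] by simp
    define w' where "w' i = (if i \<in> I then w i / sqrt (s w) else 0)" for i
    have "s w' = (\<Sum>i\<in>I. (w i)\<^sup>2 / s w)"
      unfolding s_def[of w'] w'_def by (intro sum.cong) (use sp in \<open>auto simp: power_divide\<close>)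
    also have "\<dots> = 1" using sp by (simp add: s_def sum_divide_distrib[symmetric])
    finally have "w' \<in> K" by (simp add: K_def w'_def)
    then have "q w' \<le> \<mu>" using max \<mu>_def by simp
    moreover have "q w' = (\<Sum>i\<in>I. \<Sum>j\<in>I. L i j * w i * w j / s w)"
      unfolding q_def w'_def by (intro sum.cong refl) (use sp in \<open>auto simp: field_simps\<close>)
    then have "q w' = q w / s w"
      by (simp add: q_def sum_divide_distrib)
    ultimately show ?thesis using sp by (simp add: field_simps)
  qed
  \<comment> \<open>At a maximal vector the residual \<open>r\<close> is the gradient; moving a little along it would increase the form.\<close>
  have crit: "ap w i = \<mu> * w i" if eq: "q w = \<mu> * s w" and i: "i \<in> I" for w i
  proof -
    define r where "r i = ap w i - \<mu> * w i" for i
    define S where "S = (\<Sum>i\<in>I. (r i)\<^sup>2)"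
    define c where "c = q r - \<mu> * s r"
    have expand: "q (\<lambda>i. w i + t * r i) - \<mu> * s (\<lambda>i. w i + t * r i) = 2 * t * S + t\<^sup>2 * c" for t
    proof -
      have sw: "(\<Sum>i\<in>I. w i * ap r i) = (\<Sum>i\<in>I. r i * ap w i)"
        unfolding ap_def sum_distrib_left
        by (subst sum.swap, intro sum.cong refl) (simp add: sym mult_ac)
      have "ap (\<lambda>i. w i + t * r i) i = ap w i + t * ap r i" for i
        by (simp add: ap_def algebra_simps sum.distrib sum_distrib_left)
      then have "q (\<lambda>i. w i + t * r i)
          = q w + t * (\<Sum>i\<in>I. r i * ap w i) + t * (\<Sum>i\<in>I. w i * ap r i) + t\<^sup>2 * q r"
        by (simp add: q_ap algebra_simps sum.distrib sum_distrib_left power2_eq_square)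
      moreover have "s (\<lambda>i. w i + t * r i) = s w + 2 * t * (\<Sum>i\<in>I. r i * w i) + t\<^sup>2 * s r"
        by (simp add: s_def algebra_simps sum.distrib sum_distrib_left power2_eq_square)
      moreover have "(\<Sum>i\<in>I. r i * ap w i) = S + \<mu> * (\<Sum>i\<in>I. r i * w i)"
        unfolding S_def sum_distrib_left sum.distrib[symmetric]
        by (intro sum.cong refl) (simp add: r_def power2_eq_square algebra_simps)
      ultimately show ?thesis using eq sw by (simp add: c_def algebra_simps)
    qed
    have le: "2 * S + t * c \<le> 0" if "t > 0" for t
    proof -
      have "t * (2 * S + t * c) \<le> 0"
        using expand[of t] rayleigh[of "\<lambda>i. w i + t * r i"]
        by (simp add: algebra_simps power2_eq_square)
      then show ?thesis using that by (simp add: mult_le_0_iff)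
    qed
    have "S \<le> 0"
    proof (rule ccontr)
      assume "\<not> S \<le> 0"
      then have S: "S > 0" by simp
      \<comment> \<open>This step length keeps the quadratic term below half of the linear one.\<close>
      have "2 * S + (S / (\<bar>c\<bar> + 1)) * c \<le> 0" by (rule le) (use S in auto)
      moreover have "\<bar>(S / (\<bar>c\<bar> + 1)) * c\<bar> \<le> S"
        using S by (simp add: abs_mult field_simps)
      ultimately show False using S by linarith
    qed
    then have "s r = 0" using s_nonneg[of r] by (simp add: S_def s_def)
    then show ?thesis using i s_zero by (simp add: r_def)
  qed
  have abs_crit: "q (\<lambda>i. \<bar>w i\<bar>) = \<mu> * s (\<lambda>i. \<bar>w i\<bar>)" if eq: "q w = \<mu> * s w" for w
  proof (rule antisym[OF rayleigh])
    have "q w \<le> q (\<lambda>i. \<bar>w i\<bar>)"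
      unfolding q_def
    proof (intro sum_mono)
      fix i j assume "i \<in> I" "j \<in> I"
      then have "L i j > 0" by (rule pos)
      then have "L i j * (w i * w j) \<le> L i j * (\<bar>w i\<bar> * \<bar>w j\<bar>)"
        by (intro mult_left_mono) (auto simp: abs_mult[symmetric])
      then show "L i j * w i * w j \<le> L i j * \<bar>w i\<bar> * \<bar>w j\<bar>" by (simp add: mult.assoc)
    qed
    then show "\<mu> * s (\<lambda>i. \<bar>w i\<bar>) \<le> q (\<lambda>i. \<bar>w i\<bar>)" using eq by (simp add: s_def)
  qed
  have nowhere_zero: "w i \<noteq> 0" if eq: "q w = \<mu> * s w" and "s w \<noteq> 0" and i: "i \<in> I" for w i
  proof -
    obtain k where k: "k \<in> I" "w k \<noteq> 0" using \<open>s w \<noteq> 0\<close> s_zero by blast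
    have "0 < ap (\<lambda>i. \<bar>w i\<bar>) i"
      unfolding ap_def
    proof (rule sum_pos2[OF fin k(1)])
      show "0 < L i k * \<bar>w k\<bar>" using k pos[OF i k(1)] by simp
      show "0 \<le> L i j * \<bar>w j\<bar>" if "j \<in> I" for j using pos[OF i that] by simp
    qed
    then show ?thesis using crit[OF abs_crit[OF eq] i] by auto
  qed
  have w0': "q w0 = \<mu> * s w0" "s w0 \<noteq> 0" using w0 by (auto simp: \<mu>_def K_def)
  define v where "v i = \<bar>w0 i\<bar>" for i
  have vpos: "v i > 0" if "i \<in> I" for i
    using nowhere_zero[OF w0' that] by (simp add: v_def)
  have veig: "ap v i = \<mu> * v i" if "i \<in> I" for i
    using crit[OF abs_crit[OF w0'(1)] that] by (simp add: v_def[abs_def])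
  have uniq: "\<exists>c. \<forall>i\<in>I. w i = c * v i" if weig: "\<And>i. i \<in> I \<Longrightarrow> ap w i = \<mu> * w i" for w
  proof -
    define x where "x i = w i - w i0 / v i0 * v i" for i
    have "ap x i = \<mu> * x i" if "i \<in> I" for i
    proof -
      have "ap x i = ap w i - w i0 / v i0 * ap v i"
        by (simp add: ap_def x_def algebra_simps sum_subtractf sum_distrib_left sum_divide_distrib)
      then show ?thesis using weig[OF that] veig[OF that] by (simp add: x_def algebra_simps)
    qed
    then have "q x = \<mu> * s x"
      by (simp add: q_ap s_def sum_distrib_left power2_eq_square mult_ac)
    moreover have "x i0 = 0" using vpos[OF i0] by (simp add: x_def)
    ultimately have "s x = 0" using nowhere_zero i0 by blast
    then show ?thesis using s_zero by (intro exI[of _ "w i0 / v i0"]) (simp add: x_def)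
  qed
  show ?thesis
    unfolding ap_def[symmetric]
    by (intro exI[of _ \<mu>] exI[of _ v] conjI ballI allI impI uniq vpos veig) auto
qed

section \<open>Based rings and their dimension character\<close>

text \<open>
  The Grothendieck ring in terms of its structure constants: \<open>N i j k\<close> is the multiplicity of \<open>k\<close> in
  the product of \<open>i\<close> and \<open>j\<close>. The last axiom is what an adjunction between multiplications by \<open>dual i\<close> and
  by \<open>i\<close> provides; with associativity it implies the usual axioms of a based ring, namely that
  \<open>dual\<close> is an anti-involution and that the unit occurs in \<open>i j\<close> only for \<open>j = dual i\<close>.
\<close>

locale based_ring =
  fixes I :: "'a set" and N :: "'a \<Rightarrow> 'a \<Rightarrow> 'a \<Rightarrow> nat" and e :: 'a and dual :: "'a \<Rightarrow> 'a"
  assumes finite_basis: "finite I"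
    and unit_in: "e \<in> I"
    and dual_in: "i \<in> I \<Longrightarrow> dual i \<in> I"
    and unit_left: "j \<in> I \<Longrightarrow> k \<in> I \<Longrightarrow> N e j k = (if j = k then 1 else 0)"
    and unit_right: "i \<in> I \<Longrightarrow> k \<in> I \<Longrightarrow> N i e k = (if i = k then 1 else 0)"
    and assoc: "i \<in> I \<Longrightarrow> j \<in> I \<Longrightarrow> k \<in> I \<Longrightarrow> l \<in> I \<Longrightarrow>
          (\<Sum>m\<in>I. N i j m * N m k l) = (\<Sum>m\<in>I. N j k m * N i m l)"
    and frobenius: "i \<in> I \<Longrightarrow> j \<in> I \<Longrightarrow> k \<in> I \<Longrightarrow> N i j k = N (dual i) k j"
begin

text \<open>
  Moving \<open>i\<close> to the other side twice turns the unit law \<open>N i e i = 1\<close> into \<open>N (dual (dual i)) e i = 1\<close>.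
\<close>

lemma dual_dual: assumes "i \<in> I" shows "dual (dual i) = i"
proof -
  have "N (dual i) i e = 1"
    using frobenius[of i e i] assms unit_in by (simp add: unit_right)
  moreover have "N (dual i) i e = N (dual (dual i)) e i"
    using frobenius[of "dual i" i e] assms unit_in dual_in by simp
  moreover have "N (dual (dual i)) e i = (if dual (dual i) = i then 1 else 0)"
    using assms by (intro unit_right dual_in)
  ultimately show ?thesis by (metis zero_neq_one)
qed

lemma dual_eq_iff: "i \<in> I \<Longrightarrow> j \<in> I \<Longrightarrow> dual i = j \<longleftrightarrow> i = dual j"
  using dual_dual by metis

lemma dual_bij: "bij_betw dual I I"
  by (rule bij_betwI[of _ _ _ dual]) (auto simp: dual_in dual_dual)

lemma coeff_unit: "i \<in> I \<Longrightarrow> j \<in> I \<Longrightarrow> N i j e = (if j = dual i then 1 else 0)"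
  using frobenius[of i j e] unit_in dual_in by (auto simp: unit_right)

text \<open>
  Both sides count the unit in the product of \<open>i\<close>, \<open>j\<close> and \<open>k\<close>, bracketed in the two possible ways.
\<close>

lemma cyclic:
  assumes "i \<in> I" "j \<in> I" "k \<in> I"
  shows "N i j (dual k) = N j k (dual i)"
proof -
  have "(\<Sum>m\<in>I. N i j m * N m k e) = (\<Sum>m\<in>I. if m = dual k then N i j m else 0)"
    using assms dual_eq_iff by (intro sum.cong) (auto simp: coeff_unit)
  also have "\<dots> = N i j (dual k)" using assms dual_in finite_basis by simp
  finally have "N i j (dual k) = (\<Sum>m\<in>I. N j k m * N i m e)"
    using assoc assms unit_in by simp
  also have "\<dots> = (\<Sum>m\<in>I. if m = dual i then N j k m else 0)"
    using assms by (intro sum.cong) (auto simp: coeff_unit)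
  also have "\<dots> = N j k (dual i)" using assms dual_in finite_basis by simp
  finally show ?thesis .
qed

lemma anti_involution:
  assumes "i \<in> I" "j \<in> I" "k \<in> I"
  shows "N i j k = N (dual j) (dual i) (dual k)"
  using cyclic[of i j "dual k"] frobenius[of j "dual k" "dual i"] assms
  by (simp add: dual_in dual_dual)

lemma frobenius_right:
  assumes "i \<in> I" "j \<in> I" "k \<in> I"
  shows "N i j k = N k (dual j) i"
  using anti_involution[of k "dual j" i] anti_involution[of i j k] frobenius[of j "dual k" "dual i"] assms
  by (simp add: dual_in dual_dual)

text \<open>
  Since all multiplicities are nonnegative, associativity passes from the structure constants to their
  supports.
\<close>

lemma support_assoc:
  assumes "i \<in> I" "j \<in> I" "k \<in> I" "l \<in> I"
  shows "(\<exists>m\<in>I. N i j m > 0 \<and> N m k l > 0) \<longleftrightarrow> (\<exists>m\<in>I. N j k m > 0 \<and> N i m l > 0)"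
proof -
  have "(\<exists>m\<in>I. N i j m > 0 \<and> N m k l > 0) \<longleftrightarrow> (\<Sum>m\<in>I. N i j m * N m k l) > 0"
    using finite_basis by (auto simp: sum_eq_0_iff simp flip: neq0_conv)
  also have "\<dots> \<longleftrightarrow> (\<Sum>m\<in>I. N j k m * N i m l) > 0"
    using assoc assms by simp
  also have "\<dots> \<longleftrightarrow> (\<exists>m\<in>I. N j k m > 0 \<and> N i m l > 0)"
    using finite_basis by (auto simp: sum_eq_0_iff simp flip: neq0_conv)
  finally show ?thesis .
qed

text \<open>
  Products do not vanish because \<open>dual i \<cdot> i \<cdot> j\<close> contains \<open>j\<close>.
\<close>

lemma ex_constituent: assumes "i \<in> I" "j \<in> I" shows "\<exists>k\<in>I. N i j k > 0"
proof -
  have "\<exists>m\<in>I. N (dual i) i m > 0 \<and> N m j j > 0"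
    using assms unit_in by (intro bexI[of _ e]) (auto simp: coeff_unit unit_left dual_dual dual_in)
  then show ?thesis using support_assoc[of "dual i" i j j] assms dual_in by blast
qed

lemma ex_left_factor: assumes "j \<in> I" "k \<in> I" shows "\<exists>i\<in>I. N i j k > 0"
proof -
  obtain i where "i \<in> I" "N k (dual j) i > 0"
    using ex_constituent[of k "dual j"] assms dual_in by blast
  then show ?thesis using frobenius_right[of i j k] assms by (intro bexI[of _ i]) auto
qed

lemma sum_over_duals: "(\<Sum>i\<in>I. f (dual i)) = (\<Sum>i\<in>I. f i)"
  using sum.reindex_bij_betw[OF dual_bij] by simp

definition dim_character :: "('a \<Rightarrow> real) \<Rightarrow> bool" where
  "dim_character d \<longleftrightarrow> (\<forall>i\<in>I. d i > 0) \<and> (\<forall>i\<in>I. d (dual i) = d i) \<and>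
     (\<forall>i\<in>I. \<forall>j\<in>I. d i * d j = (\<Sum>k\<in>I. real (N i j k) * d k))"

text \<open>
  The matrix \<open>L\<close> of multiplication by the sum of all basis elements is symmetric by Frobenius reciprocity and
  positive because every \<open>k\<close> occurs in some \<open>i j\<close>. Right multiplication \<open>R j\<close> commutes with it, so it
  maps the positive eigenvector \<open>v\<close> to a multiple \<open>d j\<close> of itself. Then \<open>d\<close> is multiplicative because \<open>R\<close> is,
  and invariant under duality because \<open>R (dual j)\<close> is the transpose of \<open>R j\<close>.
\<close>

theorem ex_dim_character: "\<exists>d. dim_character d"
proof -
  define L where "L k j = (\<Sum>i\<in>I. real (N i j k))" for k j
  have sym: "L k j = L j k" if "k \<in> I" "j \<in> I" for k j
  proof -
    have "L k j = (\<Sum>i\<in>I. real (N (dual i) k j))"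
      unfolding L_def using that frobenius by (intro sum.cong) auto
    then show ?thesis unfolding L_def using sum_over_duals[of "\<lambda>i. real (N i k j)"] by simp
  qed
  have pos: "L k j > 0" if kj: "k \<in> I" "j \<in> I" for k j
  proof -
    obtain i where "i \<in> I" "N i j k > 0" using ex_left_factor kj by blast
    then show ?thesis unfolding L_def using finite_basis by (intro sum_pos2[of I i]) auto
  qed
  have "I \<noteq> {}" using unit_in by blast
  then obtain \<mu> v where vpos: "\<forall>i\<in>I. v i > 0"
    and eig: "\<forall>i\<in>I. (\<Sum>j\<in>I. L i j * v j) = \<mu> * v i"
    and uniq: "\<forall>w. (\<forall>i\<in>I. (\<Sum>j\<in>I. L i j * w j) = \<mu> * w i) \<longrightarrow> (\<exists>c. \<forall>i\<in>I. w i = c * v i)"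
    using positive_symmetric_eigenvector[of I L, OF finite_basis] sym pos that by blast
  have v: "v i > 0" if "i \<in> I" for i using vpos that by blast
  define R where "R j k = (\<Sum>m\<in>I. v m * real (N m j k))" for j k
  have assoc': "(\<Sum>m\<in>I. real (N i j m) * real (N m k l)) = (\<Sum>m\<in>I. real (N j k m) * real (N i m l))"
    if "i \<in> I" "j \<in> I" "k \<in> I" "l \<in> I" for i j k l
    using arg_cong[OF assoc[OF that], of real] by simp
  have "\<exists>c. \<forall>k\<in>I. R j k = c * v k" if j: "j \<in> I" for j
  proof (rule uniq[rule_format])
    fix l assume l: "l \<in> I"
    have "(\<Sum>k\<in>I. L l k * R j k)
        = (\<Sum>k\<in>I. \<Sum>i\<in>I. \<Sum>m\<in>I. v m * (real (N m j k) * real (N i k l)))"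
      by (simp add: L_def R_def sum_product mult_ac)
    also have "\<dots> = (\<Sum>i\<in>I. \<Sum>k\<in>I. \<Sum>m\<in>I. v m * (real (N m j k) * real (N i k l)))"
      by (rule sum.swap)
    also have "\<dots> = (\<Sum>i\<in>I. \<Sum>m\<in>I. \<Sum>k\<in>I. v m * (real (N m j k) * real (N i k l)))"
      by (intro sum.cong refl sum.swap)
    also have "\<dots> = (\<Sum>i\<in>I. \<Sum>m\<in>I. \<Sum>k\<in>I. v m * (real (N i m k) * real (N k j l)))"
      unfolding sum_distrib_left[symmetric] using assoc' j l by (intro sum.cong) auto
    also have "\<dots> = (\<Sum>i\<in>I. \<Sum>k\<in>I. \<Sum>m\<in>I. v m * (real (N i m k) * real (N k j l)))"
      by (intro sum.cong refl sum.swap)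
    also have "\<dots> = (\<Sum>k\<in>I. \<Sum>i\<in>I. \<Sum>m\<in>I. v m * (real (N i m k) * real (N k j l)))"
      by (rule sum.swap)
    also have "\<dots> = (\<Sum>k\<in>I. \<Sum>m\<in>I. \<Sum>i\<in>I. v m * (real (N i m k) * real (N k j l)))"
      by (intro sum.cong refl sum.swap)
    also have "\<dots> = (\<Sum>k\<in>I. (\<Sum>m\<in>I. L k m * v m) * real (N k j l))"
      by (simp add: L_def sum_distrib_left sum_distrib_right mult_ac)
    also have "\<dots> = \<mu> * R j l"
      by (simp add: R_def eig sum_distrib_left mult.assoc)
    finally show "(\<Sum>k\<in>I. L l k * R j k) = \<mu> * R j l" .
  qed
  then obtain d where d: "\<And>j k. j \<in> I \<Longrightarrow> k \<in> I \<Longrightarrow> R j k = d j * v k" by metis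
  have "d j > 0" if j: "j \<in> I" for j
  proof -
    obtain m where "m \<in> I" "N m j e > 0" using ex_left_factor[OF j unit_in] by blast
    then have "R j e > 0"
      unfolding R_def using finite_basis v by (intro sum_pos2[of I m]) (auto simp: less_imp_le)
    then show ?thesis using d[OF j unit_in] v[OF unit_in] by (simp add: zero_less_mult_iff)
  qed
  moreover have "d (dual j) = d j" if j: "j \<in> I" for j
  proof -
    have "d j * (\<Sum>k\<in>I. (v k)\<^sup>2) = (\<Sum>k\<in>I. R j k * v k)"
      by (simp add: d j sum_distrib_left power2_eq_square mult.assoc)
    also have "\<dots> = (\<Sum>k\<in>I. \<Sum>m\<in>I. v m * real (N m j k) * v k)"
      by (simp add: R_def sum_distrib_right)
    also have "\<dots> = (\<Sum>m\<in>I. \<Sum>k\<in>I. v m * real (N m j k) * v k)" by (rule sum.swap)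
    also have "\<dots> = (\<Sum>m\<in>I. \<Sum>k\<in>I. v m * real (N k (dual j) m) * v k)"
      using frobenius_right j by (intro sum.cong) auto
    also have "\<dots> = (\<Sum>m\<in>I. R (dual j) m * v m)"
      by (simp add: R_def sum_distrib_right sum_distrib_left mult_ac)
    also have "\<dots> = d (dual j) * (\<Sum>k\<in>I. (v k)\<^sup>2)"
      by (simp add: d j dual_in sum_distrib_left power2_eq_square mult.assoc)
    finally have "d j * (\<Sum>k\<in>I. (v k)\<^sup>2) = d (dual j) * (\<Sum>k\<in>I. (v k)\<^sup>2)" .
    moreover have "(\<Sum>k\<in>I. (v k)\<^sup>2) > 0"
      using finite_basis unit_in v[OF unit_in] by (intro sum_pos2[of I e]) auto
    ultimately show ?thesis by simp
  qed
  moreover have "d i * d j = (\<Sum>k\<in>I. real (N i j k) * d k)" if i: "i \<in> I" and j: "j \<in> I" for i j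
  proof -
    have "d i * d j * v e = d i * R j e" using d j unit_in by simp
    also have "\<dots> = (\<Sum>m\<in>I. R i m * real (N m j e))"
      by (simp add: R_def[of j] d i sum_distrib_left mult_ac)
    also have "\<dots> = (\<Sum>m\<in>I. \<Sum>n\<in>I. v n * (real (N n i m) * real (N m j e)))"
      by (simp add: R_def sum_distrib_right mult.assoc)
    also have "\<dots> = (\<Sum>n\<in>I. \<Sum>m\<in>I. v n * (real (N n i m) * real (N m j e)))" by (rule sum.swap)
    also have "\<dots> = (\<Sum>n\<in>I. \<Sum>m\<in>I. v n * (real (N i j m) * real (N n m e)))"
      unfolding sum_distrib_left[symmetric] using assoc' i j unit_in by (intro sum.cong) auto
    also have "\<dots> = (\<Sum>m\<in>I. \<Sum>n\<in>I. v n * (real (N i j m) * real (N n m e)))" by (rule sum.swap)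
    also have "\<dots> = (\<Sum>m\<in>I. real (N i j m) * R m e)"
      by (simp add: R_def sum_distrib_left mult_ac)
    also have "\<dots> = (\<Sum>m\<in>I. real (N i j m) * d m) * v e"
      by (simp add: d unit_in sum_distrib_right mult.assoc)
    finally show ?thesis using v[OF unit_in] by simp
  qed
  ultimately show ?thesis unfolding dim_character_def by blast
qed

text \<open>
  Frobenius reciprocity turns multiplicativity for \<open>dual i\<close> into the statement that \<open>d\<close> is a right eigenvector of the
  matrix of \<open>i\<close>.
\<close>

lemma dim_character_eigenvector:
  assumes "dim_character d" "i \<in> I" "k \<in> I"
  shows "(\<Sum>j\<in>I. real (N i j k) * d j) = d i * d k"
proof -
  have "(\<Sum>j\<in>I. real (N i j k) * d j) = (\<Sum>j\<in>I. real (N (dual i) k j) * d j)"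
    using frobenius assms by (intro sum.cong) auto
  then show ?thesis using assms dual_in unfolding dim_character_def by metis
qed

text \<open>
  Multiplicativity makes \<open>d\<close> a positive left eigenvector for the eigenvalue \<open>d i\<close>. Pairing it with the entrywise
  inequality between \<open>r \<bar>w\<bar>\<close> and the image of \<open>\<bar>w\<bar>\<close> bounds \<open>r\<close> by \<open>d i\<close>.
\<close>

lemma eigenvalue_le_dim_character:
  assumes d: "dim_character d" and i: "i \<in> I"
    and w: "\<And>k. k \<in> I \<Longrightarrow> (\<Sum>j\<in>I. real (N i j k) * w j) = r * w k"
    and r: "r \<ge> 0" and k0: "k0 \<in> I" "w k0 \<noteq> 0"
  shows "r \<le> d i"
proof -
  have dpos: "\<And>j. j \<in> I \<Longrightarrow> d j > 0" using d by (simp add: dim_character_def)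
  have "r * (\<Sum>k\<in>I. d k * \<bar>w k\<bar>) = (\<Sum>k\<in>I. d k * \<bar>r * w k\<bar>)"
    using r by (simp add: sum_distrib_left abs_mult mult_ac)
  also have "\<dots> \<le> (\<Sum>k\<in>I. d k * (\<Sum>j\<in>I. real (N i j k) * \<bar>w j\<bar>))"
  proof (intro sum_mono mult_left_mono)
    fix k assume k: "k \<in> I"
    have "\<bar>r * w k\<bar> = \<bar>\<Sum>j\<in>I. real (N i j k) * w j\<bar>" using w[OF k] by simp
    also have "\<dots> \<le> (\<Sum>j\<in>I. \<bar>real (N i j k) * w j\<bar>)" by (rule sum_abs)
    finally show "\<bar>r * w k\<bar> \<le> (\<Sum>j\<in>I. real (N i j k) * \<bar>w j\<bar>)" by (simp add: abs_mult)
    show "0 \<le> d k" using dpos[OF k] by simp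
  qed
  also have "\<dots> = (\<Sum>j\<in>I. \<Sum>k\<in>I. real (N i j k) * d k * \<bar>w j\<bar>)"
    unfolding sum_distrib_left by (subst sum.swap) (simp add: mult_ac)
  also have "\<dots> = (\<Sum>j\<in>I. d i * d j * \<bar>w j\<bar>)"
    unfolding sum_distrib_right[symmetric] using d i
    by (intro sum.cong) (auto simp: dim_character_def)
  also have "\<dots> = d i * (\<Sum>k\<in>I. d k * \<bar>w k\<bar>)" by (simp add: sum_distrib_left mult.assoc)
  finally have "r * (\<Sum>k\<in>I. d k * \<bar>w k\<bar>) \<le> d i * (\<Sum>k\<in>I. d k * \<bar>w k\<bar>)" .
  moreover have "(\<Sum>k\<in>I. d k * \<bar>w k\<bar>) > 0"
    using finite_basis k0 dpos by (intro sum_pos2[of I k0]) (auto simp: less_imp_le)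
  ultimately show ?thesis by simp
qed

lemma dim_character_unit: assumes "dim_character d" shows "d e = 1"
proof -
  have "(\<Sum>k\<in>I. real (N e e k) * d k) = (\<Sum>k\<in>I. if k = e then d k else 0)"
    using unit_in by (intro sum.cong) (auto simp: unit_left)
  then have "d e * d e = d e"
    using assms unit_in finite_basis by (simp add: dim_character_def)
  moreover have "d e > 0" using assms unit_in by (simp add: dim_character_def)
  ultimately show ?thesis by simp
qed

section \<open>The adjoint subring and its group of cosets\<close>

text \<open>
  The support of a product of two sets of basis elements. Intersecting with \<open>I\<close> makes this operation
  associative on arbitrary sets.
\<close>

definition hprod :: "'a set \<Rightarrow> 'a set \<Rightarrow> 'a set" (infixl "\<odot>" 70) where
  "P \<odot> Q = {k \<in> I. \<exists>i \<in> P \<inter> I. \<exists>j \<in> Q \<inter> I. N i j k > 0}"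

lemma hprod_iff: "k \<in> P \<odot> Q \<longleftrightarrow> k \<in> I \<and> (\<exists>i \<in> P \<inter> I. \<exists>j \<in> Q \<inter> I. N i j k > 0)"
  by (simp add: hprod_def)

lemma hprodI: "i \<in> P \<Longrightarrow> j \<in> Q \<Longrightarrow> i \<in> I \<Longrightarrow> j \<in> I \<Longrightarrow> k \<in> I \<Longrightarrow> N i j k > 0 \<Longrightarrow> k \<in> P \<odot> Q"
  unfolding hprod_def by blast

lemma hprodE:
  assumes "k \<in> P \<odot> Q"
  obtains i j where "i \<in> P" "j \<in> Q" "i \<in> I" "j \<in> I" "k \<in> {i} \<odot> {j}"
  using assms unfolding hprod_def by blast

lemma hprod_assoc: "(P \<odot> Q) \<odot> R = P \<odot> (Q \<odot> R)"
proof (intro equalityI subsetI)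
  fix l assume "l \<in> (P \<odot> Q) \<odot> R"
  then obtain m i j k where *: "l \<in> I" "m \<in> I" "i \<in> P" "i \<in> I" "j \<in> Q" "j \<in> I" "k \<in> R" "k \<in> I"
    and "N i j m > 0" "N m k l > 0"
    by (auto simp: hprod_iff)
  then obtain n where "n \<in> I" "N j k n > 0" "N i n l > 0"
    using support_assoc[of i j k l] by auto
  then show "l \<in> P \<odot> (Q \<odot> R)"
    using * by (intro hprodI[of i P n "Q \<odot> R" l] hprodI[of j Q k R n])
next
  fix l assume "l \<in> P \<odot> (Q \<odot> R)"
  then obtain n i j k where *: "l \<in> I" "n \<in> I" "i \<in> P" "i \<in> I" "j \<in> Q" "j \<in> I" "k \<in> R" "k \<in> I"
    and "N j k n > 0" "N i n l > 0"
    by (auto simp: hprod_iff)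
  then obtain m where "m \<in> I" "N i j m > 0" "N m k l > 0"
    using support_assoc[of i j k l] by auto
  then show "l \<in> (P \<odot> Q) \<odot> R"
    using * by (intro hprodI[of m "P \<odot> Q" k R l] hprodI[of i P j Q m])
qed

lemma hprod_mono: "P \<subseteq> P' \<Longrightarrow> Q \<subseteq> Q' \<Longrightarrow> P \<odot> Q \<subseteq> P' \<odot> Q'"
  unfolding hprod_def by blast

lemma hprod_subset: "P \<odot> Q \<subseteq> I"
  unfolding hprod_def by blast

lemma hprod_unit_left: "P \<subseteq> I \<Longrightarrow> {e} \<odot> P = P"
  using unit_in by (auto simp: hprod_iff unit_left split: if_splits)

lemma hprod_unit_right: "P \<subseteq> I \<Longrightarrow> P \<odot> {e} = P"
  using unit_in by (auto simp: hprod_iff unit_right split: if_splits)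

lemma unit_in_hprod_dual: "i \<in> I \<Longrightarrow> {e} \<subseteq> {i} \<odot> {dual i}" "i \<in> I \<Longrightarrow> {e} \<subseteq> {dual i} \<odot> {i}"
  using unit_in by (auto simp: hprod_iff coeff_unit dual_in dual_dual)

lemma hprod_singletons_commute:
  assumes "\<And>x. x \<in> P \<Longrightarrow> {x} \<odot> A = A \<odot> {x}"
  shows "P \<odot> A = A \<odot> P"
proof -
  have "P \<odot> A = (\<Union>x\<in>P. {x} \<odot> A)" "A \<odot> P = (\<Union>x\<in>P. A \<odot> {x})"
    unfolding hprod_def by blast+
  then show ?thesis using assms by simp
qed

primrec hpow :: "'a \<Rightarrow> nat \<Rightarrow> 'a set" where
  "hpow i 0 = {e}"
| "hpow i (Suc n) = hpow i n \<odot> {i}"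

definition based_subring :: "'a set \<Rightarrow> bool" where
  "based_subring S \<longleftrightarrow> S \<subseteq> I \<and> e \<in> S \<and> S \<odot> S \<subseteq> S \<and> (\<forall>i\<in>S. dual i \<in> S)"

lemma hpow_subset:
  assumes "e \<in> S" "S \<odot> S \<subseteq> S" "i \<in> S"
  shows "hpow i n \<subseteq> S"
proof (induction n)
  case (Suc n)
  then show ?case using hprod_mono[of "hpow i n" S "{i}" S] assms by auto
qed (use assms in simp)

text \<open>
  A subset closed under products is closed under duals as soon as every element has finite order: if the
  unit occurs in \<open>i\<^sup>n\<close>, then \<open>dual i\<close> occurs in \<open>i\<^bsup>n-1\<^esup>\<close>.
\<close>

lemma based_subring_if_torsion:
  assumes S: "S \<subseteq> I" "e \<in> S" "S \<odot> S \<subseteq> S"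
    and torsion: "\<And>i. i \<in> S \<Longrightarrow> \<exists>n\<ge>1. e \<in> hpow i n"
  shows "based_subring S"
proof -
  have "dual i \<in> S" if i: "i \<in> S" for i
  proof -
    obtain n where n: "n \<ge> 1" "e \<in> hpow i n" using torsion[OF i] by blast
    then obtain m where m: "n = Suc m" by (cases n) auto
    then obtain l where l: "l \<in> hpow i m" "l \<in> I" "N l i e > 0"
      using n(2) by (auto simp: hprod_iff)
    then have "dual i = l"
      using i S(1) by (auto simp: coeff_unit dual_dual split: if_splits)
    then show ?thesis using l(1) hpow_subset[OF S(2,3) i] by blast
  qed
  then show ?thesis using S by (simp add: based_subring_def)
qed

inductive_set adjoint_subring :: "'a set \<Rightarrow> 'a set" for S where
  gen: "z \<in> S \<Longrightarrow> k \<in> {z} \<odot> {dual z} \<Longrightarrow> k \<in> adjoint_subring S"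
| prod: "a \<in> adjoint_subring S \<Longrightarrow> b \<in> adjoint_subring S \<Longrightarrow> k \<in> {a} \<odot> {b} \<Longrightarrow>
    k \<in> adjoint_subring S"

context
  fixes S A
  assumes S: "based_subring S"
  defines "A \<equiv> adjoint_subring S"
begin

lemma subring_subset: "S \<subseteq> I" and subring_unit: "e \<in> S" and subring_mult: "S \<odot> S \<subseteq> S"
  and subring_dual: "i \<in> S \<Longrightarrow> dual i \<in> S" and subring_in: "i \<in> S \<Longrightarrow> i \<in> I"
  using S by (auto simp: based_subring_def)

lemma adjoint_generators: "z \<in> S \<Longrightarrow> {z} \<odot> {dual z} \<subseteq> A"
  unfolding A_def by (auto intro: adjoint_subring.gen)

lemma adjoint_mult: "A \<odot> A \<subseteq> A"
proof
  fix k assume "k \<in> A \<odot> A"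
  then obtain a b where "a \<in> A" "b \<in> A" "k \<in> {a} \<odot> {b}" by (auto simp: hprod_iff)
  then show "k \<in> A" unfolding A_def by (rule adjoint_subring.prod)
qed

lemma adjoint_subset_subring: "A \<subseteq> S"
proof
  fix k assume "k \<in> A"
  then show "k \<in> S" unfolding A_def
  proof induction
    case (gen z k)
    then show ?case using hprod_mono[of "{z}" S "{dual z}" S] subring_mult subring_dual by blast
  next
    case (prod a b k)
    then show ?case using hprod_mono[of "{a}" S "{b}" S] subring_mult by blast
  qed
qed

lemma adjoint_subset: "A \<subseteq> I" using adjoint_subset_subring subring_subset by blast

lemma adjoint_unit: "e \<in> A"
  using adjoint_generators[OF subring_unit] unit_in_hprod_dual(1)[OF unit_in] by blast

lemma adjoint_dual: "a \<in> A \<Longrightarrow> dual a \<in> A"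
proof -
  have flip: "dual k \<in> {dual b} \<odot> {dual a}" if "k \<in> {a} \<odot> {b}" for a b k
    using that anti_involution dual_in by (auto simp: hprod_iff)
  assume "a \<in> A"
  then show "dual a \<in> A" unfolding A_def
  proof induction
    case (gen z k)
    then show ?case
      using flip[of k z "dual z"] adjoint_subring.gen[of z S "dual k"] subring_in by (simp add: dual_dual)
  next
    case (prod a b k)
    then show ?case using flip[of k a b] adjoint_subring.prod by blast
  qed
qed

lemma based_subring_adjoint: "based_subring A"
  using adjoint_subset adjoint_unit adjoint_mult adjoint_dual by (simp add: based_subring_def)

lemma adjoint_idem: "A \<odot> A = A"
  using adjoint_mult hprod_mono[of "{e}" A A A] hprod_unit_left[OF adjoint_subset] adjoint_unit by blast

text \<open>
  If \<open>u\<close> and \<open>w\<close> both occur in \<open>x z\<close>, then \<open>z\<close> occurs in \<open>x\<^sup>* w\<close>, and therefore \<open>u\<close> in \<open>x x\<^sup>* w\<close>. This puts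
  all constituents of a product into the same coset.
\<close>

lemma constituents_related:
  assumes "x \<in> S" "z \<in> S" "u \<in> {x} \<odot> {z}" "w \<in> {x} \<odot> {z}"
  shows "u \<in> ({x} \<odot> {dual x}) \<odot> {w}"
proof -
  have "z \<in> {dual x} \<odot> {w}"
    using assms frobenius subring_in by (auto simp: hprod_iff dual_in)
  then have "{x} \<odot> {z} \<subseteq> {x} \<odot> ({dual x} \<odot> {w})" by (intro hprod_mono) auto
  then show ?thesis using assms(3) by (auto simp: hprod_assoc)
qed

lemma constituents_same_coset:
  assumes "x \<in> S" "z \<in> S" "w \<in> {x} \<odot> {z}"
  shows "{x} \<odot> {z} \<subseteq> A \<odot> {w}"
proof
  fix u assume "u \<in> {x} \<odot> {z}"
  then have "u \<in> ({x} \<odot> {dual x}) \<odot> {w}" using constituents_related assms by blast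
  then show "u \<in> A \<odot> {w}" using hprod_mono[OF adjoint_generators[OF assms(1)] subset_refl] by blast
qed

text \<open>
  Normality uses that \<open>A\<close> is generated by the constituents of the products \<open>z z\<^sup>*\<close>. A constituent of
  \<open>x z z\<^sup>* x\<^sup>*\<close> occurs in some \<open>u w\<^sup>*\<close> with \<open>u\<close> and \<open>w\<close> in \<open>x z\<close>, hence in
  \<open>(x x\<^sup>*) (w w\<^sup>*)\<close>. For products one inserts \<open>x\<^sup>* x\<close>, which contains the unit.
\<close>

lemma adjoint_normal_element:
  assumes x: "x \<in> S" and b: "b \<in> A"
  shows "{x} \<odot> ({b} \<odot> {dual x}) \<subseteq> A"
  using b unfolding A_def
proof induction
  case (gen z b)
  show ?case
  proof
    fix y assume y: "y \<in> {x} \<odot> ({b} \<odot> {dual x})"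
    have "{x} \<odot> ({b} \<odot> {dual x}) \<subseteq> {x} \<odot> (({z} \<odot> {dual z}) \<odot> {dual x})"
      using gen by (intro hprod_mono) auto
    also have "\<dots> = ({x} \<odot> {z}) \<odot> ({dual z} \<odot> {dual x})" by (simp add: hprod_assoc)
    finally obtain u w' where u: "u \<in> {x} \<odot> {z}" and w': "w' \<in> {dual z} \<odot> {dual x}"
      and yuw: "y \<in> {u} \<odot> {w'}"
      using y by (meson hprodE subsetD)
    define w where "w = dual w'"
    have wI: "w \<in> {x} \<odot> {z}" "dual w = w'"
      using w' anti_involution[of "dual z" "dual x" w'] gen x subring_in
      by (auto simp: w_def hprod_iff dual_in dual_dual)
    have wS: "w \<in> S" using wI(1) hprod_mono[of "{x}" S "{z}" S] subring_mult x gen by blast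
    have "{u} \<odot> {w'} \<subseteq> (({x} \<odot> {dual x}) \<odot> {w}) \<odot> {w'}"
      using constituents_related[OF x gen(1) u wI(1)] by (intro hprod_mono) auto
    also have "\<dots> = ({x} \<odot> {dual x}) \<odot> ({w} \<odot> {dual w})" using wI(2) by (simp add: hprod_assoc)
    also have "\<dots> \<subseteq> A \<odot> A" by (intro hprod_mono adjoint_generators x wS)
    also have "\<dots> \<subseteq> A" by (rule adjoint_mult)
    finally show "y \<in> adjoint_subring S" using yuw A_def by blast
  qed
next
  case (prod b1 b2 b)
  have bI: "b1 \<in> I" "b2 \<in> I" using prod adjoint_subset A_def by auto
  have dx: "dual x \<in> I" using x subring_in dual_in by blast
  have "{x} \<odot> ({b} \<odot> {dual x}) \<subseteq> {x} \<odot> (({b1} \<odot> {b2}) \<odot> {dual x})"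
    using prod by (intro hprod_mono) auto
  also have "\<dots> = {x} \<odot> ({b1} \<odot> ({e} \<odot> ({b2} \<odot> {dual x})))"
    using hprod_unit_left[OF hprod_subset] by (simp add: hprod_assoc)
  also have "\<dots> \<subseteq> {x} \<odot> ({b1} \<odot> (({dual x} \<odot> {x}) \<odot> ({b2} \<odot> {dual x})))"
    using unit_in_hprod_dual(2)[OF subring_in[OF x]] by (intro hprod_mono) auto
  also have "\<dots> = ({x} \<odot> ({b1} \<odot> {dual x})) \<odot> ({x} \<odot> ({b2} \<odot> {dual x}))"
    by (simp add: hprod_assoc)
  also have "\<dots> \<subseteq> A \<odot> A"
    using prod.IH A_def by (intro hprod_mono) auto
  finally show ?case using adjoint_mult A_def by blast
qed

lemma adjoint_normal: "x \<in> S \<Longrightarrow> {x} \<odot> (A \<odot> {dual x}) \<subseteq> A"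
proof
  fix y assume x: "x \<in> S" and "y \<in> {x} \<odot> (A \<odot> {dual x})"
  then obtain m where m: "m \<in> A \<odot> {dual x}" "y \<in> {x} \<odot> {m}"
    by (metis hprodE singletonD)
  then obtain b where "b \<in> A" "m \<in> {b} \<odot> {dual x}" by (metis hprodE singletonD)
  moreover then have "{x} \<odot> {m} \<subseteq> {x} \<odot> ({b} \<odot> {dual x})"
    by (intro hprod_mono) auto
  ultimately show "y \<in> A" using adjoint_normal_element[OF x, of b] m(2) by (meson subsetD)
qed

lemma adjoint_commute: assumes x: "x \<in> S" shows "{x} \<odot> A = A \<odot> {x}"
proof
  have "{x} \<odot> A = {x} \<odot> (A \<odot> {e})" by (simp add: hprod_unit_right adjoint_subset)
  also have "\<dots> \<subseteq> {x} \<odot> (A \<odot> ({dual x} \<odot> {x}))"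
    using unit_in_hprod_dual(2)[OF subring_in[OF x]] by (intro hprod_mono) auto
  also have "\<dots> = ({x} \<odot> (A \<odot> {dual x})) \<odot> {x}" by (simp add: hprod_assoc)
  also have "\<dots> \<subseteq> A \<odot> {x}" using adjoint_normal[OF x] by (intro hprod_mono) auto
  finally show "{x} \<odot> A \<subseteq> A \<odot> {x}" .
next
  have "A \<odot> {x} = {e} \<odot> (A \<odot> {x})" by (simp add: hprod_unit_left hprod_subset)
  also have "\<dots> \<subseteq> ({x} \<odot> {dual x}) \<odot> (A \<odot> {x})"
    using unit_in_hprod_dual(1)[OF subring_in[OF x]] by (intro hprod_mono) auto
  also have "\<dots> = {x} \<odot> ({dual x} \<odot> (A \<odot> {dual (dual x)}))"
    using x subring_in by (simp add: hprod_assoc dual_dual)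
  also have "\<dots> \<subseteq> {x} \<odot> A"
    using adjoint_normal[OF subring_dual[OF x]] by (intro hprod_mono) auto
  finally show "A \<odot> {x} \<subseteq> {x} \<odot> A" .
qed

lemma coset_self: "i \<in> I \<Longrightarrow> i \<in> A \<odot> {i}"
  using hprod_mono[of "{e}" A "{i}" "{i}"] adjoint_unit hprod_unit_left[of "{i}"] by blast

lemma coset_subset_S: "i \<in> S \<Longrightarrow> A \<odot> {i} \<subseteq> S"
  using hprod_mono[of A S "{i}" S] adjoint_subset_subring subring_mult by blast

lemma coset_le: "k \<in> A \<odot> {i} \<Longrightarrow> A \<odot> {k} \<subseteq> A \<odot> {i}"
  using hprod_mono[of A A "{k}" "A \<odot> {i}"] by (simp add: hprod_assoc[symmetric] adjoint_idem)

lemma coset_eq: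
  assumes "i \<in> I" "k \<in> A \<odot> {i}" shows "A \<odot> {k} = A \<odot> {i}"
proof -
  obtain a where "a \<in> A" "k \<in> I" "N a i k > 0" using assms by (auto simp: hprod_iff)
  then have "N (dual a) k i > 0" using frobenius[of a i k] assms adjoint_subset by auto
  then have "i \<in> A \<odot> {k}"
    using \<open>a \<in> A\<close> \<open>k \<in> I\<close> adjoint_dual adjoint_subset assms(1) by (auto simp: hprod_iff)
  then show ?thesis using coset_le assms(2) by blast
qed

lemma coset_mult:
  assumes i: "i \<in> S" and j: "j \<in> S" and k: "k \<in> {i} \<odot> {j}"
  shows "(A \<odot> {i}) \<odot> (A \<odot> {j}) = A \<odot> {k}"
proof -
  have "(A \<odot> {i}) \<odot> (A \<odot> {j}) = A \<odot> (({i} \<odot> A) \<odot> {j})" by (simp add: hprod_assoc)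
  also have "\<dots> = (A \<odot> A) \<odot> ({i} \<odot> {j})" by (simp add: adjoint_commute[OF i] hprod_assoc)
  finally have eq: "(A \<odot> {i}) \<odot> (A \<odot> {j}) = A \<odot> ({i} \<odot> {j})" by (simp add: adjoint_idem)
  have "A \<odot> ({i} \<odot> {j}) \<subseteq> A \<odot> (A \<odot> {k})"
    by (rule hprod_mono[OF subset_refl constituents_same_coset[OF i j k]])
  moreover have "A \<odot> {k} \<subseteq> A \<odot> ({i} \<odot> {j})" using k by (intro hprod_mono) auto
  ultimately show ?thesis using eq by (simp add: hprod_assoc[symmetric] adjoint_idem)
qed

text \<open>
  The universal grading group of the based ring \<open>S\<close>: its elements are the cosets of the adjoint subring, as
  sets of basis elements.
\<close>

definition coset_group :: "'a set monoid" where
  "coset_group = \<lparr>carrier = (\<lambda>i. A \<odot> {i}) ` S, monoid.mult = (\<odot>), one = A\<rparr>"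

lemma unit_coset: "A = A \<odot> {e}"
  using hprod_unit_right[OF adjoint_subset] by simp

lemma group_coset_group: "group coset_group"
proof (rule groupI)
  fix x y assume "x \<in> carrier coset_group" "y \<in> carrier coset_group"
  then obtain i j where ij: "i \<in> S" "j \<in> S" "x = A \<odot> {i}" "y = A \<odot> {j}"
    by (auto simp: coset_group_def)
  obtain k where k: "k \<in> {i} \<odot> {j}" using ex_constituent[of i j] ij subring_in by (auto simp: hprod_iff)
  then have "k \<in> S" using ij subring_mult hprod_mono[of "{i}" S "{j}" S] by blast
  then show "x \<otimes>\<^bsub>coset_group\<^esub> y \<in> carrier coset_group"
    using coset_mult[OF ij(1,2) k] ij by (auto simp: coset_group_def)
next
  show "\<one>\<^bsub>coset_group\<^esub> \<in> carrier coset_group"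
    using unit_coset subring_unit by (auto simp: coset_group_def)
next
  fix x y z
  show "(x \<otimes>\<^bsub>coset_group\<^esub> y) \<otimes>\<^bsub>coset_group\<^esub> z = x \<otimes>\<^bsub>coset_group\<^esub> (y \<otimes>\<^bsub>coset_group\<^esub> z)"
    by (simp add: coset_group_def hprod_assoc)
next
  fix x assume "x \<in> carrier coset_group"
  then show "\<one>\<^bsub>coset_group\<^esub> \<otimes>\<^bsub>coset_group\<^esub> x = x"
    by (auto simp: coset_group_def hprod_assoc[symmetric] adjoint_idem)
next
  fix x assume "x \<in> carrier coset_group"
  then obtain i where i: "i \<in> S" "x = A \<odot> {i}" by (auto simp: coset_group_def)
  have "(A \<odot> {dual i}) \<odot> (A \<odot> {i}) = A \<odot> {e}"
    using coset_mult[OF subring_dual[OF i(1)] i(1), of e] unit_in_hprod_dual(2)[OF subring_in[OF i(1)]] by blast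
  then show "\<exists>y\<in>carrier coset_group. y \<otimes>\<^bsub>coset_group\<^esub> x = \<one>\<^bsub>coset_group\<^esub>"
    using i subring_dual unit_coset by (auto simp: coset_group_def)
qed

lemma coset_pow: assumes i: "i \<in> S" shows "(A \<odot> {i}) [^]\<^bsub>coset_group\<^esub> n = A \<odot> hpow i n"
proof (induction n)
  case 0
  then show ?case using unit_coset by (simp add: coset_group_def nat_pow_def)
next
  case (Suc n)
  have comm: "hpow i n \<odot> A = A \<odot> hpow i n"
  proof (rule hprod_singletons_commute)
    show "{x} \<odot> A = A \<odot> {x}" if "x \<in> hpow i n" for x
      using that hpow_subset[OF subring_unit subring_mult i, of n] by (intro adjoint_commute) auto
  qed
  have "(A \<odot> hpow i n) \<odot> (A \<odot> {i}) = A \<odot> ((hpow i n \<odot> A) \<odot> {i})"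
    by (simp only: hprod_assoc)
  also have "\<dots> = (A \<odot> A) \<odot> (hpow i n \<odot> {i})"
    by (simp only: comm hprod_assoc)
  finally have "(A \<odot> hpow i n) \<odot> (A \<odot> {i}) = A \<odot> (hpow i n \<odot> {i})"
    by (simp only: adjoint_idem)
  then show ?case using Suc by (simp add: coset_group_def nat_pow_def)
qed

lemma coset_pow_eq_one:
  assumes i: "i \<in> S" and n: "e \<in> hpow i n"
  shows "(A \<odot> {i}) [^]\<^bsub>coset_group\<^esub> n = \<one>\<^bsub>coset_group\<^esub>"
proof -
  interpret group coset_group by (rule group_coset_group)
  have "(A \<odot> {i}) [^]\<^bsub>coset_group\<^esub> n \<in> carrier coset_group"
    using i by (intro nat_pow_closed) (auto simp: coset_group_def)
  then obtain k where k: "k \<in> S" "A \<odot> hpow i n = A \<odot> {k}"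
    using coset_pow[OF i] by (auto simp: coset_group_def)
  have "A \<odot> {e} \<subseteq> A \<odot> hpow i n" using n by (intro hprod_mono) auto
  then have "e \<in> A \<odot> {k}" using k coset_self[OF unit_in] by blast
  then have "A \<odot> {e} = A \<odot> {k}" using coset_eq k subring_in by blast
  then show ?thesis using k coset_pow[OF i] unit_coset by (simp add: coset_group_def)
qed

text \<open>
  Compute the sum of \<open>d a \<cdot> d k \<cdot> N a i k\<close> over \<open>a\<close> in \<open>A\<close> and \<open>k\<close> in the coset in two ways. Summing over \<open>k\<close>
  first gives \<open>d i \<cdot> \<Sum>(d a)\<^sup>2\<close>. Summing over \<open>a\<close> first gives \<open>d i \<cdot> \<Sum>(d k)\<^sup>2\<close>, since all
  constituents of \<open>k i\<^sup>*\<close> lie in \<open>A\<close> and \<open>N a i k = N k i\<^sup>* a\<close>.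
\<close>

lemma coset_dimension:
  assumes d: "dim_character d" and i: "i \<in> S"
  shows "(\<Sum>k\<in>A \<odot> {i}. (d k)\<^sup>2) = (\<Sum>a\<in>A. (d a)\<^sup>2)"
proof -
  have finA: "finite A" using adjoint_subset finite_basis finite_subset by blast
  have iI: "i \<in> I" using i subring_in by blast
  have dd: "d x * d y = (\<Sum>k\<in>I. real (N x y k) * d k)" if "x \<in> I" "y \<in> I" for x y
    using d that by (simp add: dim_character_def)
  have "d i * (\<Sum>a\<in>A. (d a)\<^sup>2) = (\<Sum>a\<in>A. d a * (d a * d i))"
    by (simp add: sum_distrib_left power2_eq_square mult_ac)
  also have "\<dots> = (\<Sum>a\<in>A. \<Sum>k\<in>A \<odot> {i}. d a * (real (N a i k) * d k))"
  proof (intro sum.cong refl)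
    fix a assume a: "a \<in> A"
    then have "a \<in> I" using adjoint_subset by blast
    have "d a * d i = (\<Sum>k\<in>A \<odot> {i}. real (N a i k) * d k)"
      unfolding dd[OF \<open>a \<in> I\<close> iI]
      by (rule sum.mono_neutral_right) (use a \<open>a \<in> I\<close> iI finite_basis hprod_subset in \<open>auto simp: hprod_iff\<close>)
    then show "d a * (d a * d i) = (\<Sum>k\<in>A \<odot> {i}. d a * (real (N a i k) * d k))"
      by (simp add: sum_distrib_left)
  qed
  also have "\<dots> = (\<Sum>k\<in>A \<odot> {i}. \<Sum>a\<in>A. d a * (real (N a i k) * d k))" by (rule sum.swap)
  also have "\<dots> = (\<Sum>k\<in>A \<odot> {i}. d k * (d k * d i))"
  proof (intro sum.cong refl)
    fix k assume k: "k \<in> A \<odot> {i}"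
    then have kI: "k \<in> I" using hprod_subset by blast
    have "{k} \<odot> {dual i} \<subseteq> (A \<odot> {i}) \<odot> {dual i}" using k by (intro hprod_mono) auto
    also have "\<dots> \<subseteq> A \<odot> A" unfolding hprod_assoc using adjoint_generators[OF i] by (intro hprod_mono) auto
    finally have sub: "{k} \<odot> {dual i} \<subseteq> A" using adjoint_mult by blast
    have "d k * d i = d k * d (dual i)" using d iI by (simp add: dim_character_def)
    also have "\<dots> = (\<Sum>a\<in>I. real (N k (dual i) a) * d a)" using dd kI iI dual_in by simp
    also have "\<dots> = (\<Sum>a\<in>A. real (N k (dual i) a) * d a)"
    proof (rule sum.mono_neutral_right[OF finite_basis adjoint_subset], intro ballI)
      fix a assume "a \<in> I - A"
      then have "N k (dual i) a = 0"
        using sub hprodI[of k "{k}" "dual i" "{dual i}" a] kI dual_in[OF iI] by auto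
      then show "real (N k (dual i) a) * d a = 0" by simp
    qed
    also have "\<dots> = (\<Sum>a\<in>A. real (N a i k) * d a)"
      using frobenius_right[of k "dual i"] kI iI adjoint_subset
      by (intro sum.cong) (auto simp: dual_in dual_dual subset_iff)
    finally show "(\<Sum>a\<in>A. d a * (real (N a i k) * d k)) = d k * (d k * d i)"
      by (simp add: sum_distrib_left mult_ac)
  qed
  also have "\<dots> = d i * (\<Sum>k\<in>A \<odot> {i}. (d k)\<^sup>2)"
    by (simp add: sum_distrib_left power2_eq_square mult_ac)
  finally have "d i * (\<Sum>a\<in>A. (d a)\<^sup>2) = d i * (\<Sum>k\<in>A \<odot> {i}. (d k)\<^sup>2)" .
  moreover have "d i > 0" using d iI by (simp add: dim_character_def)
  ultimately show ?thesis by simp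
qed

lemma dimension_eq_order_times_adjoint:
  assumes d: "dim_character d"
  shows "(\<Sum>i\<in>S. (d i)\<^sup>2) = real (Coset.order coset_group) * (\<Sum>a\<in>A. (d a)\<^sup>2)"
proof -
  have finS: "finite S" using subring_subset finite_basis finite_subset by blast
  have un: "\<Union> (carrier coset_group) = S"
    using coset_self subring_in coset_subset_S by (fastforce simp: coset_group_def)
  have disj: "x \<inter> y = {}" if xy: "x \<in> carrier coset_group" "y \<in> carrier coset_group" and ne: "x \<noteq> y" for x y
  proof (rule ccontr)
    assume "x \<inter> y \<noteq> {}"
    then obtain k where "k \<in> x" "k \<in> y" by blast
    then have "x = A \<odot> {k}" "y = A \<odot> {k}"
      using xy coset_eq subring_in by (auto simp: coset_group_def)
    then show False using ne by simp
  qed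
  have "(\<Sum>i\<in>\<Union> (carrier coset_group). (d i)\<^sup>2) = (\<Sum>x\<in>carrier coset_group. \<Sum>i\<in>x. (d i)\<^sup>2)"
  proof (subst sum.Union_disjoint)
    show "\<forall>x\<in>carrier coset_group. finite x"
      using finite_subset[OF hprod_subset finite_basis] by (auto simp: coset_group_def)
  qed (use disj in auto)
  also have "\<dots> = (\<Sum>x\<in>carrier coset_group. \<Sum>a\<in>A. (d a)\<^sup>2)"
    by (rule sum.cong[OF refl]) (use coset_dimension[OF d] in \<open>auto simp: coset_group_def\<close>)
  finally show ?thesis using un by (simp add: Coset.order_def)
qed

end

lemma dimension_prime_power_multiple:
  assumes S: "based_subring S" and d: "dim_character d" and p: "prime (p::nat)"
    and ppow: "\<And>i. i \<in> S \<Longrightarrow> \<exists>a. e \<in> hpow i (p ^ a)"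
  shows "\<exists>m. (\<Sum>i\<in>S. (d i)\<^sup>2) = real (p ^ m) * (\<Sum>i\<in>adjoint_subring S. (d i)\<^sup>2)"
proof -
  interpret G: group "coset_group S" by (rule group_coset_group[OF S])
  have "finite S" using S finite_basis finite_subset by (auto simp: based_subring_def)
  then have "finite (carrier (coset_group S))" by (simp add: coset_group_def[OF S])
  moreover have "\<exists>a. x [^]\<^bsub>coset_group S\<^esub> (p ^ a) = \<one>\<^bsub>coset_group S\<^esub>"
    if "x \<in> carrier (coset_group S)" for x
    using that coset_pow_eq_one[OF S] ppow by (auto simp: coset_group_def[OF S]) metis
  ultimately obtain m where "Coset.order (coset_group S) = p ^ m"
    using G.order_prime_power[OF p] by blast
  then show ?thesis using dimension_eq_order_times_adjoint[OF S d] by auto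
qed

end

section \<open>Linear algebra in Hom spaces\<close>

text \<open>
  Gaussian elimination: a row with a nonzero entry in column \<open>j\<close> clears this column in the others.
\<close>

lemma more_rows_than_columns_dependent:
  fixes a :: "'i \<Rightarrow> 'j \<Rightarrow> 'k::field"
  assumes "finite J" "finite I" "card J < card I"
  shows "\<exists>c. (\<exists>i\<in>I. c i \<noteq> 0) \<and> (\<forall>j\<in>J. (\<Sum>i\<in>I. c i * a i j) = 0)"
  using assms
proof (induction J arbitrary: I a rule: finite_induct)
  case empty
  then obtain i where "i \<in> I" by fastforce
  then show ?case by (intro exI[of _ "\<lambda>_. 1"]) auto
next
  case (insert j J)
  show ?case
  proof (cases "\<forall>i\<in>I. a i j = 0")
    case True
    obtain c where "\<exists>i\<in>I. c i \<noteq> 0" "\<forall>j\<in>J. (\<Sum>i\<in>I. c i * a i j) = 0"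
      using insert.IH[of I a] insert.prems insert.hyps by auto
    then show ?thesis using True by (intro exI[of _ c]) (auto intro!: sum.neutral)
  next
    case False
    then obtain i0 where i0: "i0 \<in> I" "a i0 j \<noteq> 0" by blast
    define b where "b i k = a i k - a i j / a i0 j * a i0 k" for i k
    have "card J < card (I - {i0})" using insert i0 by (simp add: card_Diff_singleton)
    then obtain c where c: "\<exists>i\<in>I - {i0}. c i \<noteq> 0" "\<forall>k\<in>J. (\<Sum>i\<in>I - {i0}. c i * b i k) = 0"
      using insert.IH[of "I - {i0}" b] insert.prems by auto
    define s where "s = (\<Sum>i\<in>I - {i0}. c i * a i j) / a i0 j"
    define c' where "c' = c(i0 := - s)"
    have split: "(\<Sum>i\<in>I. c' i * a i k) = (\<Sum>i\<in>I - {i0}. c i * a i k) - s * a i0 k" for k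
    proof -
      have "(\<Sum>i\<in>I - {i0}. c' i * a i k) = (\<Sum>i\<in>I - {i0}. c i * a i k)"
        by (rule sum.cong) (auto simp: c'_def)
      then show ?thesis using insert.prems(1) i0(1)
        by (simp add: sum.remove[of I i0] c'_def)
    qed
    have "(\<Sum>i\<in>I - {i0}. c i * b i k) = (\<Sum>i\<in>I - {i0}. c i * a i k) - s * a i0 k" for k
      by (simp add: b_def s_def algebra_simps sum_subtractf sum_distrib_left sum_divide_distrib)
    then have "(\<Sum>i\<in>I. c' i * a i k) = 0" if "k \<in> insert j J" for k
      using that split c(2) i0 by (auto simp: s_def)
    moreover have "\<exists>i\<in>I. c' i \<noteq> 0" using c(1) by (auto simp: c'_def)
    ultimately show ?thesis by blast
  qed
qed

context category begin

lemma MorI: "f \<in> arr C \<Longrightarrow> src C f = X \<Longrightarrow> tgt C f = Y \<Longrightarrow> f \<in> Mor C X Y"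
  by (simp add: Mor_def)

lemma Mor_arr: "f \<in> Mor C X Y \<Longrightarrow> f \<in> arr C"
  and Mor_src: "f \<in> Mor C X Y \<Longrightarrow> src C f = X"
  by (auto simp: Mor_def)

lemma Mor_objs: "f \<in> Mor C X Y \<Longrightarrow> X \<in> obj C" "f \<in> Mor C X Y \<Longrightarrow> Y \<in> obj C"
  using src_obj tgt_obj by (auto simp: Mor_def)

text \<open>
  Many facts are restated for arrows with given source and target instead of membership in a Hom set: their
  premises contain no objects that are absent from the conclusion, so they work as rewrite rules.
\<close>

lemma idn_arr: "X \<in> obj C \<Longrightarrow> idn C X \<in> arr C" "X \<in> obj C \<Longrightarrow> src C (idn C X) = X"
    "X \<in> obj C \<Longrightarrow> tgt C (idn C X) = X"
  using idn_Mor by (auto simp: Mor_def)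

lemma cmp_arr:
  assumes "f \<in> arr C" "g \<in> arr C" "tgt C f = src C g"
  shows "g \<cdot> f \<in> arr C" "src C (g \<cdot> f) = src C f" "tgt C (g \<cdot> f) = tgt C g"
  using cmp_Mor[of f "src C f" "src C g" g "tgt C g"] assms by (auto simp: Mor_def)

lemma cmp_assoc_arr:
  assumes "f \<in> arr C" "g \<in> arr C" "h \<in> arr C" "tgt C f = src C g" "tgt C g = src C h"
  shows "(h \<cdot> g) \<cdot> f = h \<cdot> (g \<cdot> f)"
  using cmp_assoc[of f "src C f" "src C g" g "src C h" h "tgt C h"] assms by (auto simp: Mor_def)

lemma idn_cmp: "f \<in> arr C \<Longrightarrow> tgt C f = X \<Longrightarrow> idn C X \<cdot> f = f"
    "f \<in> arr C \<Longrightarrow> src C f = X \<Longrightarrow> f \<cdot> idn C X = f"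
  using idn_left idn_right by (auto simp: Mor_def)

lemma is_inverse_iff:
  "f \<in> Mor C X Y \<Longrightarrow> is_inverse C f g \<longleftrightarrow> g \<in> Mor C Y X \<and> g \<cdot> f = idn C X \<and> f \<cdot> g = idn C Y"
  by (auto simp: is_inverse_def Mor_def)

lemma is_isoE:
  assumes "is_iso C f" "f \<in> Mor C X Y"
  obtains g where "g \<in> Mor C Y X" "g \<cdot> f = idn C X" "f \<cdot> g = idn C Y"
  using assms is_inverse_iff[OF assms(2)] that by (auto simp: is_iso_def)

lemma is_isoI: "f \<in> Mor C X Y \<Longrightarrow> g \<in> Mor C Y X \<Longrightarrow> g \<cdot> f = idn C X \<Longrightarrow> f \<cdot> g = idn C Y \<Longrightarrow> is_iso C f"
  using is_inverse_iff[of f X Y g] by (auto simp: is_iso_def)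

lemma inverse_unique:
  assumes "f \<in> Mor C X Y" "g \<in> Mor C Y X" "g' \<in> Mor C Y X" "g \<cdot> f = idn C X" "f \<cdot> g' = idn C Y"
  shows "g = g'"
proof -
  have "g = g \<cdot> (f \<cdot> g')" using assms idn_right by simp
  also have "\<dots> = (g \<cdot> f) \<cdot> g'" using assms cmp_assoc by metis
  finally show ?thesis using assms idn_left by simp
qed

lemma inv_arr:
  assumes "is_iso C f" "f \<in> Mor C X Y"
  shows "inv_arr C f \<in> Mor C Y X" "inv_arr C f \<cdot> f = idn C X" "f \<cdot> inv_arr C f = idn C Y"
proof -
  obtain g where g: "is_inverse C f g" using assms(1) by (auto simp: is_iso_def)
  moreover have "g' = g" if "is_inverse C f g'" for g'
    by (rule inverse_unique[OF assms(2)]) (use that g is_inverse_iff[OF assms(2)] in simp_all)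
  ultimately have "inv_arr C f = g" unfolding inv_arr_def by (rule the_equality)
  then show "inv_arr C f \<in> Mor C Y X" "inv_arr C f \<cdot> f = idn C X" "f \<cdot> inv_arr C f = idn C Y"
    using g is_inverse_iff[OF assms(2)] by auto
qed

lemma inv_arr_iso: "is_iso C f \<Longrightarrow> f \<in> Mor C X Y \<Longrightarrow> is_iso C (inv_arr C f)"
  by (rule is_isoI[of _ Y X f]) (auto intro: inv_arr)

lemma cmp_iso:
  assumes "is_iso C f" "is_iso C g" "f \<in> Mor C X Y" "g \<in> Mor C Y Z"
  shows "is_iso C (g \<cdot> f)"
proof -
  obtain f' where f': "f' \<in> Mor C Y X" "f' \<cdot> f = idn C X" "f \<cdot> f' = idn C Y"
    using assms by (elim is_isoE)
  obtain g' where g': "g' \<in> Mor C Z Y" "g' \<cdot> g = idn C Y" "g \<cdot> g' = idn C Z"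
    using assms by (elim is_isoE)
  have "(f' \<cdot> g') \<cdot> (g \<cdot> f) = f' \<cdot> ((g' \<cdot> g) \<cdot> f)"
    using assms f'(1) g'(1) by (simp add: Mor_def cmp_arr cmp_assoc_arr)
  moreover have "(g \<cdot> f) \<cdot> (f' \<cdot> g') = g \<cdot> ((f \<cdot> f') \<cdot> g')"
    using assms f'(1) g'(1) by (simp add: Mor_def cmp_arr cmp_assoc_arr)
  ultimately show ?thesis
    using assms f' g' by (intro is_isoI[of "g \<cdot> f" X Z "f' \<cdot> g'"]) (auto intro: cmp_Mor simp: idn_left)
qed

lemma isomorphic_refl: "X \<in> obj C \<Longrightarrow> isomorphic C X X"
  unfolding isomorphic_def by (intro bexI[of _ "idn C X"] is_isoI[of _ X X "idn C X"]) (auto simp: idn_Mor idn_left[OF idn_Mor])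

lemma isomorphic_sym: "isomorphic C X Y \<Longrightarrow> isomorphic C Y X"
  unfolding isomorphic_def using inv_arr inv_arr_iso by blast

lemma isomorphic_trans: "isomorphic C X Y \<Longrightarrow> isomorphic C Y Z \<Longrightarrow> isomorphic C X Z"
  unfolding isomorphic_def using cmp_iso cmp_Mor by blast

lemma iso_mono:
  assumes "f \<in> Mor C X Y" "g \<in> Mor C Y X" "g \<cdot> f = idn C X"
  shows "is_mono C f"
  unfolding is_mono_def
proof (intro conjI allI ballI impI)
  show "f \<in> arr C" using assms(1) by (rule Mor_arr)
  fix W u v assume uv: "u \<in> Mor C W (src C f)" "v \<in> Mor C W (src C f)" "f \<cdot> u = f \<cdot> v"
  have "u = g \<cdot> (f \<cdot> u)" "v = g \<cdot> (f \<cdot> v)"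
    using assms uv(1,2) by (auto simp: Mor_src cmp_assoc[symmetric] idn_left)
  then show "u = v" using uv(3) by simp
qed

end

context linear_category begin

lemma hadd_cancel:
  assumes "f \<in> Mor C X Y" "g \<in> Mor C X Y" "h \<in> Mor C X Y" "f \<boxplus> h = g \<boxplus> h"
  shows "f = g"
proof -
  obtain h' where h': "h' \<in> Mor C X Y" "h \<boxplus> h' = hzero C X Y" using hadd_neg assms by blast
  have "f = (f \<boxplus> h) \<boxplus> h'" using assms(1-3) h' by (simp add: hadd_assoc hadd_zero)
  also have "\<dots> = g" unfolding assms(4) using assms(1-3) h' by (simp add: hadd_assoc hadd_zero)
  finally show ?thesis .
qed

lemma hzero_add: "f \<in> Mor C X Y \<Longrightarrow> hzero C X Y \<boxplus> f = f"
  using hadd_comm hadd_zero hzero_Mor Mor_objs by metis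

lemma scale_zero: assumes "f \<in> Mor C X Y" shows "hscale C 0 f = hzero C X Y"
proof (rule hadd_cancel)
  show "hscale C 0 f \<boxplus> hscale C 0 f = hzero C X Y \<boxplus> hscale C 0 f"
    using assms hscale_add_left[of f X Y 0 0] by (simp add: hzero_add hscale_Mor)
qed (use assms hscale_Mor hzero_Mor Mor_objs in blast)+

lemma scale_hzero: assumes "X \<in> obj C" "Y \<in> obj C" shows "hscale C a (hzero C X Y) = hzero C X Y"
  using hscale_mult[of "hzero C X Y" X Y a 0] hzero_Mor[OF assms] by (simp add: scale_zero)

lemma hzero_cmp: assumes "f \<in> Mor C X Y" "Z \<in> obj C" shows "hzero C Y Z \<cdot> f = hzero C X Z"
proof -
  have z: "hzero C Y Z \<in> Mor C Y Z" using assms Mor_objs hzero_Mor by blast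
  have "hzero C Y Z \<cdot> f = hscale C 0 (hzero C Y Z) \<cdot> f" using z by (simp add: scale_zero)
  also have "\<dots> = hscale C 0 (hzero C Y Z \<cdot> f)" using z assms by (simp add: cmp_scale_left)
  finally show ?thesis using scale_zero[OF cmp_Mor[OF assms(1) z]] by simp
qed

lemma cmp_hzero: assumes "g \<in> Mor C Y Z" "X \<in> obj C" shows "g \<cdot> hzero C X Y = hzero C X Z"
proof -
  have z: "hzero C X Y \<in> Mor C X Y" using assms Mor_objs hzero_Mor by blast
  have "g \<cdot> hzero C X Y = g \<cdot> hscale C 0 (hzero C X Y)" using z by (simp add: scale_zero)
  also have "\<dots> = hscale C 0 (g \<cdot> hzero C X Y)" using z assms by (simp add: cmp_scale_right)
  finally show ?thesis using scale_zero[OF cmp_Mor[OF z assms(1)]] by simp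
qed

lemma add_neg: "f \<in> Mor C X Y \<Longrightarrow> f \<boxplus> hscale C (-1) f = hzero C X Y"
  using hscale_add_left[of f X Y 1 "-1"] by (simp add: hscale_one scale_zero)

lemma eq_if_difference_zero:
  assumes "f \<in> Mor C X Y" "g \<in> Mor C X Y" "f \<boxplus> hscale C (-1) g = hzero C X Y" shows "f = g"
  using hadd_cancel[of f X Y g "hscale C (-1) g"] assms by (simp add: add_neg hscale_Mor)

lemma hadd_swap:
  assumes "a \<in> Mor C X Y" "b \<in> Mor C X Y" "c \<in> Mor C X Y" "d \<in> Mor C X Y"
  shows "(a \<boxplus> b) \<boxplus> (c \<boxplus> d) = (a \<boxplus> c) \<boxplus> (b \<boxplus> d)"
proof -
  have "(a \<boxplus> b) \<boxplus> (c \<boxplus> d) = a \<boxplus> ((b \<boxplus> c) \<boxplus> d)"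
    using assms by (simp add: hadd_assoc hadd_Mor)
  also have "\<dots> = a \<boxplus> ((c \<boxplus> b) \<boxplus> d)" using assms hadd_comm by metis
  also have "\<dots> = (a \<boxplus> c) \<boxplus> (b \<boxplus> d)"
    using assms by (simp add: hadd_assoc hadd_Mor)
  finally show ?thesis .
qed

text \<open>
  The Hom spaces are subsets of a type without algebraic structure, so linear combinations are formed by
  recursion over a list of morphisms, with the coefficients given by a sequence.
\<close>

primrec lincomb :: "'o \<Rightarrow> 'o \<Rightarrow> 'm list \<Rightarrow> (nat \<Rightarrow> 'k) \<Rightarrow> 'm" where
  "lincomb X Y [] c = hzero C X Y"
| "lincomb X Y (b # bs) c = hscale C (c 0) b \<boxplus> lincomb X Y bs (\<lambda>i. c (Suc i))"

lemma lincomb_Mor: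
  "X \<in> obj C \<Longrightarrow> Y \<in> obj C \<Longrightarrow> set bs \<subseteq> Mor C X Y \<Longrightarrow> lincomb X Y bs c \<in> Mor C X Y"
  by (induction bs arbitrary: c) (auto simp: hzero_Mor hadd_Mor hscale_Mor)

lemma lincomb_add:
  assumes "X \<in> obj C" "Y \<in> obj C" "set bs \<subseteq> Mor C X Y"
  shows "lincomb X Y bs (\<lambda>i. c i + d i) = lincomb X Y bs c \<boxplus> lincomb X Y bs d"
  using assms(3)
proof (induction bs arbitrary: c d)
  case Nil
  then show ?case using hzero_add[OF hzero_Mor] assms by simp
next
  case (Cons b bs)
  then show ?case
    using assms by (simp add: hscale_add_left[of b X Y] hadd_swap[of _ X Y] hscale_Mor lincomb_Mor)
qed

lemma lincomb_scale:
  assumes "X \<in> obj C" "Y \<in> obj C" "set bs \<subseteq> Mor C X Y"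
  shows "lincomb X Y bs (\<lambda>i. a * c i) = hscale C a (lincomb X Y bs c)"
  using assms(3)
proof (induction bs arbitrary: c)
  case Nil
  then show ?case using scale_hzero assms by simp
next
  case (Cons b bs)
  then show ?case
    using assms by (simp add: hscale_mult[of b X Y] hscale_add_right[of _ X Y] hscale_Mor lincomb_Mor)
qed

lemma lincomb_cong: "(\<And>i. i < length bs \<Longrightarrow> c i = d i) \<Longrightarrow> lincomb X Y bs c = lincomb X Y bs d"
proof (induction bs arbitrary: c d)
  case (Cons b bs)
  have "c 0 = d 0" using Cons.prems[of 0] by simp
  moreover have "lincomb X Y bs (\<lambda>i. c (Suc i)) = lincomb X Y bs (\<lambda>i. d (Suc i))"
    by (rule Cons.IH) (use Cons.prems in simp)
  ultimately show ?case by simp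
qed simp

lemma lincomb_zero:
  assumes "X \<in> obj C" "Y \<in> obj C" "set bs \<subseteq> Mor C X Y" "\<And>i. i < length bs \<Longrightarrow> c i = 0"
  shows "lincomb X Y bs c = hzero C X Y"
proof -
  have "lincomb X Y bs c = lincomb X Y bs (\<lambda>i. 0 * c i)"
    using assms(4) by (intro lincomb_cong) simp
  also have "\<dots> = hzero C X Y"
    unfolding lincomb_scale[OF assms(1-3)] by (rule scale_zero[OF lincomb_Mor[OF assms(1-3)]])
  finally show ?thesis .
qed

lemma lincomb_append:
  assumes "X \<in> obj C" "Y \<in> obj C" "set as \<subseteq> Mor C X Y" "set bs \<subseteq> Mor C X Y"
  shows "lincomb X Y (as @ bs) c = lincomb X Y as c \<boxplus> lincomb X Y bs (\<lambda>i. c (i + length as))"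
  using assms(3)
proof (induction as arbitrary: c)
  case Nil
  then show ?case using hzero_add[OF lincomb_Mor] assms by simp
next
  case (Cons b as)
  then show ?case using assms by (simp add: hadd_assoc[of _ X Y] hscale_Mor lincomb_Mor)
qed

lemma lincomb_unit:
  assumes "X \<in> obj C" "Y \<in> obj C" "set bs \<subseteq> Mor C X Y" "i < length bs"
  shows "lincomb X Y bs (\<lambda>j. if j = i then 1 else 0) = bs ! i"
  using assms(3,4)
proof (induction bs arbitrary: i)
  case (Cons b bs)
  show ?case
  proof (cases i)
    case 0
    then show ?thesis
      using Cons.prems assms by (simp add: lincomb_zero hscale_one[of b X Y] hadd_zero)
  next
    case (Suc i')
    then have "bs ! i' \<in> Mor C X Y" using Cons.prems nth_mem[of i' bs] by auto
    then show ?thesis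
      using Suc Cons assms scale_zero[of b X Y] by (simp add: hzero_add[of _ X Y])
  qed
qed simp

lemma lin_span_iff_lincomb:
  assumes "X \<in> obj C" "Y \<in> obj C" "set bs \<subseteq> Mor C X Y"
  shows "f \<in> lin_span C X Y (set bs) \<longleftrightarrow> (\<exists>c. f = lincomb X Y bs c)"
proof
  assume "f \<in> lin_span C X Y (set bs)"
  then show "\<exists>c. f = lincomb X Y bs c"
  proof induction
    case zero
    show ?case using lincomb_zero[OF assms, of "\<lambda>_. 0"] by metis
  next
    case (base f)
    then show ?case using lincomb_unit[OF assms] by (metis in_set_conv_nth)
  next
    case (add f g)
    then show ?case using lincomb_add[OF assms] by metis
  next
    case (scale f a)
    then show ?case using lincomb_scale[OF assms] by metis
  qed
next
  have "lincomb X Y as c \<in> lin_span C X Y (set bs)" if "set as \<subseteq> set bs" for as c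
    using that by (induction as arbitrary: c) (auto intro: lin_span.intros)
  then show "\<exists>c. f = lincomb X Y bs c \<Longrightarrow> f \<in> lin_span C X Y (set bs)" by blast
qed

lemma dependent_if_longer:
  assumes XY: "X \<in> obj C" "Y \<in> obj C" and bs: "set bs \<subseteq> Mor C X Y"
    and fs: "set fs \<subseteq> lin_span C X Y (set bs)" "length bs < length fs"
  shows "\<exists>c. (\<exists>i<length fs. c i \<noteq> 0) \<and> lincomb X Y fs c = hzero C X Y"
proof -
  have "\<forall>f \<in> set fs. \<exists>a. f = lincomb X Y bs a"
    using fs lin_span_iff_lincomb[OF XY bs] by blast
  then obtain a where a: "\<And>f. f \<in> set fs \<Longrightarrow> f = lincomb X Y bs (a f)" by metis
  have expand: "lincomb X Y gs c = lincomb X Y bs (\<lambda>j. \<Sum>i<length gs. c i * a (gs ! i) j)"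
    if "set gs \<subseteq> set fs" for gs c
    using that
  proof (induction gs arbitrary: c)
    case Nil
    then show ?case using lincomb_zero[OF XY bs, of "\<lambda>_. 0"] by simp
  next
    case (Cons g gs)
    have "lincomb X Y (g # gs) c = hscale C (c 0) g \<boxplus>
        lincomb X Y bs (\<lambda>j. \<Sum>i<length gs. c (Suc i) * a (gs ! i) j)"
      using Cons by simp
    also have "hscale C (c 0) g = lincomb X Y bs (\<lambda>j. c 0 * a g j)"
      using a[of g] Cons.prems lincomb_scale[OF XY bs, of "c 0" "a g"] by simp
    also have "\<dots> \<boxplus> lincomb X Y bs (\<lambda>j. \<Sum>i<length gs. c (Suc i) * a (gs ! i) j) =
        lincomb X Y bs (\<lambda>j. c 0 * a g j + (\<Sum>i<length gs. c (Suc i) * a (gs ! i) j))"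
      by (rule lincomb_add[OF XY bs, symmetric])
    finally show ?case by (simp add: sum.lessThan_Suc_shift del: sum.lessThan_Suc)
  qed
  obtain c where c: "\<exists>i\<in>{..<length fs}. c i \<noteq> 0"
    "\<forall>j\<in>{..<length bs}. (\<Sum>i\<in>{..<length fs}. c i * a (fs ! i) j) = 0"
    using more_rows_than_columns_dependent[of "{..<length bs}" "{..<length fs}" "\<lambda>i. a (fs ! i)"] fs(2)
    by auto
  have "lincomb X Y fs c = hzero C X Y"
    unfolding expand[OF subset_refl] by (rule lincomb_zero[OF XY bs]) (use c(2) in simp)
  then show ?thesis using c(1) by auto
qed

definition is_basis :: "'o \<Rightarrow> 'o \<Rightarrow> 'm list \<Rightarrow> bool" where
  "is_basis X Y bs \<longleftrightarrow> X \<in> obj C \<and> Y \<in> obj C \<and> set bs \<subseteq> Mor C X Y \<and>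
     (\<forall>f \<in> Mor C X Y. \<exists>c. f = lincomb X Y bs c) \<and>
     (\<forall>c. lincomb X Y bs c = hzero C X Y \<longrightarrow> (\<forall>i<length bs. c i = 0))"

text \<open>
  The elements of a basis number at most as many as those of any spanning set, as otherwise they would be
  dependent. So the least size of a spanning set is the length of any basis.
\<close>

lemma basis_dim: assumes "is_basis X Y bs" shows "dim_Mor C X Y = length bs"
proof -
  have XY: "X \<in> obj C" "Y \<in> obj C" and bs: "set bs \<subseteq> Mor C X Y"
    using assms by (auto simp: is_basis_def)
  have span: "lin_span C X Y (set bs) = Mor C X Y"
    using lin_span_iff_lincomb[OF XY bs] lincomb_Mor[OF XY bs] assms by (auto simp: is_basis_def)
  have lower: "length bs \<le> card B" if B: "finite_spanning C X Y B" for B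
  proof (rule ccontr)
    assume "\<not> ?thesis"
    moreover obtain bs' where bs': "set bs' = B" "distinct bs'"
      using B finite_distinct_list[of B] by (auto simp: finite_spanning_def)
    moreover have "length bs' = card B" using distinct_card[OF bs'(2)] bs'(1) by simp
    ultimately obtain c i where "i < length bs" "c i \<noteq> 0" "lincomb X Y bs c = hzero C X Y"
      using dependent_if_longer[OF XY, of bs' bs] bs B by (auto simp: finite_spanning_def)
    then show False using assms by (auto simp: is_basis_def)
  qed
  have fsp: "finite_spanning C X Y (set bs)" using bs span by (simp add: finite_spanning_def)
  then have "card (set bs) = length bs" using lower card_length antisym by blast
  then show ?thesis unfolding dim_Mor_def using fsp lower by (intro Least_equality) auto
qed

lemma dim_pos_if_nonzero:
  assumes "is_basis X Y bs" "f \<in> Mor C X Y" "f \<noteq> hzero C X Y"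
  shows "dim_Mor C X Y > 0"
proof -
  obtain c where "f = lincomb X Y bs c" using assms by (auto simp: is_basis_def)
  then have "bs \<noteq> []" using assms(3) by auto
  then show ?thesis using basis_dim[OF assms(1)] by simp
qed

text \<open>
  The zero space is spanned by the empty set.
\<close>

lemma nonzero_if_dim_pos:
  assumes XY: "X \<in> obj C" "Y \<in> obj C" and "dim_Mor C X Y > 0"
  obtains f where "f \<in> Mor C X Y" "f \<noteq> hzero C X Y"
proof (rule ccontr)
  assume "\<not> thesis"
  then have "Mor C X Y = {hzero C X Y}" using that hzero_Mor[OF XY] by blast
  moreover have "f = hzero C X Y" if "f \<in> lin_span C X Y {}" for f
    using that by induction (auto simp: hzero_add[OF hzero_Mor[OF XY]] scale_hzero[OF XY])
  then have "lin_span C X Y {} = {hzero C X Y}" by (intro equalityI subsetI) (auto intro: lin_span.zero)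
  ultimately have "finite_spanning C X Y {}" by (simp add: finite_spanning_def)
  then have "dim_Mor C X Y = 0" unfolding dim_Mor_def by (intro Least_eq_0) auto
  then show False using assms(3) by simp
qed

definition linear_map :: "'o \<Rightarrow> 'o \<Rightarrow> 'o \<Rightarrow> 'o \<Rightarrow> ('m \<Rightarrow> 'm) \<Rightarrow> bool" where
  "linear_map X Y X' Y' T \<longleftrightarrow>
     (\<forall>f \<in> Mor C X Y. T f \<in> Mor C X' Y') \<and>
     (\<forall>f \<in> Mor C X Y. \<forall>g \<in> Mor C X Y. T (f \<boxplus> g) = T f \<boxplus> T g) \<and>
     (\<forall>f \<in> Mor C X Y. \<forall>a. T (hscale C a f) = hscale C a (T f))"

lemma linear_map_zero:
  assumes "linear_map X Y X' Y' T" "X \<in> obj C" "Y \<in> obj C"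
  shows "T (hzero C X Y) = hzero C X' Y'"
  using assms hzero_Mor scale_zero[of "hzero C X Y" X Y] scale_zero[of "T (hzero C X Y)" X' Y']
  unfolding linear_map_def by metis

lemma linear_map_lincomb:
  assumes T: "linear_map X Y X' Y' T" and XY: "X \<in> obj C" "Y \<in> obj C" and bs: "set bs \<subseteq> Mor C X Y"
  shows "T (lincomb X Y bs c) = lincomb X' Y' (map T bs) c"
  using bs
proof (induction bs arbitrary: c)
  case Nil
  then show ?case using linear_map_zero[OF T XY] by simp
next
  case (Cons b bs)
  then show ?case using T XY by (simp add: linear_map_def hscale_Mor lincomb_Mor)
qed

lemma basis_transfer:
  assumes bs: "is_basis X Y bs" and T: "linear_map X Y X' Y' T" and XY': "X' \<in> obj C" "Y' \<in> obj C"
    and surj: "\<And>g. g \<in> Mor C X' Y' \<Longrightarrow> \<exists>f \<in> Mor C X Y. T f = g"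
    and inj: "\<And>f. f \<in> Mor C X Y \<Longrightarrow> T f = hzero C X' Y' \<Longrightarrow> f = hzero C X Y"
  shows "is_basis X' Y' (map T bs)"
proof -
  have XY: "X \<in> obj C" "Y \<in> obj C" and sub: "set bs \<subseteq> Mor C X Y" using bs by (auto simp: is_basis_def)
  note lc = linear_map_lincomb[OF T XY sub, symmetric]
  have "\<exists>c. g = lincomb X' Y' (map T bs) c" if g: "g \<in> Mor C X' Y'" for g
  proof -
    obtain f where f: "f \<in> Mor C X Y" "T f = g" using surj[OF g] by blast
    then obtain c where "f = lincomb X Y bs c" using bs by (auto simp: is_basis_def)
    then show ?thesis using f(2) lc by auto
  qed
  moreover have "c i = 0" if "lincomb X' Y' (map T bs) c = hzero C X' Y'" "i < length bs" for c i
    using that inj[OF lincomb_Mor[OF XY sub]] bs by (simp add: lc is_basis_def)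
  moreover have "set (map T bs) \<subseteq> Mor C X' Y'" using T sub by (auto simp: linear_map_def)
  ultimately show ?thesis using XY' by (simp add: is_basis_def)
qed

text \<open>
  A space that is split by \<open>\<alpha>, \<beta>, \<pi>, \<rho>\<close> into a direct sum of two others has the union of their bases as a
  basis. It is applied to \<open>Hom(A, X \<oplus> Y)\<close> and to \<open>Hom(X \<oplus> Y, A)\<close>.
\<close>

lemma basis_append:
  assumes as: "is_basis X Y as" and bs: "is_basis X' Y' bs" and Z: "Z \<in> obj C" "Z' \<in> obj C"
    and \<alpha>: "linear_map X Y Z Z' \<alpha>" and \<beta>: "linear_map X' Y' Z Z' \<beta>"
    and \<pi>: "linear_map Z Z' X Y \<pi>" and \<rho>: "linear_map Z Z' X' Y' \<rho>"
    and pa: "\<And>f. f \<in> Mor C X Y \<Longrightarrow> \<pi> (\<alpha> f) = f" and rb: "\<And>f. f \<in> Mor C X' Y' \<Longrightarrow> \<rho> (\<beta> f) = f"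
    and pb: "\<And>f. f \<in> Mor C X' Y' \<Longrightarrow> \<pi> (\<beta> f) = hzero C X Y"
    and ra: "\<And>f. f \<in> Mor C X Y \<Longrightarrow> \<rho> (\<alpha> f) = hzero C X' Y'"
    and sum: "\<And>f. f \<in> Mor C Z Z' \<Longrightarrow> \<alpha> (\<pi> f) \<boxplus> \<beta> (\<rho> f) = f"
  shows "is_basis Z Z' (map \<alpha> as @ map \<beta> bs)"
proof -
  have XY: "X \<in> obj C" "Y \<in> obj C" and suba: "set as \<subseteq> Mor C X Y" using as by (auto simp: is_basis_def)
  have XY': "X' \<in> obj C" "Y' \<in> obj C" and subb: "set bs \<subseteq> Mor C X' Y'" using bs by (auto simp: is_basis_def)
  have sub: "set (map \<alpha> as) \<subseteq> Mor C Z Z'" "set (map \<beta> bs) \<subseteq> Mor C Z Z'"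
    using \<alpha> \<beta> suba subb by (auto simp: linear_map_def)
  have lc: "lincomb Z Z' (map \<alpha> as @ map \<beta> bs) c =
      \<alpha> (lincomb X Y as c) \<boxplus> \<beta> (lincomb X' Y' bs (\<lambda>i. c (i + length as)))" for c
    using lincomb_append[OF Z sub] linear_map_lincomb[OF \<alpha> XY suba] linear_map_lincomb[OF \<beta> XY' subb]
    by simp
  have "\<exists>c. f = lincomb Z Z' (map \<alpha> as @ map \<beta> bs) c" if f: "f \<in> Mor C Z Z'" for f
  proof -
    have "\<pi> f \<in> Mor C X Y" "\<rho> f \<in> Mor C X' Y'" using f \<pi> \<rho> by (auto simp: linear_map_def)
    then obtain c d where c: "\<pi> f = lincomb X Y as c" and d: "\<rho> f = lincomb X' Y' bs d"
      using as bs unfolding is_basis_def by meson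
    define e where "e i = (if i < length as then c i else d (i - length as))" for i
    have "lincomb X Y as e = \<pi> f" unfolding c by (rule lincomb_cong) (simp add: e_def)
    moreover have "lincomb X' Y' bs (\<lambda>i. e (i + length as)) = \<rho> f" unfolding d by (simp add: e_def)
    ultimately show ?thesis using sum[OF f] lc[of e] by metis
  qed
  moreover have "c i = 0"
    if zero: "lincomb Z Z' (map \<alpha> as @ map \<beta> bs) c = hzero C Z Z'" and i: "i < length as + length bs" for c i
  proof -
    define f where "f = lincomb X Y as c"
    define g where "g = lincomb X' Y' bs (\<lambda>i. c (i + length as))"
    have fg: "f \<in> Mor C X Y" "g \<in> Mor C X' Y'"
      unfolding f_def g_def using lincomb_Mor XY XY' suba subb by auto
    then have fg': "\<alpha> f \<in> Mor C Z Z'" "\<beta> g \<in> Mor C Z Z'" using \<alpha> \<beta> by (auto simp: linear_map_def)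
    have z: "\<alpha> f \<boxplus> \<beta> g = hzero C Z Z'" using zero lc by (simp add: f_def g_def)
    have "\<pi> (\<alpha> f \<boxplus> \<beta> g) = f" "\<rho> (\<alpha> f \<boxplus> \<beta> g) = g"
      using \<pi> \<rho> fg fg' pa rb pb ra hadd_zero hzero_add by (auto simp: linear_map_def)
    then have "f = hzero C X Y" "g = hzero C X' Y'"
      using z linear_map_zero[OF \<pi> Z] linear_map_zero[OF \<rho> Z] by auto
    then have "\<forall>i<length as. c i = 0" "\<forall>i<length bs. c (i + length as) = 0"
      using as bs unfolding is_basis_def f_def g_def by blast+
    moreover have "i - length as < length bs" "i - length as + length as = i" if "\<not> i < length as"
      using i that by auto
    ultimately show ?thesis by (cases "i < length as") metis+
  qed
  ultimately show ?thesis using Z sub by (simp add: is_basis_def)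
qed

end

section \<open>Duals give adjoint functors\<close>

context linear_monoidal_category begin

lemma tarr_arr:
  assumes "f \<in> arr C" "g \<in> arr C"
  shows "f \<star> g \<in> arr C" "src C (f \<star> g) = src C f \<boxtimes> src C g" "tgt C (f \<star> g) = tgt C f \<boxtimes> tgt C g"
  using tarr_Mor[of f "src C f" "tgt C f" g "src C g" "tgt C g"] assms by (auto simp: Mor_def)

lemma interchange:
  assumes "f \<in> arr C" "f' \<in> arr C" "g \<in> arr C" "g' \<in> arr C" "tgt C f = src C f'" "tgt C g = src C g'"
  shows "(f' \<star> g') \<cdot> (f \<star> g) = (f' \<cdot> f) \<star> (g' \<cdot> g)"
  using tarr_cmp[of f "src C f" "src C f'" f' "tgt C f'" g "src C g" "src C g'" g' "tgt C g'"] assms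
  by (auto simp: Mor_def)

lemma assoc_arr:
  assumes "X \<in> obj C" "Y \<in> obj C" "Z \<in> obj C"
  shows "assoc C X Y Z \<in> arr C" "src C (assoc C X Y Z) = (X \<boxtimes> Y) \<boxtimes> Z"
    "tgt C (assoc C X Y Z) = X \<boxtimes> (Y \<boxtimes> Z)"
    "inv_arr C (assoc C X Y Z) \<in> arr C" "src C (inv_arr C (assoc C X Y Z)) = X \<boxtimes> (Y \<boxtimes> Z)"
    "tgt C (inv_arr C (assoc C X Y Z)) = (X \<boxtimes> Y) \<boxtimes> Z"
    "inv_arr C (assoc C X Y Z) \<cdot> assoc C X Y Z = idn C ((X \<boxtimes> Y) \<boxtimes> Z)"
    "assoc C X Y Z \<cdot> inv_arr C (assoc C X Y Z) = idn C (X \<boxtimes> (Y \<boxtimes> Z))"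
  using assoc_Mor[OF assms] inv_arr[OF assoc_iso[OF assms] assoc_Mor[OF assms]] by (auto simp: Mor_def)

lemma lun_arr:
  assumes "X \<in> obj C"
  shows "lun C X \<in> arr C" "src C (lun C X) = unit_obj C \<boxtimes> X" "tgt C (lun C X) = X"
    "inv_arr C (lun C X) \<in> arr C" "src C (inv_arr C (lun C X)) = X"
    "tgt C (inv_arr C (lun C X)) = unit_obj C \<boxtimes> X"
    "inv_arr C (lun C X) \<cdot> lun C X = idn C (unit_obj C \<boxtimes> X)"
    "lun C X \<cdot> inv_arr C (lun C X) = idn C X"
  using lun_Mor[OF assms] inv_arr[OF lun_iso[OF assms] lun_Mor[OF assms]] by (auto simp: Mor_def)

lemma run_arr:
  assumes "X \<in> obj C"
  shows "run C X \<in> arr C" "src C (run C X) = X \<boxtimes> unit_obj C" "tgt C (run C X) = X"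
    "inv_arr C (run C X) \<in> arr C" "src C (inv_arr C (run C X)) = X"
    "tgt C (inv_arr C (run C X)) = X \<boxtimes> unit_obj C"
    "inv_arr C (run C X) \<cdot> run C X = idn C (X \<boxtimes> unit_obj C)"
    "run C X \<cdot> inv_arr C (run C X) = idn C X"
  using run_Mor[OF assms] inv_arr[OF run_iso[OF assms] run_Mor[OF assms]] by (auto simp: Mor_def)

lemmas typing = idn_arr cmp_arr tarr_arr assoc_arr(1-6) lun_arr(1-6) run_arr(1-6) tobj_obj unit_obj

lemma cmp_inverse_left:
  assumes "h \<in> Mor C Y X" "g \<in> Mor C X Y" "h \<cdot> g = idn C X" "f \<in> Mor C W X"
  shows "h \<cdot> (g \<cdot> f) = f"
  using assms cmp_assoc[of f W X g Y h X] by (simp add: idn_left)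

text \<open>
  Naturality squares are stated for \<open>assoc\<close> and \<open>lun\<close>; this turns them into squares for the inverses.
\<close>

lemma square_inverse:
  assumes "a \<cdot> f = g \<cdot> b" "a' \<cdot> a = idn C (src C a)" "b \<cdot> b' = idn C (tgt C b)"
    and arr: "a \<in> arr C" "a' \<in> arr C" "b \<in> arr C" "b' \<in> arr C" "f \<in> arr C" "g \<in> arr C"
    and st: "src C a' = tgt C a" "tgt C a' = src C a" "src C b' = tgt C b" "tgt C b' = src C b"
      "tgt C f = src C a" "src C f = src C b" "src C g = tgt C b" "tgt C g = tgt C a"
  shows "a' \<cdot> g = f \<cdot> b'"
proof -
  have "a' \<cdot> g = a' \<cdot> (g \<cdot> (b \<cdot> b'))" using assms by (simp add: idn_cmp)
  also have "g \<cdot> (b \<cdot> b') = (a \<cdot> f) \<cdot> b'" unfolding assms(1) using arr st by (simp add: cmp_assoc_arr)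
  also have "a' \<cdot> ((a \<cdot> f) \<cdot> b') = (a' \<cdot> a) \<cdot> (f \<cdot> b')" using arr st by (simp add: cmp_arr cmp_assoc_arr)
  also have "\<dots> = f \<cdot> b'" unfolding assms(2) using arr st by (simp add: cmp_arr idn_cmp)
  finally show ?thesis .
qed

lemma inverse_of_cmp:
  assumes "b \<cdot> b' = idn C Y" "c \<cdot> c' = idn C Z" "b \<in> Mor C X Y" "b' \<in> Mor C Y X" "c \<in> Mor C Y Z" "c' \<in> Mor C Z Y"
  shows "(c \<cdot> b) \<cdot> (b' \<cdot> c') = idn C Z"
proof -
  have "(c \<cdot> b) \<cdot> (b' \<cdot> c') = c \<cdot> ((b \<cdot> b') \<cdot> c')"
    using assms(3-6) by (simp add: Mor_def cmp_arr cmp_assoc_arr)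
  then show ?thesis using assms by (simp add: idn_left)
qed

text \<open>
  A commuting square in front of a further morphism \<open>t\<close>, in the right-associated form of composites.
\<close>

lemma slide:
  assumes "g \<cdot> f = k \<cdot> h" "f \<in> arr C" "g \<in> arr C" "h \<in> arr C" "k \<in> arr C" "t \<in> arr C"
    "tgt C f = src C g" "tgt C h = src C k" "tgt C t = src C f" "tgt C t = src C h"
  shows "g \<cdot> (f \<cdot> t) = k \<cdot> (h \<cdot> t)"
  using assms by (metis cmp_assoc_arr)

lemma tarr_iso:
  assumes "is_iso C f" "f \<in> Mor C X X'" "is_iso C g" "g \<in> Mor C Y Y'"
  shows "is_iso C (f \<star> g)"
proof -
  obtain f' where f': "f' \<in> Mor C X' X" "f' \<cdot> f = idn C X" "f \<cdot> f' = idn C X'"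
    using assms by (elim is_isoE)
  obtain g' where g': "g' \<in> Mor C Y' Y" "g' \<cdot> g = idn C Y" "g \<cdot> g' = idn C Y'"
    using assms by (elim is_isoE)
  have "X \<in> obj C" "X' \<in> obj C" "Y \<in> obj C" "Y' \<in> obj C" using assms Mor_objs by blast+
  then show ?thesis
    using assms f' g'
    by (intro is_isoI[of "f \<star> g" "X \<boxtimes> Y" "X' \<boxtimes> Y'" "f' \<star> g'"] tarr_Mor)
      (auto simp: Mor_def interchange tarr_idn)
qed

lemma iso_rules:
  "X \<in> obj C \<Longrightarrow> is_iso C (idn C X)"
  "is_iso C f \<Longrightarrow> is_iso C g \<Longrightarrow> tgt C f = src C g \<Longrightarrow> is_iso C (g \<cdot> f)"
  "is_iso C f \<Longrightarrow> is_iso C g \<Longrightarrow> is_iso C (f \<star> g)"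
  "X \<in> obj C \<Longrightarrow> is_iso C (lun C X)" "X \<in> obj C \<Longrightarrow> is_iso C (inv_arr C (lun C X))"
  "X \<in> obj C \<Longrightarrow> Y \<in> obj C \<Longrightarrow> Z \<in> obj C \<Longrightarrow> is_iso C (assoc C X Y Z)"
  "X \<in> obj C \<Longrightarrow> Y \<in> obj C \<Longrightarrow> Z \<in> obj C \<Longrightarrow> is_iso C (inv_arr C (assoc C X Y Z))"
proof -
  have arr: "h \<in> arr C" if "is_iso C h" for h using that by (auto simp: is_iso_def is_inverse_def)
  show "is_iso C (idn C X)" if "X \<in> obj C"
    using idn_Mor[OF that] by (intro is_isoI[of _ X X "idn C X"]) (auto simp: idn_left[OF idn_Mor[OF that]])
  show "is_iso C (g \<cdot> f)" if "is_iso C f" "is_iso C g" "tgt C f = src C g"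
    using that cmp_iso[of f g "src C f" "src C g" "tgt C g"] arr by (simp add: Mor_def)
  show "is_iso C (f \<star> g)" if "is_iso C f" "is_iso C g"
    using that tarr_iso[of f "src C f" "tgt C f" g "src C g" "tgt C g"] arr by (simp add: Mor_def)
qed (intro lun_iso assoc_iso inv_arr_iso[OF lun_iso lun_Mor] inv_arr_iso[OF assoc_iso assoc_Mor]; assumption)+

text \<open>
  The two maps \<open>Hom(Y \<otimes> A, B) \<rightarrow> Hom(A, X \<otimes> B)\<close> and back that the coevaluation and the evaluation of a dual \<open>Y\<close> of
  \<open>X\<close> define.
\<close>

definition adj_left :: "'o \<Rightarrow> 'o \<Rightarrow> 'm \<Rightarrow> 'o \<Rightarrow> 'm \<Rightarrow> 'm" where
  "adj_left X Y coev A f =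
     (idn C X \<star> f) \<cdot> assoc C X Y A \<cdot> (coev \<star> idn C A) \<cdot> inv_arr C (lun C A)"

definition adj_right :: "'o \<Rightarrow> 'o \<Rightarrow> 'm \<Rightarrow> 'o \<Rightarrow> 'm \<Rightarrow> 'm" where
  "adj_right X Y ev B g =
     lun C B \<cdot> (ev \<star> idn C B) \<cdot> inv_arr C (assoc C Y X B) \<cdot> (idn C Y \<star> g)"

text \<open>
  One round trip is composition with a fixed morphism, up to the zigzag identity of \<open>Y\<close>. That morphism is
  in fact the identity, by coherence; but it is composed of structural isomorphisms, and its
  invertibility already makes the maps of the adjunction bijective. Moving \<open>f\<close> to the left by naturality leaves the
  zigzag of \<open>Y\<close> tensored with \<open>A\<close>, after one use of the pentagon and one of the triangle identity.
\<close>

lemma adj_right_left: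
  assumes X: "X \<in> obj C" and Y: "Y \<in> obj C"
    and ev: "ev \<in> Mor C (Y \<boxtimes> X) (unit_obj C)" and coev: "coev \<in> Mor C (unit_obj C) (X \<boxtimes> Y)"
    and zigzag: "lun C Y \<cdot> (ev \<star> idn C Y) \<cdot> inv_arr C (assoc C Y X Y) \<cdot> (idn C Y \<star> coev)
          \<cdot> inv_arr C (run C Y) = idn C Y"
    and f: "f \<in> Mor C (Y \<boxtimes> A) B" and A: "A \<in> obj C"
  shows "adj_right X Y ev B (adj_left X Y coev A f) =
    f \<cdot> lun C (Y \<boxtimes> A) \<cdot> assoc C (unit_obj C) Y A \<cdot> (inv_arr C (lun C Y) \<star> idn C A)"
proof -
  define I where "I = unit_obj C"
  have B: "B \<in> obj C" and I: "I \<in> obj C" using f Mor_objs unit_obj I_def by blast+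
  have fs: "f \<in> arr C" "src C f = Y \<boxtimes> A" "tgt C f = B"
    and evs: "ev \<in> arr C" "src C ev = Y \<boxtimes> X" "tgt C ev = I"
    and coevs: "coev \<in> arr C" "src C coev = I" "tgt C coev = X \<boxtimes> Y"
    using f ev coev by (auto simp: Mor_def I_def)
  note ty = X Y A B I fs evs coevs typing[folded I_def]
  \<comment> \<open>The facts up to \<open>s8\<close> move one factor each; \<open>r2\<close> to \<open>r8\<close> are the same moves within a longer composite.\<close>
  have s1: "idn C Y \<star> adj_left X Y coev A f = (idn C Y \<star> (idn C X \<star> f)) \<cdot> (idn C Y \<star> assoc C X Y A)
      \<cdot> (idn C Y \<star> (coev \<star> idn C A)) \<cdot> (idn C Y \<star> inv_arr C (lun C A))"
    unfolding adj_left_def by (simp add: ty interchange idn_cmp)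
  have s2: "inv_arr C (assoc C Y X B) \<cdot> (idn C Y \<star> (idn C X \<star> f))
      = (idn C (Y \<boxtimes> X) \<star> f) \<cdot> inv_arr C (assoc C Y X (Y \<boxtimes> A))"
  proof (rule square_inverse)
    show "assoc C Y X B \<cdot> (idn C (Y \<boxtimes> X) \<star> f) = (idn C Y \<star> (idn C X \<star> f)) \<cdot> assoc C Y X (Y \<boxtimes> A)"
      using assoc_natural[OF idn_Mor[OF Y] idn_Mor[OF X] f] X Y by (simp add: tarr_idn)
  qed (simp_all add: ty assoc_arr)
  have s34: "lun C B \<cdot> (ev \<star> idn C B) \<cdot> (idn C (Y \<boxtimes> X) \<star> f) = f \<cdot> lun C (Y \<boxtimes> A) \<cdot> (ev \<star> idn C (Y \<boxtimes> A))"
  proof -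
    have "(ev \<star> idn C B) \<cdot> (idn C (Y \<boxtimes> X) \<star> f) = (idn C I \<star> f) \<cdot> (ev \<star> idn C (Y \<boxtimes> A))"
      by (simp add: ty interchange idn_cmp)
    moreover have "lun C B \<cdot> (idn C I \<star> f) \<cdot> (ev \<star> idn C (Y \<boxtimes> A)) = f \<cdot> lun C (Y \<boxtimes> A) \<cdot> (ev \<star> idn C (Y \<boxtimes> A))"
      by (rule slide) (use lun_natural[OF f] in \<open>simp_all add: ty flip: I_def\<close>)
    ultimately show ?thesis by simp
  qed
  have pent: "inv_arr C (assoc C Y X (Y \<boxtimes> A)) \<cdot> (idn C Y \<star> assoc C X Y A)
      = assoc C (Y \<boxtimes> X) Y A \<cdot> (inv_arr C (assoc C Y X Y) \<star> idn C A) \<cdot> inv_arr C (assoc C Y (X \<boxtimes> Y) A)"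
  proof -
    have "(idn C Y \<star> assoc C X Y A) \<cdot> (assoc C Y (X \<boxtimes> Y) A \<cdot> (assoc C Y X Y \<star> idn C A)) =
          assoc C Y X (Y \<boxtimes> A) \<cdot> assoc C (Y \<boxtimes> X) Y A"
      using pentagon X Y A by simp
    note eq = this[symmetric]
    have inv: "(assoc C Y (X \<boxtimes> Y) A \<cdot> (assoc C Y X Y \<star> idn C A)) \<cdot>
        ((inv_arr C (assoc C Y X Y) \<star> idn C A) \<cdot> inv_arr C (assoc C Y (X \<boxtimes> Y) A)) = idn C (Y \<boxtimes> ((X \<boxtimes> Y) \<boxtimes> A))"
      by (rule inverse_of_cmp[of _ _ "(Y \<boxtimes> (X \<boxtimes> Y)) \<boxtimes> A" _ _ _ "((Y \<boxtimes> X) \<boxtimes> Y) \<boxtimes> A"])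
        (simp_all add: ty interchange assoc_arr idn_cmp tarr_idn MorI)
    show ?thesis
      by (rule square_inverse[OF eq]) (use inv in \<open>simp_all add: ty assoc_arr\<close>)
  qed
  have s6: "inv_arr C (assoc C Y (X \<boxtimes> Y) A) \<cdot> (idn C Y \<star> (coev \<star> idn C A))
      = ((idn C Y \<star> coev) \<star> idn C A) \<cdot> inv_arr C (assoc C Y I A)"
  proof (rule square_inverse)
    show "assoc C Y (X \<boxtimes> Y) A \<cdot> ((idn C Y \<star> coev) \<star> idn C A) = (idn C Y \<star> (coev \<star> idn C A)) \<cdot> assoc C Y I A"
      using assoc_natural[OF idn_Mor[OF Y] coev idn_Mor[OF A]] by (simp add: I_def)
  qed (simp_all add: ty assoc_arr)
  have s7: "inv_arr C (assoc C Y I A) \<cdot> (idn C Y \<star> inv_arr C (lun C A)) = inv_arr C (run C Y) \<star> idn C A"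
  proof (rule inverse_unique)
    let ?U = "(idn C Y \<star> lun C A) \<cdot> assoc C Y I A"
    have U: "?U = run C Y \<star> idn C A" using triangle[OF Y A] by (simp add: I_def)
    show "?U \<in> Mor C ((Y \<boxtimes> I) \<boxtimes> A) (Y \<boxtimes> A)"
      "inv_arr C (assoc C Y I A) \<cdot> (idn C Y \<star> inv_arr C (lun C A)) \<in> Mor C (Y \<boxtimes> A) ((Y \<boxtimes> I) \<boxtimes> A)"
      "inv_arr C (run C Y) \<star> idn C A \<in> Mor C (Y \<boxtimes> A) ((Y \<boxtimes> I) \<boxtimes> A)"
      by (rule MorI; simp add: ty)+
    show "(inv_arr C (assoc C Y I A) \<cdot> (idn C Y \<star> inv_arr C (lun C A))) \<cdot> ?U = idn C ((Y \<boxtimes> I) \<boxtimes> A)"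
      by (rule inverse_of_cmp[of _ _ "Y \<boxtimes> (I \<boxtimes> A)" _ _ _ "Y \<boxtimes> A"])
        (use lun_arr[OF A] in \<open>simp_all add: ty interchange assoc_arr idn_cmp tarr_idn MorI flip: I_def\<close>)
    show "?U \<cdot> (inv_arr C (run C Y) \<star> idn C A) = idn C (Y \<boxtimes> A)"
      unfolding U using run_arr[OF Y] by (simp add: ty interchange idn_cmp tarr_idn flip: I_def)
  qed
  have s8: "(ev \<star> idn C (Y \<boxtimes> A)) \<cdot> assoc C (Y \<boxtimes> X) Y A = assoc C I Y A \<cdot> ((ev \<star> idn C Y) \<star> idn C A)"
    using assoc_natural[OF ev idn_Mor[OF Y] idn_Mor[OF A]] X Y A by (simp add: I_def tarr_idn)
  have zz: "(ev \<star> idn C Y) \<cdot> inv_arr C (assoc C Y X Y) \<cdot> (idn C Y \<star> coev) \<cdot> inv_arr C (run C Y)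
      = inv_arr C (lun C Y)" (is "?W = _")
  proof -
    have "inv_arr C (lun C Y) \<cdot> (lun C Y \<cdot> ?W) = ?W"
      by (rule cmp_inverse_left) (use lun_arr[OF Y] in \<open>auto intro!: MorI simp: ty simp flip: I_def\<close>)
    then show ?thesis unfolding zigzag using lun_arr[OF Y] by (simp add: idn_cmp)
  qed
  have r2: "inv_arr C (assoc C Y X B) \<cdot> (idn C Y \<star> (idn C X \<star> f)) \<cdot> t
      = (idn C (Y \<boxtimes> X) \<star> f) \<cdot> inv_arr C (assoc C Y X (Y \<boxtimes> A)) \<cdot> t"
    if "t \<in> arr C" "tgt C t = Y \<boxtimes> (X \<boxtimes> (Y \<boxtimes> A))" for t
    by (rule slide[OF s2]) (simp_all add: that ty)
  have r34: "lun C B \<cdot> (ev \<star> idn C B) \<cdot> (idn C (Y \<boxtimes> X) \<star> f) \<cdot> t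
      = f \<cdot> lun C (Y \<boxtimes> A) \<cdot> (ev \<star> idn C (Y \<boxtimes> A)) \<cdot> t"
    if "t \<in> arr C" "tgt C t = (Y \<boxtimes> X) \<boxtimes> (Y \<boxtimes> A)" for t
    using arg_cong[OF s34, of "\<lambda>x. x \<cdot> t"] that by (simp add: ty cmp_assoc_arr)
  have r5: "inv_arr C (assoc C Y X (Y \<boxtimes> A)) \<cdot> (idn C Y \<star> assoc C X Y A) \<cdot> t
      = assoc C (Y \<boxtimes> X) Y A \<cdot> (inv_arr C (assoc C Y X Y) \<star> idn C A) \<cdot> inv_arr C (assoc C Y (X \<boxtimes> Y) A) \<cdot> t"
    if "t \<in> arr C" "tgt C t = Y \<boxtimes> ((X \<boxtimes> Y) \<boxtimes> A)" for t
    using arg_cong[OF pent, of "\<lambda>x. x \<cdot> t"] that by (simp add: ty cmp_assoc_arr)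
  have r6: "inv_arr C (assoc C Y (X \<boxtimes> Y) A) \<cdot> (idn C Y \<star> (coev \<star> idn C A)) \<cdot> t
      = ((idn C Y \<star> coev) \<star> idn C A) \<cdot> inv_arr C (assoc C Y I A) \<cdot> t"
    if "t \<in> arr C" "tgt C t = Y \<boxtimes> (I \<boxtimes> A)" for t
    by (rule slide[OF s6]) (simp_all add: that ty)
  have r8: "(ev \<star> idn C (Y \<boxtimes> A)) \<cdot> assoc C (Y \<boxtimes> X) Y A \<cdot> t
      = assoc C I Y A \<cdot> ((ev \<star> idn C Y) \<star> idn C A) \<cdot> t"
    if "t \<in> arr C" "tgt C t = ((Y \<boxtimes> X) \<boxtimes> Y) \<boxtimes> A" for t
    by (rule slide[OF s8]) (simp_all add: that ty)
  have tail: "((ev \<star> idn C Y) \<star> idn C A) \<cdot> (inv_arr C (assoc C Y X Y) \<star> idn C A)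
      \<cdot> ((idn C Y \<star> coev) \<star> idn C A) \<cdot> (inv_arr C (run C Y) \<star> idn C A) = inv_arr C (lun C Y) \<star> idn C A"
    using zz by (simp add: ty interchange idn_cmp)
  show ?thesis
    unfolding adj_right_def s1 I_def[symmetric]
    by (simp add: r2 r34 r5 r6 s7 r8 tail ty)
qed

text \<open>
  The other round trip, by the mirror image of the previous argument with the zigzag identity of \<open>X\<close>.
\<close>

lemma adj_left_right:
  assumes X: "X \<in> obj C" and Y: "Y \<in> obj C"
    and ev: "ev \<in> Mor C (Y \<boxtimes> X) (unit_obj C)" and coev: "coev \<in> Mor C (unit_obj C) (X \<boxtimes> Y)"
    and zigzag: "run C X \<cdot> (idn C X \<star> ev) \<cdot> assoc C X Y X \<cdot> (coev \<star> idn C X) \<cdot> inv_arr C (lun C X) = idn C X"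
    and g: "g \<in> Mor C A (X \<boxtimes> B)" and B: "B \<in> obj C"
  shows "adj_left X Y coev A (adj_right X Y ev B g) =
    (lun C X \<star> idn C B) \<cdot> inv_arr C (assoc C (unit_obj C) X B) \<cdot> inv_arr C (lun C (X \<boxtimes> B)) \<cdot> g"
proof -
  define I where "I = unit_obj C"
  have A: "A \<in> obj C" and I: "I \<in> obj C" using g Mor_objs unit_obj I_def by blast+
  have gs: "g \<in> arr C" "src C g = A" "tgt C g = X \<boxtimes> B"
    and evs: "ev \<in> arr C" "src C ev = Y \<boxtimes> X" "tgt C ev = I"
    and coevs: "coev \<in> arr C" "src C coev = I" "tgt C coev = X \<boxtimes> Y"
    using g ev coev by (auto simp: Mor_def I_def)
  note ty = X Y A B I gs evs coevs typing[folded I_def]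
  have s1: "idn C X \<star> adj_right X Y ev B g = (idn C X \<star> lun C B) \<cdot> (idn C X \<star> (ev \<star> idn C B))
      \<cdot> (idn C X \<star> inv_arr C (assoc C Y X B)) \<cdot> (idn C X \<star> (idn C Y \<star> g))"
    unfolding adj_right_def by (simp add: ty interchange idn_cmp)
  have s2: "(idn C X \<star> (idn C Y \<star> g)) \<cdot> assoc C X Y A = assoc C X Y (X \<boxtimes> B) \<cdot> (idn C (X \<boxtimes> Y) \<star> g)"
    using assoc_natural[OF idn_Mor[OF X] idn_Mor[OF Y] g] X Y by (simp add: tarr_idn)
  have s3: "(idn C (X \<boxtimes> Y) \<star> g) \<cdot> (coev \<star> idn C A) = (coev \<star> idn C (X \<boxtimes> B)) \<cdot> (idn C I \<star> g)"
    by (simp add: ty interchange idn_cmp)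
  have s4: "(idn C I \<star> g) \<cdot> inv_arr C (lun C A) = inv_arr C (lun C (X \<boxtimes> B)) \<cdot> g"
    by (rule square_inverse[symmetric, where a = "lun C (X \<boxtimes> B)" and b = "lun C A"])
      (use lun_natural[OF g] lun_arr[OF A] lun_arr[OF tobj_obj[OF X B]] in \<open>simp_all add: ty flip: I_def\<close>)
  have pent: "(idn C X \<star> inv_arr C (assoc C Y X B)) \<cdot> assoc C X Y (X \<boxtimes> B)
      = assoc C X (Y \<boxtimes> X) B \<cdot> (assoc C X Y X \<star> idn C B) \<cdot> inv_arr C (assoc C (X \<boxtimes> Y) X B)"
  proof -
    have "(idn C X \<star> assoc C Y X B) \<cdot> (assoc C X (Y \<boxtimes> X) B \<cdot> (assoc C X Y X \<star> idn C B)) =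
          assoc C X Y (X \<boxtimes> B) \<cdot> assoc C (X \<boxtimes> Y) X B"
      using pentagon X Y B by simp
    from square_inverse[OF this, of "idn C X \<star> inv_arr C (assoc C Y X B)" "inv_arr C (assoc C (X \<boxtimes> Y) X B)"]
    show ?thesis by (simp add: ty interchange assoc_arr idn_cmp tarr_idn cmp_assoc_arr)
  qed
  have s6: "inv_arr C (assoc C (X \<boxtimes> Y) X B) \<cdot> (coev \<star> idn C (X \<boxtimes> B))
      = ((coev \<star> idn C X) \<star> idn C B) \<cdot> inv_arr C (assoc C I X B)"
  proof (rule square_inverse)
    show "assoc C (X \<boxtimes> Y) X B \<cdot> ((coev \<star> idn C X) \<star> idn C B) = (coev \<star> idn C (X \<boxtimes> B)) \<cdot> assoc C I X B"
      using assoc_natural[OF coev idn_Mor[OF X] idn_Mor[OF B]] X B by (simp add: I_def tarr_idn)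
  qed (simp_all add: ty assoc_arr)
  have s7: "(idn C X \<star> (ev \<star> idn C B)) \<cdot> assoc C X (Y \<boxtimes> X) B = assoc C X I B \<cdot> ((idn C X \<star> ev) \<star> idn C B)"
    using assoc_natural[OF idn_Mor[OF X] ev idn_Mor[OF B]] by (simp add: I_def)
  have s8: "(idn C X \<star> lun C B) \<cdot> assoc C X I B = run C X \<star> idn C B"
    using triangle[OF X B] by (simp add: I_def)
  have zz: "run C X \<cdot> (idn C X \<star> ev) \<cdot> assoc C X Y X \<cdot> (coev \<star> idn C X) = lun C X" (is "?W = _")
  proof -
    have W: "?W \<in> Mor C (I \<boxtimes> X) X" by (rule MorI; simp add: ty)
    have "?W = ?W \<cdot> (inv_arr C (lun C X) \<cdot> lun C X)"
      using W lun_arr[OF X] by (simp add: idn_right I_def)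
    also have "\<dots> = (run C X \<cdot> (idn C X \<star> ev) \<cdot> assoc C X Y X \<cdot> (coev \<star> idn C X) \<cdot> inv_arr C (lun C X)) \<cdot> lun C X"
      by (simp add: ty cmp_assoc_arr)
    finally show ?thesis unfolding zigzag using lun_arr[OF X] by (simp add: idn_cmp)
  qed
  have r2: "(idn C X \<star> (idn C Y \<star> g)) \<cdot> assoc C X Y A \<cdot> t = assoc C X Y (X \<boxtimes> B) \<cdot> (idn C (X \<boxtimes> Y) \<star> g) \<cdot> t"
    if "t \<in> arr C" "tgt C t = (X \<boxtimes> Y) \<boxtimes> A" for t
    by (rule slide[OF s2]) (simp_all add: that ty)
  have r3: "(idn C (X \<boxtimes> Y) \<star> g) \<cdot> (coev \<star> idn C A) \<cdot> t = (coev \<star> idn C (X \<boxtimes> B)) \<cdot> (idn C I \<star> g) \<cdot> t"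
    if "t \<in> arr C" "tgt C t = I \<boxtimes> A" for t
    by (rule slide[OF s3]) (simp_all add: that ty)
  have r5: "(idn C X \<star> inv_arr C (assoc C Y X B)) \<cdot> assoc C X Y (X \<boxtimes> B) \<cdot> t
      = assoc C X (Y \<boxtimes> X) B \<cdot> (assoc C X Y X \<star> idn C B) \<cdot> inv_arr C (assoc C (X \<boxtimes> Y) X B) \<cdot> t"
    if "t \<in> arr C" "tgt C t = (X \<boxtimes> Y) \<boxtimes> (X \<boxtimes> B)" for t
    using arg_cong[OF pent, of "\<lambda>x. x \<cdot> t"] that by (simp add: ty cmp_assoc_arr)
  have r6: "inv_arr C (assoc C (X \<boxtimes> Y) X B) \<cdot> (coev \<star> idn C (X \<boxtimes> B)) \<cdot> t
      = ((coev \<star> idn C X) \<star> idn C B) \<cdot> inv_arr C (assoc C I X B) \<cdot> t"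
    if "t \<in> arr C" "tgt C t = I \<boxtimes> (X \<boxtimes> B)" for t
    by (rule slide[OF s6]) (simp_all add: that ty)
  have r7: "(idn C X \<star> (ev \<star> idn C B)) \<cdot> assoc C X (Y \<boxtimes> X) B \<cdot> t
      = assoc C X I B \<cdot> ((idn C X \<star> ev) \<star> idn C B) \<cdot> t"
    if "t \<in> arr C" "tgt C t = (X \<boxtimes> (Y \<boxtimes> X)) \<boxtimes> B" for t
    by (rule slide[OF s7]) (simp_all add: that ty)
  have r8: "(idn C X \<star> lun C B) \<cdot> assoc C X I B \<cdot> t = (run C X \<star> idn C B) \<cdot> t"
    if "t \<in> arr C" "tgt C t = (X \<boxtimes> I) \<boxtimes> B" for t
    using arg_cong[OF s8, of "\<lambda>x. x \<cdot> t"] that by (simp add: ty cmp_assoc_arr)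
  have s9: "(run C X \<star> idn C B) \<cdot> ((idn C X \<star> ev) \<star> idn C B) \<cdot> (assoc C X Y X \<star> idn C B)
      \<cdot> ((coev \<star> idn C X) \<star> idn C B) = lun C X \<star> idn C B"
    using zz by (simp add: ty interchange idn_cmp)
  have head: "(run C X \<star> idn C B) \<cdot> ((idn C X \<star> ev) \<star> idn C B) \<cdot> (assoc C X Y X \<star> idn C B)
      \<cdot> ((coev \<star> idn C X) \<star> idn C B) \<cdot> t = (lun C X \<star> idn C B) \<cdot> t"
    if "t \<in> arr C" "tgt C t = (I \<boxtimes> X) \<boxtimes> B" for t
    using arg_cong[OF s9, of "\<lambda>x. x \<cdot> t"] that by (simp add: ty cmp_assoc_arr)
  show ?thesis
    unfolding adj_left_def s1 I_def[symmetric]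
    by (simp add: r2 r3 s4 r5 r6 r7 r8 head ty cmp_assoc_arr)
qed

lemma tensor_left_linear:
  assumes "X \<in> obj C"
  shows "f \<in> Mor C A B \<Longrightarrow> g \<in> Mor C A B \<Longrightarrow> idn C X \<star> (f \<boxplus> g) = (idn C X \<star> f) \<boxplus> (idn C X \<star> g)"
    "f \<in> Mor C A B \<Longrightarrow> idn C X \<star> hscale C a f = hscale C a (idn C X \<star> f)"
  using tarr_add_right tarr_scale_right idn_Mor[OF assms] by blast+

text \<open>
  Both round trips \<open>R (L f) = f \<cdot> u\<close> and \<open>L (R g) = w \<cdot> g\<close> are bijective, so the linear map \<open>L\<close> is
  bijective and carries a basis to a basis.
\<close>

lemma dual_adjunction:
  assumes dual: "is_dual C X Y" and A: "A \<in> obj C" and B: "B \<in> obj C"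
    and bs: "is_basis (Y \<boxtimes> A) B bs"
  shows "dim_Mor C (Y \<boxtimes> A) B = dim_Mor C A (X \<boxtimes> B)"
proof -
  obtain ev coev where X: "X \<in> obj C" and Y: "Y \<in> obj C"
    and ev: "ev \<in> Mor C (Y \<boxtimes> X) (unit_obj C)" and coev: "coev \<in> Mor C (unit_obj C) (X \<boxtimes> Y)"
    and z1: "run C X \<cdot> (idn C X \<star> ev) \<cdot> assoc C X Y X \<cdot> (coev \<star> idn C X) \<cdot> inv_arr C (lun C X) = idn C X"
    and z2: "lun C Y \<cdot> (ev \<star> idn C Y) \<cdot> inv_arr C (assoc C Y X Y) \<cdot> (idn C Y \<star> coev)
          \<cdot> inv_arr C (run C Y) = idn C Y"
    using dual unfolding is_dual_def by blast
  define I where "I = unit_obj C"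
  have I: "I \<in> obj C" using unit_obj I_def by simp
  have evs: "ev \<in> arr C" "src C ev = Y \<boxtimes> X" "tgt C ev = I"
    and coevs: "coev \<in> arr C" "src C coev = I" "tgt C coev = X \<boxtimes> Y"
    using ev coev by (auto simp: Mor_def I_def)
  note ty = X Y A B I evs coevs typing[folded I_def]
  define L where "L = adj_left X Y coev A"
  define R where "R = adj_right X Y ev B"
  define u where "u = lun C (Y \<boxtimes> A) \<cdot> assoc C I Y A \<cdot> (inv_arr C (lun C Y) \<star> idn C A)"
  define w where "w = (lun C X \<star> idn C B) \<cdot> inv_arr C (assoc C I X B) \<cdot> inv_arr C (lun C (X \<boxtimes> B))"
  have RL: "R (L f) = f \<cdot> u" if "f \<in> Mor C (Y \<boxtimes> A) B" for f
    using adj_right_left[OF X Y ev coev z2 that A] by (simp add: L_def R_def u_def I_def)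
  have LR: "L (R g) = w \<cdot> g" if "g \<in> Mor C A (X \<boxtimes> B)" for g
    using adj_left_right[OF X Y ev coev z1 that B] that
    by (simp add: L_def R_def w_def Mor_def ty cmp_assoc_arr flip: I_def)
  have u: "u \<in> Mor C (Y \<boxtimes> A) (Y \<boxtimes> A)" unfolding u_def by (rule MorI; simp add: ty)
  have "is_iso C u" unfolding u_def
    by (intro iso_rules) (simp_all add: ty flip: I_def)
  then obtain u' where u': "u' \<in> Mor C (Y \<boxtimes> A) (Y \<boxtimes> A)" "u \<cdot> u' = idn C (Y \<boxtimes> A)"
    using u by (elim is_isoE)
  have w: "w \<in> Mor C (X \<boxtimes> B) (X \<boxtimes> B)" unfolding w_def by (rule MorI; simp add: ty)
  have "is_iso C w" unfolding w_def
    by (intro iso_rules) (simp_all add: ty flip: I_def)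
  then obtain w' where w': "w' \<in> Mor C (X \<boxtimes> B) (X \<boxtimes> B)" "w \<cdot> w' = idn C (X \<boxtimes> B)"
    using w by (elim is_isoE)
  have linL: "linear_map (Y \<boxtimes> A) B A (X \<boxtimes> B) L"
  proof -
    define t where "t = assoc C X Y A \<cdot> (coev \<star> idn C A) \<cdot> inv_arr C (lun C A)"
    have t: "t \<in> Mor C A (X \<boxtimes> (Y \<boxtimes> A))" unfolding t_def by (rule MorI; simp add: ty)
    have L: "L f = (idn C X \<star> f) \<cdot> t" for f by (simp add: L_def adj_left_def t_def)
    have m: "idn C X \<star> f \<in> Mor C (X \<boxtimes> (Y \<boxtimes> A)) (X \<boxtimes> B)" if "f \<in> Mor C (Y \<boxtimes> A) B" for f
      using tarr_Mor idn_Mor X that by blast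
    show ?thesis unfolding linear_map_def L
      using m t by (auto simp: tensor_left_linear[OF X] cmp_add_left[OF t m m] cmp_scale_left[OF t m] intro: cmp_Mor)
  qed
  have linR: "linear_map A (X \<boxtimes> B) (Y \<boxtimes> A) B R"
  proof -
    define t where "t = lun C B \<cdot> (ev \<star> idn C B) \<cdot> inv_arr C (assoc C Y X B)"
    have t: "t \<in> Mor C (Y \<boxtimes> (X \<boxtimes> B)) B" unfolding t_def by (rule MorI; simp add: ty)
    have m: "idn C Y \<star> f \<in> Mor C (Y \<boxtimes> A) (Y \<boxtimes> (X \<boxtimes> B))" if "f \<in> Mor C A (X \<boxtimes> B)" for f
      using tarr_Mor idn_Mor Y that by blast
    have R: "R f = t \<cdot> (idn C Y \<star> f)" if "f \<in> Mor C A (X \<boxtimes> B)" for f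
      using m[OF that] by (simp add: R_def adj_right_def t_def Mor_def ty cmp_assoc_arr)
    show ?thesis unfolding linear_map_def
      using m t R by (auto simp: hadd_Mor hscale_Mor tensor_left_linear[OF Y] cmp_add_right[OF m m t]
        cmp_scale_right[OF m t] intro: cmp_Mor)
  qed
  have "is_basis A (X \<boxtimes> B) (map L bs)"
  proof (rule basis_transfer[OF bs linL A])
    show "X \<boxtimes> B \<in> obj C" by (simp add: ty)
    fix g assume g: "g \<in> Mor C A (X \<boxtimes> B)"
    have "L (R (w' \<cdot> g)) = w \<cdot> (w' \<cdot> g)" using g w' by (intro LR cmp_Mor)
    also have "\<dots> = g" using g w w' by (simp add: cmp_assoc[symmetric] idn_left)
    finally show "\<exists>f \<in> Mor C (Y \<boxtimes> A) B. L f = g"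
      using linR cmp_Mor[OF g w'(1)] by (auto simp: linear_map_def)
  next
    fix f assume f: "f \<in> Mor C (Y \<boxtimes> A) B" "L f = hzero C A (X \<boxtimes> B)"
    then have "f \<cdot> u = hzero C (Y \<boxtimes> A) B"
      using RL linear_map_zero[OF linR A] X B tobj_obj by metis
    then have "(f \<cdot> u) \<cdot> u' = hzero C (Y \<boxtimes> A) B"
      using u' B by (simp add: hzero_cmp)
    then show "f = hzero C (Y \<boxtimes> A) B"
      using f u u' by (simp add: cmp_assoc idn_right)
  qed
  then show ?thesis using basis_dim bs by (metis length_map)
qed

end

section \<open>Biproducts and additive functions on objects\<close>

context linear_category begin

lemma zero_obj_iff: "is_zero_obj C Z \<longleftrightarrow> Z \<in> obj C \<and> idn C Z = hzero C Z Z"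
proof
  assume "is_zero_obj C Z"
  then show "Z \<in> obj C \<and> idn C Z = hzero C Z Z"
    unfolding is_zero_obj_def using idn_Mor hzero_Mor by metis
next
  assume Z: "Z \<in> obj C \<and> idn C Z = hzero C Z Z"
  have "f = hzero C X Z" if "f \<in> Mor C X Z" for X f
    using that Z idn_left[OF that] hzero_cmp[OF that, of Z] by simp
  moreover have "f = hzero C Z X" if "f \<in> Mor C Z X" for X f
    using that Z idn_right[OF that] cmp_hzero[OF that, of Z] by simp
  ultimately show "is_zero_obj C Z"
    unfolding is_zero_obj_def using Z hzero_Mor by blast
qed

lemma Mor_zero_obj:
  "is_zero_obj C Z \<Longrightarrow> f \<in> Mor C X Z \<Longrightarrow> f = hzero C X Z"
  "is_zero_obj C Z \<Longrightarrow> f \<in> Mor C Z X \<Longrightarrow> f = hzero C Z X"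
  unfolding is_zero_obj_def using Mor_objs hzero_Mor by metis+

lemma simple_obj: "simple C S \<Longrightarrow> S \<in> obj C"
  and simple_idn: "simple C S \<Longrightarrow> idn C S \<noteq> hzero C S S"
  using zero_obj_iff by (auto simp: simple_def)

lemma biproductE:
  assumes "is_biproduct C Z X Y"
  obtains i j p q where "i \<in> Mor C X Z" "j \<in> Mor C Y Z" "p \<in> Mor C Z X" "q \<in> Mor C Z Y"
    "p \<cdot> i = idn C X" "q \<cdot> j = idn C Y" "p \<cdot> j = hzero C Y X" "q \<cdot> i = hzero C X Y"
    "(i \<cdot> p) \<boxplus> (j \<cdot> q) = idn C Z"
  using assms unfolding is_biproduct_def by blast

lemma biproduct_objs:
  assumes "is_biproduct C Z X Y" shows "Z \<in> obj C" "X \<in> obj C" "Y \<in> obj C"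
  using assms Mor_objs by (auto elim!: biproductE)

lemma post_linear: assumes "g \<in> Mor C Y Z" shows "linear_map A Y A Z (\<lambda>f. g \<cdot> f)"
  unfolding linear_map_def using assms cmp_Mor cmp_add_right cmp_scale_right by blast

lemma pre_linear: assumes "g \<in> Mor C X Y" shows "linear_map Y A X A (\<lambda>f. f \<cdot> g)"
  unfolding linear_map_def using assms cmp_Mor cmp_add_left cmp_scale_left by blast

lemma basis_biproduct_right:
  assumes Z: "is_biproduct C Z X Y" and as: "is_basis A X as" and bs: "is_basis A Y bs"
  shows "\<exists>cs. is_basis A Z cs \<and> length cs = length as + length bs"
proof -
  obtain i j p q where m: "i \<in> Mor C X Z" "j \<in> Mor C Y Z" "p \<in> Mor C Z X" "q \<in> Mor C Z Y"
    and e: "p \<cdot> i = idn C X" "q \<cdot> j = idn C Y" "p \<cdot> j = hzero C Y X" "q \<cdot> i = hzero C X Y"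
    and s: "(i \<cdot> p) \<boxplus> (j \<cdot> q) = idn C Z" using Z by (rule biproductE)
  have o: "A \<in> obj C" "X \<in> obj C" "Y \<in> obj C" "Z \<in> obj C"
    using as biproduct_objs[OF Z] by (auto simp: is_basis_def)
  have "is_basis A Z (map (\<lambda>f. i \<cdot> f) as @ map (\<lambda>f. j \<cdot> f) bs)"
  proof (rule basis_append[OF as bs o(1,4) post_linear[OF m(1)] post_linear[OF m(2)]
      post_linear[OF m(3)] post_linear[OF m(4)]])
    fix f assume f: "f \<in> Mor C A X"
    show "p \<cdot> (i \<cdot> f) = f" using f m e(1) by (simp add: cmp_assoc[symmetric] idn_left)
    show "q \<cdot> (i \<cdot> f) = hzero C A Y" using f m e(4) o by (simp add: cmp_assoc[symmetric] hzero_cmp)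
  next
    fix f assume f: "f \<in> Mor C A Y"
    show "q \<cdot> (j \<cdot> f) = f" using f m e(2) by (simp add: cmp_assoc[symmetric] idn_left)
    show "p \<cdot> (j \<cdot> f) = hzero C A X" using f m e(3) o by (simp add: cmp_assoc[symmetric] hzero_cmp)
  next
    fix f assume f: "f \<in> Mor C A Z"
    have "(i \<cdot> (p \<cdot> f)) \<boxplus> (j \<cdot> (q \<cdot> f)) = ((i \<cdot> p) \<boxplus> (j \<cdot> q)) \<cdot> f"
      using cmp_add_left[OF f cmp_Mor[OF m(3,1)] cmp_Mor[OF m(4,2)]]
        cmp_assoc[OF f m(3,1)] cmp_assoc[OF f m(4,2)] by simp
    then show "(i \<cdot> (p \<cdot> f)) \<boxplus> (j \<cdot> (q \<cdot> f)) = f" using s f by (simp add: idn_left)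
  qed
  then show ?thesis by (intro exI[of _ "map (\<lambda>f. i \<cdot> f) as @ map (\<lambda>f. j \<cdot> f) bs"]) simp
qed

lemma basis_biproduct_left:
  assumes Z: "is_biproduct C Z X Y" and as: "is_basis X A as" and bs: "is_basis Y A bs"
  shows "\<exists>cs. is_basis Z A cs \<and> length cs = length as + length bs"
proof -
  obtain i j p q where m: "i \<in> Mor C X Z" "j \<in> Mor C Y Z" "p \<in> Mor C Z X" "q \<in> Mor C Z Y"
    and e: "p \<cdot> i = idn C X" "q \<cdot> j = idn C Y" "p \<cdot> j = hzero C Y X" "q \<cdot> i = hzero C X Y"
    and s: "(i \<cdot> p) \<boxplus> (j \<cdot> q) = idn C Z" using Z by (rule biproductE)
  have o: "A \<in> obj C" "X \<in> obj C" "Y \<in> obj C" "Z \<in> obj C"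
    using as biproduct_objs[OF Z] by (auto simp: is_basis_def)
  have "is_basis Z A (map (\<lambda>f. f \<cdot> p) as @ map (\<lambda>f. f \<cdot> q) bs)"
  proof (rule basis_append[OF as bs o(4,1) pre_linear[OF m(3)] pre_linear[OF m(4)]
      pre_linear[OF m(1)] pre_linear[OF m(2)]])
    fix f assume f: "f \<in> Mor C X A"
    show "(f \<cdot> p) \<cdot> i = f" using f m e(1) by (simp add: cmp_assoc idn_right)
    show "(f \<cdot> p) \<cdot> j = hzero C Y A" using f m e(3) o by (simp add: cmp_assoc cmp_hzero)
  next
    fix f assume f: "f \<in> Mor C Y A"
    show "(f \<cdot> q) \<cdot> j = f" using f m e(2) by (simp add: cmp_assoc idn_right)
    show "(f \<cdot> q) \<cdot> i = hzero C X A" using f m e(4) o by (simp add: cmp_assoc cmp_hzero)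
  next
    fix f assume f: "f \<in> Mor C Z A"
    have "((f \<cdot> i) \<cdot> p) \<boxplus> ((f \<cdot> j) \<cdot> q) = f \<cdot> ((i \<cdot> p) \<boxplus> (j \<cdot> q))"
      using cmp_add_right[OF cmp_Mor[OF m(3,1)] cmp_Mor[OF m(4,2)] f]
        cmp_assoc[OF m(3,1) f] cmp_assoc[OF m(4,2) f] by simp
    then show "((f \<cdot> i) \<cdot> p) \<boxplus> ((f \<cdot> j) \<cdot> q) = f" using s f by (simp add: idn_right)
  qed
  then show ?thesis by (intro exI[of _ "map (\<lambda>f. f \<cdot> p) as @ map (\<lambda>f. f \<cdot> q) bs"]) simp
qed

text \<open>
  Additive functions are automatically invariant under isomorphisms and vanish on zero objects, because
  \<open>Z\<close> is a biproduct of \<open>Z\<close> and \<open>Z\<close> if it is zero, and any object isomorphic to \<open>X\<close> is a biproduct of \<open>X\<close> and a zero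
  object.
\<close>

definition additive :: "('o \<Rightarrow> nat) \<Rightarrow> bool" where
  "additive F \<longleftrightarrow> (\<forall>Z X Y. is_biproduct C Z X Y \<longrightarrow> F Z = F X + F Y)"

lemma additiveD: "additive F \<Longrightarrow> is_biproduct C Z X Y \<Longrightarrow> F Z = F X + F Y"
  unfolding additive_def by blast

lemma additive_zero: assumes F: "additive F" and Z: "is_zero_obj C Z" shows "F Z = 0"
proof -
  have Zo: "Z \<in> obj C" "idn C Z = hzero C Z Z" using Z zero_obj_iff by auto
  note z = hzero_Mor[OF Zo(1) Zo(1)]
  have "is_biproduct C Z Z Z"
    unfolding is_biproduct_def
    by (intro bexI[OF _ z] bexI[OF _ z]) (simp add: hzero_cmp[OF z Zo(1)] hadd_zero[OF z] Zo(2))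
  from additiveD[OF F this] show ?thesis by simp
qed

end

section \<open>Schur's lemma and dimensions of Hom spaces\<close>

context abelian_category begin

lemma additive_iso: assumes F: "additive F" and XY: "isomorphic C X Y" shows "F X = F Y"
proof -
  obtain f where f: "f \<in> Mor C X Y" "is_iso C f" using XY by (auto simp: isomorphic_def)
  obtain g where g: "g \<in> Mor C Y X" "g \<cdot> f = idn C X" "f \<cdot> g = idn C Y" using f by (elim is_isoE)
  obtain Z where Z: "is_zero_obj C Z" using ex_zero_obj by blast
  then have Zo: "Z \<in> obj C" "idn C Z = hzero C Z Z" using zero_obj_iff by auto
  have o: "X \<in> obj C" "Y \<in> obj C" using f Mor_objs by auto
  have zm: "hzero C Z Y \<in> Mor C Z Y" "hzero C Y Z \<in> Mor C Y Z" using Zo o hzero_Mor by auto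
  have "is_biproduct C Y X Z"
    unfolding is_biproduct_def
    by (intro bexI[OF _ f(1)] bexI[OF _ zm(1)] bexI[OF _ g(1)] bexI[OF _ zm(2)])
      (use f g Zo o zm in \<open>simp add: cmp_hzero hzero_cmp hadd_zero[OF idn_Mor]\<close>)
  from additiveD[OF F this] show ?thesis using additive_zero[OF F Z] by simp
qed

lemma additive_direct_sum: "additive F \<Longrightarrow> direct_sum C Z Xs \<Longrightarrow> F Z = (\<Sum>X\<leftarrow>Xs. F X)"
proof (induction Xs arbitrary: Z)
  case Nil
  then show ?case using additive_zero by simp
next
  case (Cons X Xs)
  then obtain Y where "is_biproduct C Z X Y" "direct_sum C Y Xs" by auto
  then show ?case using Cons additiveD[of F Z X Y] by simp
qed

lemma mono_if_kernel_zero: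
  assumes f: "f \<in> Mor C X Y" and k: "is_kernel C f k" and Z: "is_zero_obj C (src C k)"
  shows "is_mono C f"
  unfolding is_mono_def
proof (intro conjI allI ballI impI)
  show "f \<in> arr C" using f by (rule Mor_arr)
  fix W g h assume gh: "g \<in> Mor C W (src C f)" "h \<in> Mor C W (src C f)" "f \<cdot> g = f \<cdot> h"
  have fx: "src C f = X" "tgt C f = Y" using f by (auto simp: Mor_def)
  have m: "hscale C (-1) h \<in> Mor C W X" using gh fx hscale_Mor by auto
  define d where "d = g \<boxplus> hscale C (-1) h"
  have d: "d \<in> Mor C W X" using gh fx m hadd_Mor d_def by auto
  have "f \<cdot> d = (f \<cdot> g) \<boxplus> hscale C (-1) (f \<cdot> h)"
    using gh fx m f unfolding d_def by (simp add: cmp_add_right[of _ W X] cmp_scale_right[of _ W X])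
  also have "\<dots> = hzero C W Y"
    using gh fx f cmp_Mor by (simp add: add_neg)
  finally obtain u where u: "u \<in> Mor C W (src C k)" "k \<cdot> u = d"
    using k d fx unfolding is_kernel_def by blast
  have km: "k \<in> Mor C (src C k) X" using k fx by (simp add: is_kernel_def)
  have "u = hzero C W (src C k)" using Mor_zero_obj Z u by blast
  then have "d = hzero C W X" using u km cmp_hzero Mor_objs(1)[OF d] by metis
  then show "g = h" using eq_if_difference_zero[of g W X h] gh fx d_def by simp
qed

lemma kernel_mono: assumes k: "is_kernel C f k" and f: "f \<in> Mor C X Y" shows "is_mono C k"
  unfolding is_mono_def
proof (intro conjI allI ballI impI)
  have fx: "src C f = X" "tgt C f = Y" using f by (auto simp: Mor_def)
  have km: "k \<in> Mor C (src C k) X" and fk: "f \<cdot> k = hzero C (src C k) Y"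
    using k fx by (auto simp: is_kernel_def)
  show "k \<in> arr C" using km by (rule Mor_arr)
  fix W g h assume gh: "g \<in> Mor C W (src C k)" "h \<in> Mor C W (src C k)" "k \<cdot> g = k \<cdot> h"
  have "f \<cdot> (k \<cdot> g) = hzero C W Y"
    using gh km f fk Mor_objs(2)[OF f] by (simp add: cmp_assoc[symmetric] hzero_cmp)
  then have "\<exists>!u. u \<in> Mor C W (src C k) \<and> k \<cdot> u = k \<cdot> g"
    using k cmp_Mor[OF gh(1) km] fx by (simp add: is_kernel_def)
  then show "g = h" using gh by metis
qed

text \<open>
  The kernel of a nonzero morphism out of a simple object is a proper subobject, hence zero.
\<close>

lemma simple_nonzero_mono:
  assumes S: "simple C S" and f: "f \<in> Mor C S Y" "f \<noteq> hzero C S Y"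
  shows "is_mono C f"
proof -
  obtain k where k: "is_kernel C f k" using ex_kernel f Mor_arr by blast
  have fx: "src C f = S" "tgt C f = Y" using f by (auto simp: Mor_def)
  have km: "k \<in> Mor C (src C k) S" and fk: "f \<cdot> k = hzero C (src C k) Y"
    using k fx by (auto simp: is_kernel_def)
  have "is_zero_obj C (src C k) \<or> is_iso C k"
    using S kernel_mono[OF k f(1)] km by (auto simp: simple_def Mor_def)
  moreover have False if iso: "is_iso C k"
  proof -
    obtain k' where k': "k' \<in> Mor C S (src C k)" "k \<cdot> k' = idn C S" using iso km by (elim is_isoE)
    have "f = (f \<cdot> k) \<cdot> k'" using f km k' by (simp add: cmp_assoc idn_right)
    also have "\<dots> = hzero C S Y" unfolding fk using k' hzero_cmp Mor_objs(2)[OF f(1)] by blast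
    finally show False using f by simp
  qed
  ultimately show ?thesis using mono_if_kernel_zero[OF f(1) k] by blast
qed

lemma schur_iso:
  assumes "simple C S" "simple C T" "f \<in> Mor C S T" "f \<noteq> hzero C S T"
  shows "is_iso C f"
  using simple_nonzero_mono[OF assms(1,3,4)] assms unfolding simple_def Mor_def by auto

end

context linear_category begin

text \<open>
  Evaluation of a polynomial at an endomorphism, by the Horner scheme.
\<close>

definition poly_end :: "'o \<Rightarrow> 'm \<Rightarrow> 'k poly \<Rightarrow> 'm" where
  "poly_end X f P = fold_coeffs (\<lambda>a g. hscale C a (idn C X) \<boxplus> (f \<cdot> g)) P (hzero C X X)"

context
  fixes X f assumes f: "f \<in> Mor C X X"
begin

lemma endo_obj: "X \<in> obj C" using f Mor_objs by blast

lemma poly_end_0: "poly_end X f 0 = hzero C X X"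
  by (simp add: poly_end_def)

lemma poly_end_pCons: "poly_end X f (pCons a P) = hscale C a (idn C X) \<boxplus> (f \<cdot> poly_end X f P)"
proof (cases "a = 0 \<and> P = 0")
  case True
  then show ?thesis
    using cmp_hzero[OF f endo_obj] scale_zero[OF idn_Mor[OF endo_obj]] hzero_add[OF hzero_Mor[OF endo_obj endo_obj]]
    by (simp add: poly_end_0)
next
  case False
  then have "coeffs (pCons a P) = a # coeffs P" by (auto simp: cCons_def)
  then show ?thesis by (simp add: poly_end_def fold_coeffs_def)
qed

lemma poly_end_Mor: "poly_end X f P \<in> Mor C X X"
  by (induction P) (auto simp: poly_end_0 poly_end_pCons hzero_Mor endo_obj
      intro!: hadd_Mor hscale_Mor idn_Mor cmp_Mor[OF _ f])

lemma poly_end_smult: "poly_end X f (smult a P) = hscale C a (poly_end X f P)"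
proof (induction P)
  case 0
  then show ?case using scale_hzero[OF endo_obj endo_obj] by (simp add: poly_end_0)
next
  case (pCons b P)
  then show ?case
    using poly_end_Mor[of P] f cmp_Mor[OF poly_end_Mor f, of P] idn_Mor[OF endo_obj]
    by (simp add: poly_end_pCons hscale_add_right[of _ X X] hscale_mult[of _ X X] hscale_Mor
        cmp_scale_right[of _ X X])
qed

lemma poly_end_add: "poly_end X f (P + Q) = poly_end X f P \<boxplus> poly_end X f Q"
proof (induction P Q rule: poly_induct2)
  case 0
  then show ?case using hadd_zero[OF hzero_Mor[OF endo_obj endo_obj]] by (simp add: poly_end_0)
next
  case (pCons a P b Q)
  note m = cmp_Mor[OF poly_end_Mor f] hscale_Mor[OF idn_Mor[OF endo_obj]]
  have "poly_end X f (pCons a P + pCons b Q)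
      = (hscale C a (idn C X) \<boxplus> hscale C b (idn C X)) \<boxplus> ((f \<cdot> poly_end X f P) \<boxplus> (f \<cdot> poly_end X f Q))"
    using pCons f poly_end_Mor idn_Mor[OF endo_obj]
    by (simp add: poly_end_pCons hscale_add_left[of _ X X] cmp_add_right[of _ X X])
  then show ?case using hadd_swap[OF m(2) m(2) m(1) m(1)] by (simp add: poly_end_pCons)
qed

lemma poly_end_linear_factor:
  "poly_end X f ([:-a, 1:] * Q) = (f \<boxplus> hscale C (-a) (idn C X)) \<cdot> poly_end X f Q"
proof -
  note q = poly_end_Mor[of Q]
  have i: "hscale C (-a) (idn C X) \<in> Mor C X X" using endo_obj idn_Mor hscale_Mor by blast
  have "[:-a, 1:] * Q = smult (-a) Q + pCons 0 Q" by simp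
  then have "poly_end X f ([:-a, 1:] * Q)
      = hscale C (-a) (poly_end X f Q) \<boxplus> (f \<cdot> poly_end X f Q)"
    using scale_zero[OF idn_Mor[OF endo_obj]] hzero_add[OF cmp_Mor[OF q f]]
    by (simp only: poly_end_add poly_end_smult poly_end_pCons)
  also have "\<dots> = (f \<cdot> poly_end X f Q) \<boxplus> hscale C (-a) (poly_end X f Q)"
    by (rule hadd_comm) (use q f cmp_Mor hscale_Mor in blast)+
  also have "hscale C (-a) (poly_end X f Q) = hscale C (-a) (idn C X) \<cdot> poly_end X f Q"
    using q cmp_scale_left[OF q idn_Mor[OF endo_obj]] by (simp add: idn_left)
  also have "(f \<cdot> poly_end X f Q) \<boxplus> \<dots> = (f \<boxplus> hscale C (-a) (idn C X)) \<cdot> poly_end X f Q"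
    using cmp_add_left[OF q f i] by simp
  finally show ?thesis .
qed

primrec powers :: "nat \<Rightarrow> 'm list" where
  "powers 0 = []"
| "powers (Suc n) = idn C X # map (\<lambda>g. f \<cdot> g) (powers n)"

primrec poly_of :: "nat \<Rightarrow> (nat \<Rightarrow> 'k) \<Rightarrow> 'k poly" where
  "poly_of 0 c = 0"
| "poly_of (Suc n) c = pCons (c 0) (poly_of n (\<lambda>i. c (Suc i)))"

lemma powers_Mor: "set (powers n) \<subseteq> Mor C X X"
  by (induction n) (auto intro!: cmp_Mor[OF _ f] idn_Mor endo_obj)

lemma length_powers: "length (powers n) = n"
  by (induction n) auto

lemma coeff_poly_of: "coeff (poly_of n c) i = (if i < n then c i else 0)"
  by (induction n arbitrary: c i) (auto simp: coeff_pCons split: nat.split)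

lemma lincomb_powers: "lincomb X X (powers n) c = poly_end X f (poly_of n c)"
proof (induction n arbitrary: c)
  case (Suc n)
  then show ?case
    using linear_map_lincomb[OF post_linear[OF f] endo_obj endo_obj powers_Mor, symmetric]
    by (simp add: poly_end_pCons)
qed (simp add: poly_end_0)

text \<open>
  There are more powers of \<open>f\<close> than elements in a finite spanning set, so the powers are linearly dependent.
\<close>

lemma ex_annihilating_poly:
  assumes B: "finite_spanning C X X B"
  shows "\<exists>P. P \<noteq> 0 \<and> poly_end X f P = hzero C X X"
proof -
  have fB: "finite B" using B by (simp add: finite_spanning_def)
  obtain bs where bs: "set bs = B" using finite_list[OF fB] by blast
  define n where "n = Suc (length bs)"
  obtain c where c: "\<exists>i<n. c i \<noteq> 0" "lincomb X X (powers n) c = hzero C X X"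
    using dependent_if_longer[OF endo_obj endo_obj, of bs "powers n"] bs B powers_Mor[of n]
    by (auto simp: finite_spanning_def length_powers n_def)
  then have "poly_of n c \<noteq> 0" by (metis coeff_0 coeff_poly_of)
  then show ?thesis using c(2) lincomb_powers by metis
qed

end
end

context fusion_category begin

text \<open>
  Take a nonzero polynomial \<open>P\<close> of minimal degree with \<open>P(f) = 0\<close> and split off a root \<open>a\<close>, so that
  \<open>(f - a) Q(f) = 0\<close>. By minimality \<open>Q(f) \<noteq> 0\<close>, so \<open>f - a\<close> is not invertible, hence zero.
\<close>

lemma schur_scalar:
  assumes S: "simple C S" and f: "f \<in> Mor C S S"
  shows "\<exists>a. f = hscale C a (idn C S)"
proof -
  have So: "S \<in> obj C" using S by (rule simple_obj)
  obtain B where "finite_spanning C S S B" using finite_dim_Mor So by blast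
  then have ex: "\<exists>P. P \<noteq> 0 \<and> poly_end S f P = hzero C S S" by (rule ex_annihilating_poly[OF f])
  obtain P where P: "P \<noteq> 0" "poly_end S f P = hzero C S S"
    and minimal: "\<And>Q. Q \<noteq> 0 \<Longrightarrow> poly_end S f Q = hzero C S S \<Longrightarrow> degree P \<le> degree Q"
    using ex ex_has_least_nat[of "\<lambda>P. P \<noteq> 0 \<and> poly_end S f P = hzero C S S" _ degree] by metis
  have "degree P > 0"
  proof (rule ccontr)
    assume "\<not> degree P > 0"
    then obtain a where a: "P = [:a:]" by (meson degree_eq_zeroE gr0I)
    then have "hscale C a (idn C S) = hzero C S S"
      using P f So cmp_hzero[OF f So] hadd_zero[OF hscale_Mor[OF idn_Mor[OF So]]]
      by (simp add: poly_end_pCons[OF f] poly_end_0[OF f])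
    then have "hscale C (inverse a * a) (idn C S) = hzero C S S"
      using hscale_mult[OF idn_Mor[OF So]] scale_hzero[OF So So] by metis
    then show False using a P simple_idn[OF S] hscale_one[OF idn_Mor[OF So]] by simp
  qed
  then obtain a where "poly P a = 0" using alg_closed_imp_poly_has_root by blast
  then have "[:-a, 1:] dvd P" by (simp only: poly_eq_0_iff_dvd)
  then obtain Q where Q: "P = [:-a, 1:] * Q" by (rule dvdE)
  define g where "g = f \<boxplus> hscale C (-a) (idn C S)"
  have g: "g \<in> Mor C S S" using f So g_def by (auto intro: hadd_Mor hscale_Mor idn_Mor)
  have Q0: "Q \<noteq> 0" using P Q by auto
  have "degree P = degree [:-a, 1:] + degree Q"
    unfolding Q by (rule degree_mult_eq) (use Q0 in auto)
  then have "degree Q < degree P" by simp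
  then have nz: "poly_end S f Q \<noteq> hzero C S S" using minimal[OF Q0] by auto
  have gq: "g \<cdot> poly_end S f Q = hzero C S S"
    using P(2) Q poly_end_linear_factor[OF f, of a Q] by (simp add: g_def)
  have "g = hzero C S S"
  proof (rule ccontr)
    assume "g \<noteq> hzero C S S"
    then have "is_iso C g" using schur_iso[OF S S g] by blast
    then obtain g' where g': "g' \<in> Mor C S S" "g' \<cdot> g = idn C S" using g by (elim is_isoE)
    have "poly_end S f Q = g' \<cdot> (g \<cdot> poly_end S f Q)"
      using g g' poly_end_Mor[OF f, of Q] by (simp add: cmp_assoc[symmetric] idn_left)
    then show False using gq nz cmp_hzero[OF g'(1) So] by simp
  qed
  then have "f \<boxplus> hscale C (-1) (hscale C a (idn C S)) = hzero C S S"
    using hscale_mult[OF idn_Mor[OF So], of "-1" a] by (simp add: g_def)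
  then have "f = hscale C a (idn C S)"
    using eq_if_difference_zero[OF f hscale_Mor[OF idn_Mor[OF So]]] by blast
  then show ?thesis by blast
qed

lemma basis_isomorphic_simples:
  assumes S: "simple C S" and T: "simple C T" and ST: "isomorphic C S T"
  shows "\<exists>f. is_basis S T [f]"
proof -
  have o: "S \<in> obj C" "T \<in> obj C" using S T simple_obj by auto
  obtain f where f: "f \<in> Mor C S T" "is_iso C f" using ST by (auto simp: isomorphic_def)
  obtain g where g: "g \<in> Mor C T S" "g \<cdot> f = idn C S" "f \<cdot> g = idn C T" using f by (elim is_isoE)
  have one: "lincomb S T [f] c = hscale C (c 0) f" for c
    using f by (simp add: hadd_zero[OF hscale_Mor])
  have "\<exists>c. h = lincomb S T [f] c" if h: "h \<in> Mor C S T" for h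
  proof -
    obtain a where a: "g \<cdot> h = hscale C a (idn C S)" using schur_scalar[OF S] cmp_Mor[OF h g(1)] by blast
    have "h = f \<cdot> (g \<cdot> h)" using f g h by (simp add: cmp_assoc[symmetric] idn_left)
    also have "\<dots> = hscale C a f"
      unfolding a using f by (simp add: cmp_scale_right[OF idn_Mor[OF o(1)] f(1)] idn_right)
    finally show ?thesis unfolding one by (intro exI[of _ "\<lambda>_. a"])
  qed
  moreover have "c 0 = 0" if "hscale C (c 0) f = hzero C S T" for c :: "nat \<Rightarrow> 'k"
  proof (rule ccontr)
    assume c: "c 0 \<noteq> 0"
    have "f = hscale C (inverse (c 0)) (hscale C (c 0) f)"
      using c f hscale_mult[OF f(1), of "inverse (c 0)" "c 0"] hscale_one by simp
    then have "f = hzero C S T" using that scale_hzero o by simp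
    then have "idn C S = hzero C S S" using g cmp_hzero[OF g(1) o(1)] by simp
    then show False using simple_idn[OF S] by simp
  qed
  ultimately have "is_basis S T [f]" using o f(1) one by (simp add: is_basis_def)
  then show ?thesis by blast
qed

lemma basis_no_morphisms:
  assumes "X \<in> obj C" "Y \<in> obj C" "\<And>f. f \<in> Mor C X Y \<Longrightarrow> f = hzero C X Y"
  shows "is_basis X Y []"
  using assms by (auto simp: is_basis_def)

lemma basis_nonisomorphic_simples:
  assumes "simple C S" "simple C T" "\<not> isomorphic C S T"
  shows "is_basis S T []"
  using assms schur_iso simple_obj by (intro basis_no_morphisms) (auto simp: isomorphic_def)

text \<open>
  Both arguments are decomposed into simple objects, and Schur's lemma gives a basis for each pair of these.
\<close>

lemma ex_basis: assumes X: "X \<in> obj C" and Y: "Y \<in> obj C" shows "\<exists>bs. is_basis X Y bs"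
proof -
  have from_simple: "\<exists>bs. is_basis S Z bs"
    if S: "simple C S" and "\<forall>T\<in>set Ts. simple C T" "direct_sum C Z Ts" for S Z Ts
    using that(2,3)
  proof (induction Ts arbitrary: Z)
    case Nil
    then have Z: "is_zero_obj C Z" by simp
    then have "is_basis S Z []"
      using simple_obj[OF S] Mor_zero_obj(1)[OF Z] by (intro basis_no_morphisms) (auto simp: is_zero_obj_def)
    then show ?case by blast
  next
    case (Cons T Ts)
    then obtain W where W: "is_biproduct C Z T W" "direct_sum C W Ts" by auto
    moreover obtain as where "is_basis S T as"
      using Cons.prems basis_isomorphic_simples[OF S, of T] basis_nonisomorphic_simples[OF S, of T] by auto
    moreover obtain bs where "is_basis S W bs" using Cons.IH[OF _ W(2)] Cons.prems(1) by auto
    ultimately show ?case using basis_biproduct_right by blast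
  qed
  obtain Ts where Ts: "\<forall>T\<in>set Ts. simple C T" "direct_sum C Y Ts" using semisimple[OF Y] by blast
  have "\<exists>bs. is_basis Z Y bs" if "\<forall>S\<in>set Ss. simple C S" "direct_sum C Z Ss" for Z Ss
    using that
  proof (induction Ss arbitrary: Z)
    case Nil
    then have Z: "is_zero_obj C Z" by simp
    then have "is_basis Z Y []"
      using Y Mor_zero_obj(2)[OF Z] by (intro basis_no_morphisms) (auto simp: is_zero_obj_def)
    then show ?case by blast
  next
    case (Cons S Ss)
    then obtain W where W: "is_biproduct C Z S W" "direct_sum C W Ss" by auto
    moreover obtain as where "is_basis S Y as" using from_simple[OF _ Ts, of S] Cons.prems(1) by auto
    moreover obtain bs where "is_basis W Y bs" using Cons.IH[OF _ W(2)] Cons.prems(1) by auto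
    ultimately show ?case using basis_biproduct_left by blast
  qed
  then show ?thesis using semisimple[OF X] by blast
qed

lemma dim_additive_right: assumes A: "A \<in> obj C" shows "additive (\<lambda>X. dim_Mor C A X)"
  unfolding additive_def
proof (intro allI impI)
  fix Z X Y assume Z: "is_biproduct C Z X Y"
  obtain as bs where "is_basis A X as" "is_basis A Y bs" using ex_basis A biproduct_objs[OF Z] by meson
  moreover then obtain cs where "is_basis A Z cs" "length cs = length as + length bs"
    using basis_biproduct_right[OF Z] by blast
  ultimately show "dim_Mor C A Z = dim_Mor C A X + dim_Mor C A Y" by (simp add: basis_dim)
qed

lemma dim_additive_left: assumes A: "A \<in> obj C" shows "additive (\<lambda>X. dim_Mor C X A)"
  unfolding additive_def
proof (intro allI impI)
  fix Z X Y assume Z: "is_biproduct C Z X Y"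
  obtain as bs where "is_basis X A as" "is_basis Y A bs" using ex_basis A biproduct_objs[OF Z] by meson
  moreover then obtain cs where "is_basis Z A cs" "length cs = length as + length bs"
    using basis_biproduct_left[OF Z] by blast
  ultimately show "dim_Mor C Z A = dim_Mor C X A + dim_Mor C Y A" by (simp add: basis_dim)
qed

lemma dim_simples:
  assumes "simple C S" "simple C T"
  shows "dim_Mor C S T = (if isomorphic C S T then 1 else 0)"
  using basis_isomorphic_simples[OF assms] basis_nonisomorphic_simples[OF assms] basis_dim by fastforce

lemma dim_pos_iff:
  assumes "X \<in> obj C" "Y \<in> obj C"
  shows "dim_Mor C X Y > 0 \<longleftrightarrow> (\<exists>f \<in> Mor C X Y. f \<noteq> hzero C X Y)"
  using ex_basis[OF assms] dim_pos_if_nonzero nonzero_if_dim_pos[OF assms] by metis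

lemma biproduct_tensor_right:
  assumes Z: "is_biproduct C Z X Y" and W: "W \<in> obj C"
  shows "is_biproduct C (Z \<boxtimes> W) (X \<boxtimes> W) (Y \<boxtimes> W)"
proof -
  obtain i j p q where m: "i \<in> Mor C X Z" "j \<in> Mor C Y Z" "p \<in> Mor C Z X" "q \<in> Mor C Z Y"
    and e: "p \<cdot> i = idn C X" "q \<cdot> j = idn C Y" "p \<cdot> j = hzero C Y X" "q \<cdot> i = hzero C X Y"
    and s: "(i \<cdot> p) \<boxplus> (j \<cdot> q) = idn C Z" using Z by (rule biproductE)
  note o = biproduct_objs[OF Z]
  have hz: "hzero C U V \<star> idn C W = hzero C (U \<boxtimes> W) (V \<boxtimes> W)" if "U \<in> obj C" "V \<in> obj C" for U V
  proof -
    have "hzero C U V \<star> idn C W = hscale C 0 (hzero C U V) \<star> idn C W"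
      using that by (simp add: scale_hzero)
    also have "\<dots> = hscale C 0 (hzero C U V \<star> idn C W)"
      using tarr_scale_left[OF hzero_Mor[OF that] idn_Mor[OF W]] by simp
    also have "\<dots> = hzero C (U \<boxtimes> W) (V \<boxtimes> W)"
      by (rule scale_zero[OF tarr_Mor[OF hzero_Mor[OF that] idn_Mor[OF W]]])
    finally show ?thesis .
  qed
  have cmp: "(g \<star> idn C W) \<cdot> (f \<star> idn C W) = (g \<cdot> f) \<star> idn C W"
    if "f \<in> Mor C U V" "g \<in> Mor C V V'" for f g U V V'
    using tarr_cmp[OF that idn_Mor[OF W] idn_Mor[OF W]] idn_left[OF idn_Mor[OF W]] by simp
  note mw = m[THEN tarr_Mor, OF idn_Mor[OF W]]
  have "((i \<star> idn C W) \<cdot> (p \<star> idn C W)) \<boxplus> ((j \<star> idn C W) \<cdot> (q \<star> idn C W)) = idn C (Z \<boxtimes> W)"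
    using cmp[OF m(3,1)] cmp[OF m(4,2)] o W s
      tarr_add_left[OF cmp_Mor[OF m(3,1)] cmp_Mor[OF m(4,2)] idn_Mor[OF W]] by (simp add: tarr_idn)
  then show ?thesis
    unfolding is_biproduct_def
    by (intro bexI[OF _ mw(1)] bexI[OF _ mw(2)] bexI[OF _ mw(3)] bexI[OF _ mw(4)])
      (use cmp[OF m(1,3)] cmp[OF m(2,4)] cmp[OF m(2,3)] cmp[OF m(1,4)] o W e in \<open>simp add: tarr_idn hz\<close>)
qed

lemma biproduct_tensor_left:
  assumes Z: "is_biproduct C Z X Y" and W: "W \<in> obj C"
  shows "is_biproduct C (W \<boxtimes> Z) (W \<boxtimes> X) (W \<boxtimes> Y)"
proof -
  obtain i j p q where m: "i \<in> Mor C X Z" "j \<in> Mor C Y Z" "p \<in> Mor C Z X" "q \<in> Mor C Z Y"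
    and e: "p \<cdot> i = idn C X" "q \<cdot> j = idn C Y" "p \<cdot> j = hzero C Y X" "q \<cdot> i = hzero C X Y"
    and s: "(i \<cdot> p) \<boxplus> (j \<cdot> q) = idn C Z" using Z by (rule biproductE)
  note o = biproduct_objs[OF Z]
  have hz: "idn C W \<star> hzero C U V = hzero C (W \<boxtimes> U) (W \<boxtimes> V)" if "U \<in> obj C" "V \<in> obj C" for U V
  proof -
    have "idn C W \<star> hzero C U V = idn C W \<star> hscale C 0 (hzero C U V)"
      using that by (simp add: scale_hzero)
    also have "\<dots> = hscale C 0 (idn C W \<star> hzero C U V)"
      using tarr_scale_right[OF idn_Mor[OF W] hzero_Mor[OF that]] by simp
    also have "\<dots> = hzero C (W \<boxtimes> U) (W \<boxtimes> V)"
      by (rule scale_zero[OF tarr_Mor[OF idn_Mor[OF W] hzero_Mor[OF that]]])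
    finally show ?thesis .
  qed
  have cmp: "(idn C W \<star> g) \<cdot> (idn C W \<star> f) = idn C W \<star> (g \<cdot> f)"
    if "f \<in> Mor C U V" "g \<in> Mor C V V'" for f g U V V'
    using tarr_cmp[OF idn_Mor[OF W] idn_Mor[OF W] that] idn_left[OF idn_Mor[OF W]] by simp
  note mw = m[THEN tarr_Mor[OF idn_Mor[OF W]]]
  have "((idn C W \<star> i) \<cdot> (idn C W \<star> p)) \<boxplus> ((idn C W \<star> j) \<cdot> (idn C W \<star> q)) = idn C (W \<boxtimes> Z)"
    using cmp[OF m(3,1)] cmp[OF m(4,2)] o W s
      tarr_add_right[OF idn_Mor[OF W] cmp_Mor[OF m(3,1)] cmp_Mor[OF m(4,2)]] by (simp add: tarr_idn)
  then show ?thesis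
    unfolding is_biproduct_def
    by (intro bexI[OF _ mw(1)] bexI[OF _ mw(2)] bexI[OF _ mw(3)] bexI[OF _ mw(4)])
      (use cmp[OF m(1,3)] cmp[OF m(2,4)] cmp[OF m(2,3)] cmp[OF m(1,4)] o W e in \<open>simp add: tarr_idn hz\<close>)
qed

lemma additive_tensor:
  "additive F \<Longrightarrow> W \<in> obj C \<Longrightarrow> additive (\<lambda>X. F (X \<boxtimes> W))"
  "additive F \<Longrightarrow> W \<in> obj C \<Longrightarrow> additive (\<lambda>X. F (W \<boxtimes> X))"
  unfolding additive_def[of "\<lambda>X. F (X \<boxtimes> W)"] additive_def[of "\<lambda>X. F (W \<boxtimes> X)"]
  using biproduct_tensor_right biproduct_tensor_left additiveD by blast+

end

section \<open>The based ring of a fusion category\<close>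

context fusion_category begin

text \<open>
  Every simple object is isomorphic to an element of the finite set \<open>F\<close>, so \<open>F\<close> bounds the number of classes.
\<close>

lemma ex_irr_list: "\<exists>Xs. is_irr_list C Xs"
proof -
  define cl where "cl Y = {X. simple C X \<and> isomorphic C X Y}" for Y
  obtain F where F: "finite F" "\<And>X. simple C X \<Longrightarrow> \<exists>Y \<in> F. isomorphic C X Y"
    using finite_simples by blast
  have cl_eq: "cl X = cl Y" if "isomorphic C X Y" for X Y
    using that isomorphic_trans isomorphic_sym unfolding cl_def by blast
  have "cl ` {X. simple C X} \<subseteq> cl ` F"
  proof
    fix c assume "c \<in> cl ` {X. simple C X}"
    then obtain X where X: "simple C X" "c = cl X" by blast
    then obtain Y where "Y \<in> F" "isomorphic C X Y" using F(2) by blast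
    then show "c \<in> cl ` F" using cl_eq X by blast
  qed
  then have fin: "finite (cl ` {X. simple C X})" using F(1) finite_subset by blast
  define rep where "rep c = (SOME X. X \<in> c)" for c :: "'o set"
  have rep: "simple C (rep c) \<and> cl (rep c) = c" if c: "c \<in> cl ` {X. simple C X}" for c
  proof -
    obtain X where X: "simple C X" "c = cl X" using c by blast
    then have "X \<in> c" using isomorphic_refl[OF simple_obj] by (simp add: cl_def)
    then have "rep c \<in> c" unfolding rep_def by (rule someI)
    then show ?thesis using X cl_eq by (auto simp: cl_def)
  qed
  obtain cs where cs: "set cs = cl ` {X. simple C X}" "distinct cs" using fin finite_distinct_list by blast
  have "is_irr_list C (map rep cs)"
    unfolding is_irr_list_def
  proof (intro conjI ballI allI impI)
    fix X assume "X \<in> set (map rep cs)"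
    then show "simple C X" using rep cs by auto
  next
    fix i j assume ij: "i < length (map rep cs)" "j < length (map rep cs)"
      "isomorphic C (map rep cs ! i) (map rep cs ! j)"
    then have "cs ! i \<in> set cs" "cs ! j \<in> set cs" by auto
    then have r: "cl (rep (cs ! i)) = cs ! i" "cl (rep (cs ! j)) = cs ! j"
      unfolding cs(1) using rep[of "cs ! i"] rep[of "cs ! j"] by auto
    have "cl (rep (cs ! i)) = cl (rep (cs ! j))" by (rule cl_eq) (use ij in simp)
    then have "cs ! i = cs ! j" unfolding r .
    then show "i = j" using cs(2) ij by (simp add: nth_eq_iff_index_eq)
  next
    fix X assume X: "simple C X"
    then have c: "cl X \<in> set cs" using cs by blast
    then have "cl (rep (cl X)) = cl X" using rep cs(1) by blast
    moreover have "X \<in> cl X" using X isomorphic_refl[OF simple_obj] by (simp add: cl_def)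
    ultimately have "X \<in> cl (rep (cl X))" by simp
    then have "isomorphic C X (rep (cl X))" by (simp add: cl_def)
    then show "\<exists>Y \<in> set (map rep cs). isomorphic C X Y" using c by auto
  qed
  then show ?thesis by blast
qed

abbreviation irr :: "nat \<Rightarrow> 'o" where "irr k \<equiv> irr_list C ! k"
abbreviation rk :: nat where "rk \<equiv> length (irr_list C)"

lemma irr_list: "is_irr_list C (irr_list C)"
  unfolding irr_list_def using ex_irr_list by (rule someI_ex)

lemma irr_simple: "k < rk \<Longrightarrow> simple C (irr k)"
  using irr_list by (simp add: is_irr_list_def)

lemma irr_obj: "k < rk \<Longrightarrow> irr k \<in> obj C"
  using irr_simple simple_obj by blast

lemma irr_isomorphic_iff: "i < rk \<Longrightarrow> j < rk \<Longrightarrow> isomorphic C (irr i) (irr j) \<longleftrightarrow> i = j"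
  using irr_list isomorphic_refl irr_obj by (auto simp: is_irr_list_def)

lemma ex_irr: assumes "simple C X" obtains k where "k < rk" "isomorphic C X (irr k)"
  using assms irr_list unfolding is_irr_list_def by (metis in_set_conv_nth)

lemma dim_irr: "i < rk \<Longrightarrow> j < rk \<Longrightarrow> dim_Mor C (irr i) (irr j) = (if i = j then 1 else 0)"
  using dim_simples irr_simple irr_isomorphic_iff by simp

text \<open>
  For simple \<open>Z\<close> this is Schur's lemma, and both sides are additive in \<open>Z\<close>.
\<close>

lemma additive_decomposition:
  assumes F: "additive F" and Z: "Z \<in> obj C"
  shows "F Z = (\<Sum>k<rk. dim_Mor C (irr k) Z * F (irr k))"
proof -
  have simple: "F S = (\<Sum>k<rk. dim_Mor C (irr k) S * F (irr k))" if S: "simple C S" for S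
  proof -
    obtain l where l: "l < rk" "isomorphic C S (irr l)" using S by (rule ex_irr)
    have "(\<Sum>k<rk. dim_Mor C (irr k) S * F (irr k)) = (\<Sum>k<rk. dim_Mor C (irr k) (irr l) * F (irr k))"
      using additive_iso[OF dim_additive_right[OF irr_obj] l(2)] by simp
    also have "\<dots> = (\<Sum>k<rk. if k = l then F (irr k) else 0)"
      using l(1) by (intro sum.cong) (auto simp: dim_irr)
    also have "\<dots> = F S" using l additive_iso[OF F l(2)] by simp
    finally show ?thesis by simp
  qed
  obtain Ss where Ss: "\<forall>S\<in>set Ss. simple C S" "direct_sum C Z Ss" using semisimple[OF Z] by blast
  have "F Z = (\<Sum>S\<leftarrow>Ss. F S)" by (rule additive_direct_sum[OF F Ss(2)])
  also have "\<dots> = (\<Sum>S\<leftarrow>Ss. \<Sum>k<rk. dim_Mor C (irr k) S * F (irr k))"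
    using Ss(1) simple by (intro arg_cong[of _ _ sum_list] map_cong) auto
  also have "\<dots> = (\<Sum>k<rk. (\<Sum>S\<leftarrow>Ss. dim_Mor C (irr k) S) * F (irr k))"
    by (induction Ss) (simp_all add: sum.distrib algebra_simps)
  also have "\<dots> = (\<Sum>k<rk. dim_Mor C (irr k) Z * F (irr k))"
    using additive_direct_sum[OF dim_additive_right[OF irr_obj] Ss(2)] by (intro sum.cong) auto
  finally show ?thesis .
qed

text \<open>
  Both dimensions equal the sum over \<open>k\<close> of the products of the multiplicities of \<open>irr k\<close> in \<open>X\<close> and in \<open>Y\<close>.
\<close>

lemma dim_sym: assumes X: "X \<in> obj C" and Y: "Y \<in> obj C" shows "dim_Mor C X Y = dim_Mor C Y X"
proof -
  have "dim_Mor C A B = (\<Sum>k<rk. dim_Mor C (irr k) A * dim_Mor C (irr k) B)"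
    if "A \<in> obj C" "B \<in> obj C" for A B
    using additive_decomposition[OF dim_additive_left[OF that(2)] that(1)] .
  then show ?thesis using X Y by (simp add: mult.commute)
qed

definition fus :: "nat \<Rightarrow> nat \<Rightarrow> nat \<Rightarrow> nat" where
  "fus i j k = dim_Mor C (irr k) (irr i \<boxtimes> irr j)"

definition unit_index :: nat where
  "unit_index = (SOME k. k < rk \<and> isomorphic C (unit_obj C) (irr k))"

lemma unit_index: "unit_index < rk" "isomorphic C (unit_obj C) (irr unit_index)"
proof -
  have "\<exists>k. k < rk \<and> isomorphic C (unit_obj C) (irr k)" using ex_irr[OF simple_unit] by blast
  from someI_ex[OF this] show "unit_index < rk" "isomorphic C (unit_obj C) (irr unit_index)"
    by (auto simp: unit_index_def)
qed

lemma dim_unit: "X \<in> obj C \<Longrightarrow> dim_Mor C (unit_obj C) X = dim_Mor C (irr unit_index) X"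
  using additive_iso[OF dim_additive_left unit_index(2)] .

lemma isomorphic_lun: "X \<in> obj C \<Longrightarrow> isomorphic C (unit_obj C \<boxtimes> X) X"
  using lun_Mor lun_iso by (auto simp: isomorphic_def)

lemma isomorphic_run: "X \<in> obj C \<Longrightarrow> isomorphic C (X \<boxtimes> unit_obj C) X"
  using run_Mor run_iso by (auto simp: isomorphic_def)

lemma isomorphic_assoc:
  "X \<in> obj C \<Longrightarrow> Y \<in> obj C \<Longrightarrow> Z \<in> obj C \<Longrightarrow> isomorphic C ((X \<boxtimes> Y) \<boxtimes> Z) (X \<boxtimes> (Y \<boxtimes> Z))"
  using assoc_Mor assoc_iso unfolding isomorphic_def by blast

lemma fus_unit_left: assumes "j < rk" "k < rk" shows "fus unit_index j k = (if j = k then 1 else 0)"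
proof -
  have F: "additive (\<lambda>X. dim_Mor C (irr k) X)" using dim_additive_right irr_obj assms by blast
  have "fus unit_index j k = dim_Mor C (irr k) (unit_obj C \<boxtimes> irr j)"
    unfolding fus_def using additive_iso[OF additive_tensor(1)[OF F irr_obj] unit_index(2)] assms by simp
  also have "\<dots> = dim_Mor C (irr k) (irr j)"
    using additive_iso[OF F isomorphic_lun[OF irr_obj]] assms by simp
  finally show ?thesis using dim_irr assms by simp
qed

lemma fus_unit_right: assumes "j < rk" "k < rk" shows "fus j unit_index k = (if j = k then 1 else 0)"
proof -
  have F: "additive (\<lambda>X. dim_Mor C (irr k) X)" using dim_additive_right irr_obj assms by blast
  have "fus j unit_index k = dim_Mor C (irr k) (irr j \<boxtimes> unit_obj C)"
    unfolding fus_def using additive_iso[OF additive_tensor(2)[OF F irr_obj] unit_index(2)] assms by simp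
  also have "\<dots> = dim_Mor C (irr k) (irr j)"
    using additive_iso[OF F isomorphic_run[OF irr_obj]] assms by simp
  finally show ?thesis using dim_irr assms by simp
qed

lemma fus_assoc:
  assumes "i < rk" "j < rk" "k < rk" "l < rk"
  shows "(\<Sum>m<rk. fus i j m * fus m k l) = (\<Sum>m<rk. fus j k m * fus i m l)"
proof -
  note o = assms[THEN irr_obj]
  have F: "additive (\<lambda>X. dim_Mor C (irr l) X)" using dim_additive_right o by blast
  have "(\<Sum>m<rk. fus i j m * fus m k l) = dim_Mor C (irr l) ((irr i \<boxtimes> irr j) \<boxtimes> irr k)"
    unfolding fus_def
    using additive_decomposition[OF additive_tensor(1)[OF F o(3)] tobj_obj[OF o(1,2)]] by simp
  also have "\<dots> = dim_Mor C (irr l) (irr i \<boxtimes> (irr j \<boxtimes> irr k))"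
    using additive_iso[OF F isomorphic_assoc] o by blast
  also have "\<dots> = (\<Sum>m<rk. fus j k m * fus i m l)"
    unfolding fus_def
    using additive_decomposition[OF additive_tensor(2)[OF F o(1)] tobj_obj[OF o(2,3)]] by simp
  finally show ?thesis .
qed

lemma dim_dual: assumes "is_dual C X Y" "A \<in> obj C" "B \<in> obj C"
  shows "dim_Mor C (Y \<boxtimes> A) B = dim_Mor C A (X \<boxtimes> B)"
proof -
  have "Y \<boxtimes> A \<in> obj C" using assms tobj_obj by (simp add: is_dual_def)
  then obtain bs where "is_basis (Y \<boxtimes> A) B bs" using ex_basis assms(3) by blast
  then show ?thesis using dual_adjunction[OF assms] by blast
qed

text \<open>
  By adjunction \<open>Hom(X\<^sup>*, irr l) = Hom(\<one>, X \<otimes> irr l)\<close>, so the multiplicities of a dual can be read off from the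
  structure constants, without knowing yet that the dual is simple.
\<close>

lemma dual_multiplicity:
  assumes XY: "is_dual C X Y" and X: "isomorphic C X (irr i)" and i: "i < rk" and l: "l < rk"
  shows "dim_Mor C (irr l) Y = fus i l unit_index"
proof -
  have o: "X \<in> obj C" "Y \<in> obj C" "irr l \<in> obj C" "irr i \<in> obj C"
    using XY irr_obj l i by (auto simp: is_dual_def)
  have u: "unit_obj C \<in> obj C" by (rule unit_obj)
  have "dim_Mor C (irr l) Y = dim_Mor C Y (irr l)" using dim_sym o by blast
  also have "\<dots> = dim_Mor C (Y \<boxtimes> unit_obj C) (irr l)"
    using additive_iso[OF dim_additive_left isomorphic_run] o by simp
  also have "\<dots> = dim_Mor C (unit_obj C) (X \<boxtimes> irr l)" by (rule dim_dual[OF XY u o(3)])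
  also have "\<dots> = dim_Mor C (unit_obj C) (irr i \<boxtimes> irr l)"
    using additive_iso[OF additive_tensor(1)[OF dim_additive_right[OF u] o(3)] X] by simp
  also have "\<dots> = fus i l unit_index" unfolding fus_def by (rule dim_unit[OF tobj_obj[OF o(4,3)]])
  finally show ?thesis .
qed

lemma fus_dual_expansion:
  assumes i: "i < rk" and j: "j < rk" and k: "k < rk"
  shows "fus i j k = (\<Sum>l<rk. fus i l unit_index * fus l k j)"
proof -
  note o = i[THEN irr_obj] j[THEN irr_obj] k[THEN irr_obj]
  obtain Y where Y: "is_dual C (irr i) Y" using left_rigid o by blast
  then have Yo: "Y \<in> obj C" by (simp add: is_dual_def)
  have "fus i j k = dim_Mor C (Y \<boxtimes> irr k) (irr j)"
    unfolding fus_def using dim_dual[OF Y o(3,2)] by simp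
  also have "\<dots> = dim_Mor C (irr j) (Y \<boxtimes> irr k)" using dim_sym tobj_obj Yo o by blast
  also have "\<dots> = (\<Sum>l<rk. dim_Mor C (irr l) Y * dim_Mor C (irr j) (irr l \<boxtimes> irr k))"
    using additive_decomposition[OF additive_tensor(1)[OF dim_additive_right[OF o(2)] o(3)] Yo] .
  also have "\<dots> = (\<Sum>l<rk. fus i l unit_index * fus l k j)"
    using dual_multiplicity[OF Y isomorphic_refl[OF o(1)] i] by (intro sum.cong) (auto simp: fus_def)
  finally show ?thesis .
qed

text \<open>
  Let \<open>y i l\<close> be the multiplicity of \<open>irr l\<close> in the dual of \<open>irr i\<close>. Specialising the previous lemma to \<open>j\<close> the
  unit shows that the matrix \<open>y\<close> is its own inverse. A matrix of natural numbers whose inverse is of the same kind is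
  a permutation matrix, so duals of simple objects are simple and pairwise distinct.
\<close>

lemma ex1_dual_index:
  assumes i: "i < rk"
  shows "\<exists>j<rk. \<forall>l<rk. fus i l unit_index = (if l = j then 1 else 0)"
proof -
  define y where "y a b = fus a b unit_index" for a b
  have inv: "(\<Sum>l<rk. y a l * y l b) = (if a = b then 1 else 0)" if "a < rk" "b < rk" for a b
    using fus_dual_expansion[OF that(1) unit_index(1) that(2)] fus_unit_right[OF that] by (simp add: y_def)
  have "(\<Sum>l<rk. y i l * y l i) \<noteq> 0" using inv i by simp
  then obtain j where "j \<in> {..<rk}" "y i j * y j i \<noteq> 0"
    by (rule sum.not_neutral_contains_not_neutral)
  then have j: "j < rk" "y i j * y j i \<noteq> 0" by auto
  have le: "y a b * y b c \<le> (if a = c then 1 else 0)" if "a < rk" "b < rk" "c < rk" for a b c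
    unfolding inv[OF that(1,3), symmetric] by (rule member_le_sum[of b]) (use that in auto)
  have "y i l = (if l = j then 1 else 0)" if l: "l < rk" for l
  proof -
    have "y i j * y j i \<le> 1" using le[OF i j(1) i] by simp
    then have "y i j * y j i = 1" using j(2) by linarith
    moreover have "y j i * y i l \<le> (if j = l then 1 else 0)" by (rule le[OF j(1) i l])
    ultimately show ?thesis by (auto simp: nat_mult_eq_1_iff)
  qed
  then show ?thesis using j(1) by (auto simp: y_def)
qed

definition dual_index :: "nat \<Rightarrow> nat" where
  "dual_index i = (SOME j. j < rk \<and> (\<forall>l<rk. fus i l unit_index = (if l = j then 1 else 0)))"

lemma dual_index:
  assumes "i < rk"
  shows "dual_index i < rk" "l < rk \<Longrightarrow> fus i l unit_index = (if l = dual_index i then 1 else 0)"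
  using someI_ex[OF ex1_dual_index[OF assms]] unfolding dual_index_def by blast+

lemma fus_frobenius:
  assumes "i < rk" "j < rk" "k < rk"
  shows "fus i j k = fus (dual_index i) k j"
proof -
  have "fus i j k = (\<Sum>l<rk. if l = dual_index i then fus l k j else 0)"
    unfolding fus_dual_expansion[OF assms] using dual_index(2)[OF assms(1)] by (intro sum.cong) auto
  then show ?thesis using dual_index(1)[OF assms(1)] by simp
qed

sublocale gr: based_ring "{..<rk}" fus unit_index dual_index
proof unfold_locales
  show "fus i j k = fus (dual_index i) k j" if "i \<in> {..<rk}" "j \<in> {..<rk}" "k \<in> {..<rk}" for i j k
    using that by (intro fus_frobenius) auto
qed (simp_all add: unit_index(1) dual_index(1) fus_unit_left fus_unit_right fus_assoc)

lemma tensor_support: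
  assumes X: "X \<in> obj C" and Y: "Y \<in> obj C" and k: "k < rk" and pos: "dim_Mor C (irr k) (X \<boxtimes> Y) > 0"
  shows "\<exists>i<rk. \<exists>j<rk. dim_Mor C (irr i) X > 0 \<and> dim_Mor C (irr j) Y > 0 \<and> fus i j k > 0"
proof -
  have F: "additive (\<lambda>X. dim_Mor C (irr k) X)" using dim_additive_right irr_obj k by blast
  have "(\<Sum>i<rk. dim_Mor C (irr i) X * dim_Mor C (irr k) (irr i \<boxtimes> Y)) \<noteq> 0"
    unfolding additive_decomposition[OF additive_tensor(1)[OF F Y] X, symmetric] using pos by simp
  then obtain i where "i \<in> {..<rk}" "dim_Mor C (irr i) X * dim_Mor C (irr k) (irr i \<boxtimes> Y) \<noteq> 0"
    by (rule sum.not_neutral_contains_not_neutral)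
  then have i: "i < rk" "dim_Mor C (irr i) X > 0" "dim_Mor C (irr k) (irr i \<boxtimes> Y) > 0" by auto
  have "(\<Sum>j<rk. dim_Mor C (irr j) Y * dim_Mor C (irr k) (irr i \<boxtimes> irr j)) \<noteq> 0"
    unfolding additive_decomposition[OF additive_tensor(2)[OF F irr_obj[OF i(1)]] Y, symmetric]
    using i(3) by simp
  then obtain j where "j \<in> {..<rk}" "dim_Mor C (irr j) Y * dim_Mor C (irr k) (irr i \<boxtimes> irr j) \<noteq> 0"
    by (rule sum.not_neutral_contains_not_neutral)
  then have "j < rk" "dim_Mor C (irr j) Y > 0" "dim_Mor C (irr k) (irr i \<boxtimes> irr j) > 0" by auto
  then show ?thesis using i by (auto simp: fus_def)
qed

lemma tensor_power_obj: "X \<in> obj C \<Longrightarrow> tensor_power C X n \<in> obj C"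
  by (induction n) (auto simp: unit_obj tobj_obj)

text \<open>
  Multiplicities in a tensor power of a simple object only occur at constituents of the power of its class in the
  based ring.
\<close>

lemma tensor_power_support:
  assumes i: "i < rk" and k: "k < rk" and pos: "dim_Mor C (irr k) (tensor_power C (irr i) n) > 0"
  shows "k \<in> gr.hpow i n"
  using k pos
proof (induction n arbitrary: k)
  case 0
  have "dim_Mor C (irr k) (unit_obj C) = dim_Mor C (irr k) (irr unit_index)"
    using additive_iso[OF dim_additive_right[OF irr_obj] unit_index(2)] 0 by simp
  then show ?case using 0 unit_index(1) by (simp add: dim_irr split: if_splits)
next
  case (Suc n)
  obtain l j where l: "l < rk" "j < rk" "dim_Mor C (irr l) (tensor_power C (irr i) n) > 0"
    "dim_Mor C (irr j) (irr i) > 0" "fus l j k > 0"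
    using tensor_support[OF tensor_power_obj[OF irr_obj[OF i]] irr_obj[OF i] Suc.prems(1), of n] Suc.prems(2)
    by (auto simp only: tensor_power.simps)
  then have "j = i" using i by (simp add: dim_irr split: if_splits)
  then show ?case
    using gr.hprodI[of l "gr.hpow i n" i "{i}" k] Suc.IH[OF l(1,3)] Suc.prems(1) l i by simp
qed

lemma dim_pos_if_order:
  assumes n: "obj_order C X = n" "n \<noteq> 0"
  shows "dim_Mor C (unit_obj C) (tensor_power C X n) > 0"
proof -
  let ?P = "\<lambda>n. n \<ge> 1 \<and> mult_in C (unit_obj C) (tensor_power C X n) > 0"
  have ex: "\<exists>n. ?P n"
    using n unfolding obj_order_def by metis
  then have "n = (LEAST n. ?P n)" using n(1) unfolding obj_order_def by simp
  then show ?thesis using LeastI_ex[OF ex] by (simp add: mult_in_def)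
qed

lemma order_support:
  assumes i: "i < rk" and n: "obj_order C (irr i) = n" "n \<noteq> 0"
  shows "unit_index \<in> gr.hpow i n"
proof -
  have "dim_Mor C (irr unit_index) (tensor_power C (irr i) n) > 0"
    using dim_pos_if_order[OF n] dim_unit[OF tensor_power_obj[OF irr_obj[OF i]]] by simp
  then show ?thesis using tensor_power_support i unit_index(1) by blast
qed

text \<open>
  The character \<open>d\<close> is itself an eigenvector of the fusion matrix, and no other nonnegative eigenvalue exceeds its
  eigenvalue \<open>d i\<close>. Finiteness of the spectrum makes the maximum in the definition meaningful.
\<close>

lemma FPdim_obj_eq:
  assumes d: "gr.dim_character d" and i: "i < rk"
  shows "FPdim_obj C (irr i) = d i"
proof -
  have di: "d i > 0" using d i unfolding gr.dim_character_def by blast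
  define M where "M = fusion_matrix C (irr i)"
  have M: "M \<in> carrier_mat rk rk" by (simp add: M_def fusion_matrix_def Let_def)
  have entry: "M $$ (a, b) = real (fus i b a)" if "a < rk" "b < rk" for a b
    using that by (simp add: M_def fusion_matrix_def Let_def mult_in_def fus_def)
  have mv: "(M *\<^sub>v v) $ a = (\<Sum>b<rk. real (fus i b a) * v $ b)" if "a < rk" "v \<in> carrier_vec rk" for a v
    using that M entry by (simp add: scalar_prod_def atLeast0LessThan)
  have "eigenvalue M (d i)"
  proof -
    define v where "v = vec rk d"
    have "M *\<^sub>v v = d i \<cdot>\<^sub>v v"
    proof (rule eq_vecI)
      fix a assume "a < dim_vec (d i \<cdot>\<^sub>v v)"
      then have a: "a < rk" by (simp add: v_def)
      have "(M *\<^sub>v v) $ a = (\<Sum>b<rk. real (fus i b a) * d b)"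
        using mv[OF a, of v] by (simp add: v_def)
      then show "(M *\<^sub>v v) $ a = (d i \<cdot>\<^sub>v v) $ a"
        using gr.dim_character_eigenvector[OF d, of i a] i a by (simp add: v_def)
    qed (use M in \<open>simp add: v_def\<close>)
    moreover have "v \<noteq> 0\<^sub>v rk"
    proof
      assume "v = 0\<^sub>v rk"
      then have "v $ i = 0" using i by simp
      then show False using di i by (simp add: v_def)
    qed
    ultimately show ?thesis using M by (auto simp: eigenvalue_def eigenvector_def v_def intro!: exI[of _ v])
  qed
  moreover have "r \<le> d i" if r: "r \<ge> 0" "eigenvalue M r" for r
  proof -
    obtain v where v: "v \<in> carrier_vec rk" "v \<noteq> 0\<^sub>v rk" "M *\<^sub>v v = r \<cdot>\<^sub>v v"
      using r(2) M by (auto simp: eigenvalue_def eigenvector_def)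
    obtain k where k: "k < rk" "v $ k \<noteq> 0" using v(1,2) by (metis carrier_vecD eq_vecI index_zero_vec)
    show ?thesis
    proof (rule gr.eigenvalue_le_dim_character[OF d, of i "\<lambda>j. v $ j" r k])
      show "(\<Sum>j<rk. real (fus i j a) * v $ j) = r * v $ a" if "a \<in> {..<rk}" for a
        using mv[of a v] v that by simp
    qed (use i r k in auto)
  qed
  moreover have "finite {r. eigenvalue M r}"
  proof -
    have "char_poly M \<noteq> 0" using degree_monic_char_poly[OF M] by auto
    then show ?thesis by (simp add: eigenvalue_root_char_poly[OF M] poly_roots_finite)
  qed
  moreover have "d i \<ge> 0" using di by simp
  ultimately show ?thesis
    unfolding FPdim_obj_def M_def[symmetric] by (intro Max_eqI) auto
qed

lemma FPdim_eq:
  assumes d: "gr.dim_character d"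
  shows "FPdim C = (\<Sum>i<rk. (d i)\<^sup>2)"
  unfolding FPdim_def sum_list_sum_nth using FPdim_obj_eq[OF d] by (simp add: atLeast0LessThan)

end

section \<open>Fusion subcategories and the adjoint series\<close>

lemma full_subcategory_simps [simp]:
  "obj (full_subcategory C D) = D"
  "arr (full_subcategory C D) = {f \<in> arr C. src C f \<in> D \<and> tgt C f \<in> D}"
  "src (full_subcategory C D) = src C" "tgt (full_subcategory C D) = tgt C"
  "idn (full_subcategory C D) = idn C" "cmp (full_subcategory C D) = cmp C"
  "hadd (full_subcategory C D) = hadd C" "hzero (full_subcategory C D) = hzero C"
  "hscale (full_subcategory C D) = hscale C" "tobj (full_subcategory C D) = tobj C"
  "tarr (full_subcategory C D) = tarr C" "unit_obj (full_subcategory C D) = unit_obj C"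
  "lin_tensor_cat.assoc (full_subcategory C D) = lin_tensor_cat.assoc C"
  "lun (full_subcategory C D) = lun C" "run (full_subcategory C D) = run C"
  by (simp_all add: full_subcategory_def)

lemma Mor_full_subcategory:
  "Mor (full_subcategory C D) X Y = (if X \<in> D \<and> Y \<in> D then Mor C X Y else {})"
  by (auto simp: Mor_def)

lemma full_subcategory_twice:
  "E \<subseteq> D \<Longrightarrow> full_subcategory (full_subcategory C D) E = full_subcategory C E"
  unfolding full_subcategory_def by (auto intro!: arg_cong[of _ _ "\<lambda>A. C\<lparr>obj := E, arr := A\<rparr>"])

lemma is_inverse_full_subcategory:
  "src C f \<in> D \<Longrightarrow> tgt C f \<in> D \<Longrightarrow> is_inverse (full_subcategory C D) f g \<longleftrightarrow> is_inverse C f g"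
  by (auto simp: is_inverse_def Mor_def)

lemma inv_arr_full_subcategory:
  "src C f \<in> D \<Longrightarrow> tgt C f \<in> D \<Longrightarrow> inv_arr (full_subcategory C D) f = inv_arr C f"
  by (simp add: inv_arr_def is_inverse_full_subcategory)

lemma is_iso_full_subcategory:
  "src C f \<in> D \<Longrightarrow> tgt C f \<in> D \<Longrightarrow> is_iso (full_subcategory C D) f \<longleftrightarrow> is_iso C f"
  by (simp add: is_iso_def is_inverse_full_subcategory)

lemma is_biproduct_full_subcategory:
  "is_biproduct (full_subcategory C D) Z X Y \<longleftrightarrow> X \<in> D \<and> Y \<in> D \<and> Z \<in> D \<and> is_biproduct C Z X Y"
  by (auto simp: is_biproduct_def Mor_full_subcategory)

lemma is_mono_full_subcategory:
  "is_mono C m \<Longrightarrow> src C m \<in> D \<Longrightarrow> tgt C m \<in> D \<Longrightarrow> is_mono (full_subcategory C D) m"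
  by (auto simp: is_mono_def Mor_full_subcategory)

lemma is_mono_full_subcategoryD:
  assumes "is_mono (full_subcategory C D) m" "g \<in> Mor C W (src C m)" "h \<in> Mor C W (src C m)"
    "cmp C m g = cmp C m h" "W \<in> D"
  shows "g = h"
proof -
  have "\<forall>g \<in> Mor (full_subcategory C D) W (src C m). \<forall>h \<in> Mor (full_subcategory C D) W (src C m).
      cmp C m g = cmp C m h \<longrightarrow> g = h" and "src C m \<in> D"
    using assms(1) by (simp_all add: is_mono_def)
  then show ?thesis using assms by (simp add: Mor_full_subcategory)
qed

lemma fusion_subcategoryD:
  assumes "fusion_subcategory C D"
  shows "D \<subseteq> obj C" "unit_obj C \<in> D" "X \<in> D \<Longrightarrow> Y \<in> D \<Longrightarrow> X \<boxtimes>\<^bsub>C\<^esub> Y \<in> D"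
    "X \<in> D \<Longrightarrow> Y \<in> D \<Longrightarrow> is_biproduct C Z X Y \<Longrightarrow> Z \<in> D"
    "is_mono C m \<Longrightarrow> tgt C m \<in> D \<Longrightarrow> src C m \<in> D"
  using assms unfolding fusion_subcategory_def by blast+

lemma fusion_subcategoryI:
  assumes "D \<subseteq> obj C" "unit_obj C \<in> D" "\<And>X Y. X \<in> D \<Longrightarrow> Y \<in> D \<Longrightarrow> X \<boxtimes>\<^bsub>C\<^esub> Y \<in> D"
    "\<And>X Y Z. X \<in> D \<Longrightarrow> Y \<in> D \<Longrightarrow> is_biproduct C Z X Y \<Longrightarrow> Z \<in> D"
    "\<And>m. is_mono C m \<Longrightarrow> tgt C m \<in> D \<Longrightarrow> src C m \<in> D"
  shows "fusion_subcategory C D"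
  using assms unfolding fusion_subcategory_def by blast

context fusion_category begin

lemma full_subcategory_obj: "full_subcategory C (obj C) = C"
proof -
  have "{f \<in> arr C. src C f \<in> obj C \<and> tgt C f \<in> obj C} = arr C" using src_obj tgt_obj by auto
  then show ?thesis by (simp add: full_subcategory_def)
qed

lemma is_zero_obj_full_subcategory:
  assumes "D \<subseteq> obj C" "X \<in> D"
  shows "is_zero_obj (full_subcategory C D) X \<longleftrightarrow> is_zero_obj C X"
proof
  assume "is_zero_obj (full_subcategory C D) X"
  then have "\<exists>!f. f \<in> Mor C X X"
    using assms(2) by (auto simp: is_zero_obj_def Mor_full_subcategory)
  moreover have "X \<in> obj C" using assms by blast
  ultimately show "is_zero_obj C X" using zero_obj_iff idn_Mor hzero_Mor by metis
next
  assume X: "is_zero_obj C X"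
  have "(\<exists>!f. f \<in> Mor C A X) \<and> (\<exists>!f. f \<in> Mor C X A)" if "A \<in> D" for A
    using X that assms unfolding is_zero_obj_def by blast
  then show "is_zero_obj (full_subcategory C D) X"
    using assms(2) by (simp add: is_zero_obj_def Mor_full_subcategory)
qed

lemma fusion_subcategory_obj: "fusion_subcategory C (obj C)"
  using biproduct_objs unit_obj tobj_obj src_obj unfolding fusion_subcategory_def is_mono_def by blast

definition simples_in :: "'o set \<Rightarrow> nat set" where
  "simples_in D = {k. k < rk \<and> irr k \<in> D}"

context
  fixes D assumes D: "fusion_subcategory C D"
begin

lemma subcat_obj: "X \<in> D \<Longrightarrow> X \<in> obj C"
  and subcat_unit: "unit_obj C \<in> D"
  and subcat_tensor: "X \<in> D \<Longrightarrow> Y \<in> D \<Longrightarrow> X \<boxtimes> Y \<in> D"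
  and subcat_biproduct: "is_biproduct C Z X Y \<Longrightarrow> X \<in> D \<Longrightarrow> Y \<in> D \<Longrightarrow> Z \<in> D"
  and subcat_mono: "is_mono C m \<Longrightarrow> tgt C m \<in> D \<Longrightarrow> src C m \<in> D"
  using D unfolding fusion_subcategory_def by blast+

lemma subcat_isomorphic: assumes "isomorphic C X Y" "Y \<in> D" shows "X \<in> D"
proof -
  obtain f where f: "f \<in> Mor C X Y" "is_iso C f" using assms(1) by (auto simp: isomorphic_def)
  obtain g where "g \<in> Mor C Y X" "g \<cdot> f = idn C X" using f by (elim is_isoE)
  then have "is_mono C f" using iso_mono f(1) by blast
  then show ?thesis using subcat_mono[of f] f(1) assms(2) by (auto simp: Mor_def)
qed

lemma subcat_zero: assumes Z: "is_zero_obj C Z" shows "Z \<in> D"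
proof -
  have Zo: "Z \<in> obj C" using Z by (simp add: is_zero_obj_def)
  have f: "hzero C Z (unit_obj C) \<in> Mor C Z (unit_obj C)" using Zo unit_obj hzero_Mor by blast
  have "is_mono C (hzero C Z (unit_obj C))"
    unfolding is_mono_def using f Mor_zero_obj(1)[OF Z] by (simp add: Mor_src Mor_arr) metis
  then show ?thesis using subcat_mono[of "hzero C Z (unit_obj C)"] f subcat_unit by (auto simp: Mor_def)
qed

lemma subcat_constituent:
  assumes X: "X \<in> D" and k: "k < rk" and pos: "dim_Mor C (irr k) X > 0"
  shows "irr k \<in> D"
proof -
  obtain f where f: "f \<in> Mor C (irr k) X" "f \<noteq> hzero C (irr k) X"
    using pos dim_pos_iff[OF irr_obj[OF k] subcat_obj[OF X]] by blast
  have "is_mono C f" by (rule simple_nonzero_mono[OF irr_simple[OF k] f])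
  then show ?thesis using subcat_mono[of f] f(1) X by (auto simp: Mor_def)
qed

text \<open>
  A fusion subcategory contains exactly the objects all of whose simple constituents it contains.
\<close>

lemma subcat_if_constituents:
  assumes Z: "Z \<in> obj C" and con: "\<And>k. k < rk \<Longrightarrow> dim_Mor C (irr k) Z > 0 \<Longrightarrow> irr k \<in> D"
  shows "Z \<in> D"
proof -
  obtain Ss where Ss: "\<forall>S\<in>set Ss. simple C S" "direct_sum C Z Ss" using semisimple[OF Z] by blast
  have "S \<in> D" if S: "S \<in> set Ss" for S
  proof -
    have "simple C S" using S Ss(1) by blast
    then obtain k where k: "k < rk" "isomorphic C S (irr k)" by (rule ex_irr)
    have F: "additive (\<lambda>X. dim_Mor C (irr k) X)" using dim_additive_right irr_obj k by blast
    have "1 = dim_Mor C (irr k) S" using additive_iso[OF F k(2)] k(1) by (simp add: dim_irr)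
    also have "\<dots> \<le> (\<Sum>S\<leftarrow>Ss. dim_Mor C (irr k) S)" using S by (intro member_le_sum_list) auto
    also have "\<dots> = dim_Mor C (irr k) Z" using additive_direct_sum[OF F Ss(2)] by simp
    finally have "irr k \<in> D" using con k(1) by simp
    then show ?thesis using subcat_isomorphic k(2) by blast
  qed
  then have "\<forall>S\<in>set Ss. S \<in> D" by blast
  with Ss(2) show ?thesis
  proof (induction Ss arbitrary: Z)
    case Nil
    then show ?case using subcat_zero by simp
  next
    case (Cons S Ss)
    then show ?case using subcat_biproduct by auto
  qed
qed

lemma simples_in_closed:
  "simples_in D \<subseteq> {..<rk}" "unit_index \<in> simples_in D"
  "gr.hprod (simples_in D) (simples_in D) \<subseteq> simples_in D"
proof -
  show "simples_in D \<subseteq> {..<rk}" by (auto simp: simples_in_def)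
  show "unit_index \<in> simples_in D"
    using unit_index subcat_isomorphic[OF isomorphic_sym[OF unit_index(2)] subcat_unit] by (simp add: simples_in_def)
  show "gr.hprod (simples_in D) (simples_in D) \<subseteq> simples_in D"
  proof
    fix k assume "k \<in> gr.hprod (simples_in D) (simples_in D)"
    then obtain i j where "i \<in> simples_in D" "j \<in> simples_in D" "k < rk" "fus i j k > 0"
      by (auto simp: gr.hprod_iff)
    then show "k \<in> simples_in D"
      using subcat_constituent[OF subcat_tensor, of "irr i" "irr j" k] by (simp add: simples_in_def fus_def)
  qed
qed

text \<open>
  A monomorphism \<open>m\<close> of the subcategory into a simple object \<open>X\<close> need not be a monomorphism of \<open>C\<close> a priori.
  But if its source \<open>Y\<close> is nonzero, it contains a simple object of the subcategory, on which \<open>m\<close> is nonzero and thus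
  invertible; so \<open>m\<close> has a right inverse, which is a two-sided one as \<open>m\<close> is a monomorphism.
\<close>

lemma simple_full_subcategory: "simple (full_subcategory C D) X \<longleftrightarrow> X \<in> D \<and> simple C X"
proof
  assume X: "simple (full_subcategory C D) X"
  then have XD: "X \<in> D" by (simp add: simple_def)
  then have nz: "\<not> is_zero_obj C X"
    using X is_zero_obj_full_subcategory[of D X] subcat_obj by (auto simp: simple_def)
  have "is_zero_obj C (src C m) \<or> is_iso C m" if m: "is_mono C m" "tgt C m = X" for m
  proof -
    have s: "src C m \<in> D" using subcat_mono m XD by blast
    then have "is_zero_obj (full_subcategory C D) (src C m) \<or> is_iso (full_subcategory C D) m"
      using X is_mono_full_subcategory[of C m D] m XD by (auto simp: simple_def)
    then show ?thesis
      using is_zero_obj_full_subcategory[of D "src C m"] is_iso_full_subcategory[of C m D] s m XD subcat_obj by blast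
  qed
  then show "X \<in> D \<and> simple C X" using XD nz subcat_obj by (simp add: simple_def)
next
  assume X: "X \<in> D \<and> simple C X"
  have "is_zero_obj C (src C m) \<or> is_iso C m"
    if m: "is_mono (full_subcategory C D) m" "tgt C m = X" for m
  proof (rule disjCI)
    define Y where "Y = src C m"
    have mY: "m \<in> Mor C Y X" and YD: "Y \<in> D" using m by (auto simp: is_mono_def Mor_def Y_def)
    have cancel: "g = h" if "g \<in> Mor C W Y" "h \<in> Mor C W Y" "m \<cdot> g = m \<cdot> h" "W \<in> D" for g h W
      using is_mono_full_subcategoryD[OF m(1), of g W h] that by (simp add: Y_def)
    assume "\<not> is_iso C m"
    have "dim_Mor C (irr k) Y = 0" if k: "k < rk" for k
    proof (rule ccontr)
      assume "dim_Mor C (irr k) Y \<noteq> 0"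
      then obtain f where f: "f \<in> Mor C (irr k) Y" "f \<noteq> hzero C (irr k) Y"
        using dim_pos_iff[OF irr_obj[OF k] subcat_obj[OF YD]] by auto
      have kD: "irr k \<in> D" using subcat_constituent[OF YD k] \<open>dim_Mor C (irr k) Y \<noteq> 0\<close> by simp
      have mf: "m \<cdot> f \<in> Mor C (irr k) X" using f mY cmp_Mor by blast
      have "m \<cdot> f \<noteq> hzero C (irr k) X"
        using cancel[OF f(1) hzero_Mor] f mY kD irr_obj[OF k] subcat_obj[OF YD] cmp_hzero[OF mY] by auto
      then have "is_iso C (m \<cdot> f)" using schur_iso[OF irr_simple[OF k] _ mf] X by blast
      then obtain g where g: "g \<in> Mor C X (irr k)" "(m \<cdot> f) \<cdot> g = idn C X" using mf by (elim is_isoE)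
      have fg: "f \<cdot> g \<in> Mor C X Y" using f g cmp_Mor by blast
      have r: "m \<cdot> (f \<cdot> g) = idn C X" using g f mY by (simp add: cmp_assoc)
      have "m \<cdot> ((f \<cdot> g) \<cdot> m) = m \<cdot> idn C Y"
        using r fg mY by (simp add: cmp_assoc[symmetric] idn_left idn_right)
      then have "(f \<cdot> g) \<cdot> m = idn C Y"
        using cancel[OF cmp_Mor[OF mY fg] idn_Mor] YD subcat_obj by blast
      then show False using is_isoI[OF mY fg _ r] \<open>\<not> is_iso C m\<close> by blast
    qed
    then have "dim_Mor C Y Y = 0"
      using additive_decomposition[OF dim_additive_left[OF subcat_obj[OF YD]] subcat_obj[OF YD]] by simp
    then have "idn C Y = hzero C Y Y"
      using dim_pos_iff[of Y Y] idn_Mor subcat_obj[OF YD] by auto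
    then show "is_zero_obj C (src C m)" using zero_obj_iff subcat_obj YD by (auto simp: Y_def)
  qed
  then have "is_zero_obj (full_subcategory C D) (src C m) \<or> is_iso (full_subcategory C D) m"
    if "is_mono (full_subcategory C D) m" "tgt C m = X" for m
    using that is_zero_obj_full_subcategory[of D "src C m"] is_iso_full_subcategory[of C m D] X subcat_obj
    by (auto simp: is_mono_def)
  then show "simple (full_subcategory C D) X"
    using X is_zero_obj_full_subcategory[of D X] subcat_obj by (auto simp: simple_def)
qed

lemma is_dual_full_subcategory:
  "is_dual (full_subcategory C D) X Y \<longleftrightarrow> X \<in> D \<and> Y \<in> D \<and> is_dual C X Y"
proof (cases "X \<in> D \<and> Y \<in> D")
  case True
  then have o: "X \<in> D" "Y \<in> D" "X \<in> obj C" "Y \<in> obj C" using subcat_obj by auto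
  show ?thesis
    unfolding is_dual_def
    by (simp add: o Mor_full_subcategory subcat_unit subcat_tensor inv_arr_full_subcategory lun_arr run_arr assoc_arr)
qed (auto simp: is_dual_def)

lemma fusion_subcategory_trans:
  assumes E: "fusion_subcategory (full_subcategory C D) E"
  shows "fusion_subcategory C E" "E \<subseteq> D"
proof -
  note E = fusion_subcategoryD[OF E, unfolded full_subcategory_simps]
  show ED: "E \<subseteq> D" by (rule E(1))
  show "fusion_subcategory C E"
  proof (rule fusion_subcategoryI)
    show "E \<subseteq> obj C" using ED subcat_obj by blast
    show "unit_obj C \<in> E" by (rule E(2))
    show "X \<boxtimes> Y \<in> E" if "X \<in> E" "Y \<in> E" for X Y using that by (rule E(3))
  next
    fix X Y Z assume XYZ: "X \<in> E" "Y \<in> E" "is_biproduct C Z X Y"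
    show "Z \<in> E"
    proof (rule E(4)[OF XYZ(1,2)])
      show "is_biproduct (full_subcategory C D) Z X Y"
        unfolding is_biproduct_full_subcategory using XYZ ED subcat_biproduct[OF XYZ(3)] by auto
    qed
  next
    fix m assume m: "is_mono C m" "tgt C m \<in> E"
    then have "tgt C m \<in> D" using ED by blast
    then have "is_mono (full_subcategory C D) m"
      using m(1) subcat_mono[OF m(1)] by (intro is_mono_full_subcategory)
    then show "src C m \<in> E" using m(2) by (rule E(5))
  qed
qed

lemma fusion_subcategory_self: "fusion_subcategory (full_subcategory C D) D"
  unfolding fusion_subcategory_def
  by (auto simp: subcat_unit subcat_tensor is_biproduct_full_subcategory is_mono_def)

lemma adjoint_objs_fusion_subcategory:
  "fusion_subcategory (full_subcategory C D) (adjoint_objs (full_subcategory C D))"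
proof -
  define F where "F = {E. fusion_subcategory (full_subcategory C D) E \<and>
    (\<forall>X Y. simple (full_subcategory C D) X \<and> is_dual (full_subcategory C D) X Y \<longrightarrow> X \<boxtimes> Y \<in> E)}"
  have "D \<in> F"
    using fusion_subcategory_self subcat_tensor simple_full_subcategory is_dual_full_subcategory by (auto simp: F_def)
  moreover have "fusion_subcategory (full_subcategory C D) E" if "E \<in> F" for E using that by (simp add: F_def)
  ultimately have "fusion_subcategory (full_subcategory C D) (\<Inter> F)"
    unfolding fusion_subcategory_def by blast
  then show ?thesis by (simp add: adjoint_objs_def F_def)
qed

end

lemma tensor_dual_support:
  assumes XY: "is_dual C X Y" and X: "isomorphic C X (irr z)" and z: "z < rk" and k: "k < rk"
  shows "dim_Mor C (irr k) (X \<boxtimes> Y) = fus z (dual_index z) k"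
proof -
  have o: "X \<in> obj C" "Y \<in> obj C" using XY by (auto simp: is_dual_def)
  have F: "additive (\<lambda>X. dim_Mor C (irr k) X)" using dim_additive_right irr_obj k by blast
  have "dim_Mor C (irr k) (X \<boxtimes> Y) = dim_Mor C (irr k) (irr z \<boxtimes> Y)"
    using additive_iso[OF additive_tensor(1)[OF F o(2)] X] .
  also have "\<dots> = (\<Sum>l<rk. dim_Mor C (irr l) Y * fus z l k)"
    using additive_decomposition[OF additive_tensor(2)[OF F irr_obj[OF z]] o(2)] by (simp add: fus_def)
  also have "\<dots> = (\<Sum>l<rk. if l = dual_index z then fus z l k else 0)"
    using dual_multiplicity[OF XY X z] dual_index(2)[OF z] by (intro sum.cong) auto
  finally show ?thesis using dual_index(1)[OF z] by simp
qed

text \<open>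
  The simple objects in the subcategory generated by all \<open>X \<otimes> X\<^sup>*\<close> contain the adjoint subring since they are
  closed under constituents of products. Conversely, the objects \<open>E\<close> of the subcategory whose constituents lie in the
  adjoint subring form a fusion subcategory that contains all \<open>X \<otimes> X\<^sup>*\<close>.
\<close>

lemma simples_in_adjoint:
  assumes D: "fusion_subcategory C D" and S: "gr.based_subring (simples_in D)"
  shows "simples_in (adjoint_objs (full_subcategory C D)) = gr.adjoint_subring (simples_in D)"
proof
  let ?D' = "adjoint_objs (full_subcategory C D)"
  let ?A = "gr.adjoint_subring (simples_in D)"
  note D'_sub = fusion_subcategory_trans[OF D adjoint_objs_fusion_subcategory[OF D]]
  note D'_constituent = subcat_constituent[OF D'_sub(1)] and D'_closed = simples_in_closed[OF D'_sub(1)]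
  note subcat_obj = subcat_obj[OF D] and subcat_unit = subcat_unit[OF D] and subcat_tensor = subcat_tensor[OF D]
    and subcat_constituent = subcat_constituent[OF D] and subcat_if_constituents = subcat_if_constituents[OF D]
    and subcat_isomorphic = subcat_isomorphic[OF D] and simple_full_subcategory = simple_full_subcategory[OF D]
    and is_dual_full_subcategory = is_dual_full_subcategory[OF D]
  show "?A \<subseteq> simples_in ?D'"
  proof
    fix k assume "k \<in> ?A"
    then show "k \<in> simples_in ?D'"
    proof induction
      case (gen z k)
      then have z: "z < rk" "irr z \<in> D" and k: "k < rk" "fus z (dual_index z) k > 0"
        by (auto simp: simples_in_def gr.hprod_iff)
      obtain Y where Y: "is_dual C (irr z) Y" using left_rigid irr_obj[OF z(1)] by blast
      note zz = isomorphic_refl[OF irr_obj[OF z(1)]]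
      have "dual_index z \<in> simples_in D" using S gen(1) by (simp add: gr.based_subring_def)
      then have zD: "irr (dual_index z) \<in> D" by (simp add: simples_in_def)
      have con: "irr l \<in> D" if l: "l < rk" "dim_Mor C (irr l) Y > 0" for l
      proof -
        have "fus z l unit_index > 0" using l(2) dual_multiplicity[OF Y zz z(1) l(1)] by simp
        then have "l = dual_index z" using dual_index(2)[OF z(1) l(1)] by (simp split: if_splits)
        then show ?thesis using zD by simp
      qed
      have "Y \<in> obj C" using Y by (simp add: is_dual_def)
      then have "Y \<in> D" by (rule subcat_if_constituents[OF _ con])
      then have "simple (full_subcategory C D) (irr z)" "is_dual (full_subcategory C D) (irr z) Y"
        using z Y irr_simple[OF z(1)] by (simp_all add: simple_full_subcategory is_dual_full_subcategory)
      then have "irr z \<boxtimes> Y \<in> ?D'"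
        unfolding adjoint_objs_def full_subcategory_simps(10) by blast
      moreover have "dim_Mor C (irr k) (irr z \<boxtimes> Y) > 0"
        using tensor_dual_support[OF Y zz z(1) k(1)] k(2) by simp
      ultimately have "irr k \<in> ?D'" by (intro D'_constituent[OF _ k(1)])
      then show ?case using k(1) by (simp add: simples_in_def)
    next
      case (prod a b k)
      then show ?case
        using D'_closed(3) gr.hprod_mono[of "{a}" "simples_in ?D'" "{b}" "simples_in ?D'"] by blast
    qed
  qed
  define E where "E = {X \<in> D. \<forall>k<rk. dim_Mor C (irr k) X > 0 \<longrightarrow> k \<in> ?A}"
  have "fusion_subcategory (full_subcategory C D) E"
    unfolding fusion_subcategory_def
  proof (intro conjI ballI allI impI; (elim conjE)?)
    show "E \<subseteq> obj (full_subcategory C D)" by (auto simp: E_def)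
    have "k = unit_index" if "k < rk" "dim_Mor C (irr k) (unit_obj C) > 0" for k
      using that additive_iso[OF dim_additive_right[OF irr_obj] unit_index(2), of k] unit_index(1)
      by (simp add: dim_irr split: if_splits)
    then show "unit_obj (full_subcategory C D) \<in> E"
      using subcat_unit gr.adjoint_unit[OF S] by (auto simp: E_def)
  next
    fix X Y assume XY: "X \<in> E" "Y \<in> E"
    have "k \<in> ?A" if k: "k < rk" "dim_Mor C (irr k) (X \<boxtimes> Y) > 0" for k
    proof -
      obtain i j where "i < rk" "j < rk" "dim_Mor C (irr i) X > 0" "dim_Mor C (irr j) Y > 0" "fus i j k > 0"
        using tensor_support[OF _ _ k] XY subcat_obj by (auto simp: E_def)
      then have "i \<in> ?A" "j \<in> ?A" "k \<in> gr.hprod {i} {j}"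
        using XY k(1) by (auto simp: E_def gr.hprod_iff)
      then show ?thesis by (rule gr.adjoint_subring.prod)
    qed
    then show "X \<boxtimes>\<^bsub>full_subcategory C D\<^esub> Y \<in> E" using XY subcat_tensor by (simp add: E_def)
  next
    fix X Y Z assume XY: "X \<in> E" "Y \<in> E" and "is_biproduct (full_subcategory C D) Z X Y"
    then have Z: "Z \<in> D" "is_biproduct C Z X Y" by (auto simp: is_biproduct_full_subcategory)
    have "k \<in> ?A" if k: "k < rk" "dim_Mor C (irr k) Z > 0" for k
    proof -
      have "dim_Mor C (irr k) X > 0 \<or> dim_Mor C (irr k) Y > 0"
        using additiveD[OF dim_additive_right[OF irr_obj[OF k(1)]] Z(2)] k(2) by linarith
      then show ?thesis using XY k(1) by (auto simp: E_def)
    qed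
    then show "Z \<in> E" using Z(1) by (simp add: E_def)
  next
    fix m assume m: "is_mono (full_subcategory C D) m" "tgt (full_subcategory C D) m \<in> E"
    define Y where "Y = src C m"
    define X where "X = tgt C m"
    have mY: "m \<in> Mor C Y X" and YD: "Y \<in> D" using m by (auto simp: is_mono_def Mor_def Y_def X_def)
    have XE: "X \<in> E" using m by (simp add: X_def)
    have "k \<in> ?A" if k: "k < rk" "dim_Mor C (irr k) Y > 0" for k
    proof -
      obtain f where f: "f \<in> Mor C (irr k) Y" "f \<noteq> hzero C (irr k) Y"
        using dim_pos_iff[OF irr_obj[OF k(1)] subcat_obj[OF YD]] k(2) by auto
      have kD: "irr k \<in> D" using subcat_constituent[OF YD k] .
      have z: "hzero C (irr k) Y \<in> Mor C (irr k) Y" using hzero_Mor irr_obj[OF k(1)] subcat_obj[OF YD] by blast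
      have "m \<cdot> f \<noteq> m \<cdot> hzero C (irr k) Y"
        using is_mono_full_subcategoryD[OF m(1), of f "irr k" "hzero C (irr k) Y"] f z kD
        by (auto simp: Y_def)
      then have "m \<cdot> f \<noteq> hzero C (irr k) X" using cmp_hzero[OF mY irr_obj[OF k(1)]] by simp
      moreover have "m \<cdot> f \<in> Mor C (irr k) X" using f mY cmp_Mor by blast
      ultimately have "dim_Mor C (irr k) X > 0"
        using dim_pos_iff[OF irr_obj[OF k(1)] Mor_objs(2)[OF mY]] by blast
      then show ?thesis using XE k(1) by (simp add: E_def)
    qed
    then show "src (full_subcategory C D) m \<in> E" using YD by (simp add: E_def Y_def)
  qed
  moreover have "X \<boxtimes> Y \<in> E"
    if X: "simple (full_subcategory C D) X" and XY: "is_dual (full_subcategory C D) X Y" for X Y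
  proof -
    have *: "X \<in> D" "Y \<in> D" "simple C X" "is_dual C X Y"
      using X XY simple_full_subcategory is_dual_full_subcategory by auto
    obtain z where z: "z < rk" "isomorphic C X (irr z)" using *(3) by (rule ex_irr)
    have zS: "z \<in> simples_in D"
      using z subcat_isomorphic[OF isomorphic_sym[OF z(2)] *(1)] by (simp add: simples_in_def)
    have "k \<in> ?A" if k: "k < rk" "dim_Mor C (irr k) (X \<boxtimes> Y) > 0" for k
    proof (rule gr.adjoint_subring.gen[OF zS])
      show "k \<in> gr.hprod {z} {dual_index z}"
        using tensor_dual_support[OF *(4) z(2,1) k(1)] k z(1) dual_index(1)[OF z(1)]
        by (simp add: gr.hprod_iff)
    qed
    then show ?thesis using * subcat_tensor by (simp add: E_def)
  qed
  ultimately have "?D' \<subseteq> E" by (auto simp: adjoint_objs_def)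
  then show "simples_in ?D' \<subseteq> ?A" by (auto simp: simples_in_def E_def dim_irr)
qed

lemma simples_in_Vec:
  assumes D: "fusion_subcategory C D" and V: "is_Vec (full_subcategory C D)"
  shows "simples_in D = {unit_index}"
proof -
  note subcat_obj = subcat_obj[OF D]
  have "k = unit_index" if k: "k \<in> simples_in D" for k
  proof -
    have kr: "k < rk" "irr k \<in> D" using k by (auto simp: simples_in_def)
    obtain n where n: "direct_sum (full_subcategory C D) (irr k) (replicate n (unit_obj C))"
      using V kr(2) by (auto simp: is_Vec_def)
    show ?thesis
    proof (cases n)
      case 0
      then have "is_zero_obj C (irr k)"
        using n is_zero_obj_full_subcategory[of D "irr k"] kr subcat_obj by auto
      then show ?thesis using irr_simple[OF kr(1)] by (simp add: simple_def)
    next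
      case (Suc n')
      then obtain Y where "is_biproduct C (irr k) (unit_obj C) Y"
        using n by (auto simp: is_biproduct_full_subcategory)
      then have "dim_Mor C (unit_obj C) (irr k) \<ge> dim_Mor C (unit_obj C) (unit_obj C)"
        using additiveD[OF dim_additive_right[OF unit_obj]] by fastforce
      then have "dim_Mor C (irr unit_index) (irr k) \<ge> 1"
        using dim_unit[OF irr_obj[OF kr(1)]] dim_simples[OF simple_unit simple_unit]
          isomorphic_refl[OF unit_obj] by simp
      then show ?thesis using kr(1) unit_index(1) by (simp add: dim_irr split: if_splits)
    qed
  qed
  then show ?thesis using simples_in_closed(2)[OF D] by blast
qed

text \<open>
  The hypothesis of finite orders provides the closure under duals that each step of the series
  needs (\<open>based_subring_if_torsion\<close>).
\<close>

lemma iterated_adjoint_subring: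
  assumes torsion: "\<And>i. i < rk \<Longrightarrow> \<exists>n\<ge>1. unit_index \<in> gr.hpow i n"
  shows "\<exists>D. iterated_adjoint C n = full_subcategory C D \<and> fusion_subcategory C D \<and>
    gr.based_subring (simples_in D) \<and> simples_in D = (gr.adjoint_subring ^^ n) {..<rk}"
proof (induction n)
  case 0
  have "simples_in (obj C) = {..<rk}" using irr_obj by (auto simp: simples_in_def)
  moreover have "gr.based_subring (simples_in (obj C))"
    using simples_in_closed[OF fusion_subcategory_obj] torsion
    by (intro gr.based_subring_if_torsion) (auto simp: simples_in_def)
  ultimately show ?case
    using full_subcategory_obj fusion_subcategory_obj by (intro exI[of _ "obj C"]) simp
next
  case (Suc n)
  then obtain D where D: "iterated_adjoint C n = full_subcategory C D" "fusion_subcategory C D"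
    "gr.based_subring (simples_in D)" "simples_in D = (gr.adjoint_subring ^^ n) {..<rk}" by blast
  let ?D' = "adjoint_objs (full_subcategory C D)"
  note D' = fusion_subcategory_trans[OF D(2) adjoint_objs_fusion_subcategory[OF D(2)]]
  have "iterated_adjoint C (Suc n) = full_subcategory C ?D'"
    using D(1) full_subcategory_twice[OF D'(2)] by (simp add: adjoint_subcategory_def)
  moreover have "simples_in ?D' = gr.adjoint_subring (simples_in D)" by (rule simples_in_adjoint[OF D(2,3)])
  ultimately show ?case
    using D' D(4) gr.based_subring_adjoint[OF D(3)] by (intro exI[of _ ?D']) simp
qed

text \<open>
  Every step of the adjoint series divides the dimension by a power of \<open>p\<close>, and the series ends with the
  unit object alone, of dimension \<open>1\<close>.
\<close>

theorem FPdim_prime_power: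
  assumes p: "prime p" and nil: "nilpotent_category C"
    and ord: "\<And>X. simple C X \<Longrightarrow> \<exists>a. obj_order C X = p ^ a"
  shows "\<exists>m. FPdim C = real (p ^ m)"
proof -
  have ppow: "\<exists>a. unit_index \<in> gr.hpow i (p ^ a)" if "i < rk" for i
    using ord[OF irr_simple[OF that]] order_support[OF that] p
    by (metis power_eq_0_iff not_prime_0)
  have torsion: "\<exists>n\<ge>1. unit_index \<in> gr.hpow i n" if "i < rk" for i
    using ppow[OF that] p by (metis one_le_power prime_ge_1_nat)
  obtain d where d: "gr.dim_character d" using gr.ex_dim_character by blast
  have step: "\<exists>m. (\<Sum>i<rk. (d i)\<^sup>2) = real (p ^ m) * (\<Sum>i\<in>(gr.adjoint_subring ^^ n) {..<rk}. (d i)\<^sup>2)" for n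
  proof (induction n)
    case 0
    show ?case by (intro exI[of _ 0]) simp
  next
    case (Suc n)
    obtain m where m: "(\<Sum>i<rk. (d i)\<^sup>2) = real (p ^ m) * (\<Sum>i\<in>(gr.adjoint_subring ^^ n) {..<rk}. (d i)\<^sup>2)"
      using Suc by blast
    define S where "S = (gr.adjoint_subring ^^ n) {..<rk}"
    have S: "gr.based_subring S" using iterated_adjoint_subring[OF torsion, of n] by (auto simp: S_def)
    moreover have "\<exists>a. unit_index \<in> gr.hpow i (p ^ a)" if "i \<in> S" for i
      using ppow that S by (auto simp: gr.based_subring_def)
    ultimately obtain m' where "(\<Sum>i\<in>S. (d i)\<^sup>2) = real (p ^ m') * (\<Sum>i\<in>gr.adjoint_subring S. (d i)\<^sup>2)"
      using gr.dimension_prime_power_multiple[OF _ d p] by blast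
    then show ?case using m by (intro exI[of _ "m + m'"]) (simp add: S_def power_add)
  qed
  obtain n where n: "is_Vec (iterated_adjoint C n)" using nil by (auto simp: nilpotent_category_def)
  obtain D where "iterated_adjoint C n = full_subcategory C D" "fusion_subcategory C D"
    "simples_in D = (gr.adjoint_subring ^^ n) {..<rk}"
    using iterated_adjoint_subring[OF torsion, of n] by blast
  then have "(gr.adjoint_subring ^^ n) {..<rk} = {unit_index}" using simples_in_Vec[of D] n by simp
  then obtain m where "(\<Sum>i<rk. (d i)\<^sup>2) = real (p ^ m) * (d unit_index)\<^sup>2" using step[of n] by auto
  then show ?thesis using FPdim_eq[OF d] gr.dim_character_unit[OF d] by auto
qed

end

section \<open>Degrees in a faithful grading\<close>

context fusion_category begin

text \<open>
  Direct summands, in the form that is preserved by tensor powers.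
\<close>

definition retract :: "'o \<Rightarrow> 'o \<Rightarrow> bool" where
  "retract S X \<longleftrightarrow> (\<exists>i \<in> Mor C S X. \<exists>p \<in> Mor C X S. p \<cdot> i = idn C S)"

lemma retract_tensor:
  assumes "retract S X" "retract T Y" shows "retract (S \<boxtimes> T) (X \<boxtimes> Y)"
proof -
  obtain i p where ip: "i \<in> Mor C S X" "p \<in> Mor C X S" "p \<cdot> i = idn C S"
    using assms(1) by (auto simp: retract_def)
  obtain j q where jq: "j \<in> Mor C T Y" "q \<in> Mor C Y T" "q \<cdot> j = idn C T"
    using assms(2) by (auto simp: retract_def)
  have "(p \<star> q) \<cdot> (i \<star> j) = idn C (S \<boxtimes> T)"
    using tarr_cmp[OF ip(1,2) jq(1,2)] ip jq tarr_idn Mor_objs by metis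
  then show ?thesis
    unfolding retract_def using tarr_Mor[OF ip(1) jq(1)] tarr_Mor[OF ip(2) jq(2)] by blast
qed

lemma retract_refl: "X \<in> obj C \<Longrightarrow> retract X X"
  unfolding retract_def using idn_Mor idn_left by blast

lemma retract_tensor_power: "retract S X \<Longrightarrow> retract (tensor_power C S n) (tensor_power C X n)"
  by (induction n) (auto simp: retract_tensor retract_refl unit_obj)

lemma nonzero_object_has_simple_retract:
  assumes X: "X \<in> obj C" "\<not> is_zero_obj C X"
  obtains S where "simple C S" "retract S X"
proof -
  obtain Ss where Ss: "\<forall>S\<in>set Ss. simple C S" "direct_sum C X Ss" using semisimple[OF X(1)] by blast
  then obtain S Ss' where "Ss = S # Ss'" using X(2) by (cases Ss) auto
  then obtain Y where "simple C S" "is_biproduct C X S Y" using Ss by auto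
  then show thesis using that unfolding is_biproduct_def retract_def by blast
qed

lemma dim_unit_retract:
  assumes SX: "retract A B" and pos: "dim_Mor C (unit_obj C) A > 0"
  obtains f where "f \<in> Mor C (unit_obj C) B" "f \<noteq> hzero C (unit_obj C) B"
proof -
  obtain i p where ip: "i \<in> Mor C A B" "p \<in> Mor C B A" "p \<cdot> i = idn C A"
    using SX by (auto simp: retract_def)
  have A: "A \<in> obj C" using ip Mor_objs by blast
  obtain g where g: "g \<in> Mor C (unit_obj C) A" "g \<noteq> hzero C (unit_obj C) A"
    using dim_pos_iff[OF unit_obj A] pos by blast
  have "p \<cdot> (i \<cdot> g) = g" using ip g by (simp add: cmp_assoc[symmetric] idn_left)
  then have "i \<cdot> g \<noteq> hzero C (unit_obj C) B" using g cmp_hzero[OF ip(2) unit_obj] by auto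
  then show thesis using that cmp_Mor[OF g(1) ip(1)] by blast
qed

context
  fixes U :: "'g monoid" and D :: "'g \<Rightarrow> 'o set"
  assumes grad: "faithful_grading C U D" and unit_in: "unit_obj C \<in> D \<one>\<^bsub>U\<^esub>"
begin

lemma grading_group: "group U"
  and grading_obj: "g \<in> carrier U \<Longrightarrow> X \<in> D g \<Longrightarrow> X \<in> obj C"
  and grading_orthogonal: "g \<in> carrier U \<Longrightarrow> h \<in> carrier U \<Longrightarrow> g \<noteq> h \<Longrightarrow> X \<in> D g \<Longrightarrow> Y \<in> D h \<Longrightarrow>
    Mor C X Y = {hzero C X Y}"
  and grading_tensor: "g \<in> carrier U \<Longrightarrow> h \<in> carrier U \<Longrightarrow> X \<in> D g \<Longrightarrow> Y \<in> D h \<Longrightarrow>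
    X \<boxtimes> Y \<in> D (g \<otimes>\<^bsub>U\<^esub> h)"
  and grading_nonzero: "g \<in> carrier U \<Longrightarrow> \<exists>X \<in> D g. \<not> is_zero_obj C X"
proof -
  have "grading C U D" and nonzero: "\<forall>g \<in> carrier U. \<exists>X \<in> D g. \<not> is_zero_obj C X"
    using grad by (auto simp only: faithful_grading_def)
  then have gr: "group U" "\<forall>g \<in> carrier U. full_abelian_subcategory C (D g)"
    "\<forall>g \<in> carrier U. \<forall>h \<in> carrier U. g \<noteq> h \<longrightarrow> (\<forall>X \<in> D g. \<forall>Y \<in> D h. Mor C X Y = {hzero C X Y})"
    "\<forall>g \<in> carrier U. \<forall>h \<in> carrier U. \<forall>X \<in> D g. \<forall>Y \<in> D h. X \<boxtimes> Y \<in> D (g \<otimes>\<^bsub>U\<^esub> h)"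
    unfolding grading_def by - (elim conjE, assumption)+
  show "group U" by (rule gr(1))
  show "X \<in> obj C" if "g \<in> carrier U" "X \<in> D g" for g X
    using gr(2) that unfolding full_abelian_subcategory_def by blast
  show "Mor C X Y = {hzero C X Y}"
    if "g \<in> carrier U" "h \<in> carrier U" "g \<noteq> h" "X \<in> D g" "Y \<in> D h" for g h X Y
    using gr(3) that by blast
  show "X \<boxtimes> Y \<in> D (g \<otimes>\<^bsub>U\<^esub> h)"
    if "g \<in> carrier U" "h \<in> carrier U" "X \<in> D g" "Y \<in> D h" for g h X Y
    using gr(4) that by blast
  show "\<exists>X \<in> D g. \<not> is_zero_obj C X" if "g \<in> carrier U" for g using nonzero that by blast
qed

lemma grading_tensor_power:
  assumes g: "g \<in> carrier U" and X: "X \<in> D g"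
  shows "tensor_power C X n \<in> D (g [^]\<^bsub>U\<^esub> n)"
proof -
  interpret group U by (rule grading_group)
  show ?thesis
    by (induction n) (use g X unit_in in \<open>auto simp: intro!: grading_tensor\<close>)
qed

lemma degree_one_if_unit_occurs:
  assumes "g \<in> carrier U" "X \<in> D g" "retract A X" "dim_Mor C (unit_obj C) A > 0"
  shows "g = \<one>\<^bsub>U\<^esub>"
proof (rule ccontr)
  assume ne: "g \<noteq> \<one>\<^bsub>U\<^esub>"
  interpret group U by (rule grading_group)
  obtain f where "f \<in> Mor C (unit_obj C) X" "f \<noteq> hzero C (unit_obj C) X"
    using assms(3,4) by (rule dim_unit_retract)
  then show False using grading_orthogonal[OF one_closed assms(1) ne[symmetric] unit_in assms(2)] by simp
qed

lemma degree_pow_order: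
  assumes ord: "\<And>S. simple C S \<Longrightarrow> obj_order C S dvd n" and n: "n \<ge> 1" and g: "g \<in> carrier U"
  shows "g [^]\<^bsub>U\<^esub> n = \<one>\<^bsub>U\<^esub>"
proof -
  interpret group U by (rule grading_group)
  obtain X where X: "X \<in> D g" "\<not> is_zero_obj C X" using grading_nonzero[OF g] by blast
  obtain S where S: "simple C S" "retract S X"
    using nonzero_object_has_simple_retract[OF grading_obj[OF g X(1)] X(2)] .
  define m where "m = obj_order C S"
  have m: "m dvd n" using ord[OF S(1)] by (simp add: m_def)
  then have "m \<noteq> 0" using n by auto
  then have "dim_Mor C (unit_obj C) (tensor_power C S m) > 0"
    using dim_pos_if_order[of S m] by (simp add: m_def)
  then have "g [^]\<^bsub>U\<^esub> m = \<one>\<^bsub>U\<^esub>"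
    using degree_one_if_unit_occurs[OF _ grading_tensor_power[OF g X(1)] retract_tensor_power[OF S(2)]] g
    by blast
  moreover obtain l where "n = m * l" using m by (auto elim: dvdE)
  ultimately show ?thesis using g by (simp add: nat_pow_pow[symmetric])
qed

text \<open>
  If \<open>S\<close> is isomorphic to its dual \<open>Y\<close>, then \<open>Hom(\<one>, S \<otimes> S) = Hom(\<one>, S \<otimes> Y) = Hom(Y, Y)\<close>, which is nonzero.
\<close>

lemma degree_square_self_dual:
  assumes sd: "\<And>S. simple C S \<Longrightarrow> self_dual C S" and g: "g \<in> carrier U"
  shows "g \<otimes>\<^bsub>U\<^esub> g = \<one>\<^bsub>U\<^esub>"
proof -
  interpret group U by (rule grading_group)
  obtain X where X: "X \<in> D g" "\<not> is_zero_obj C X" using grading_nonzero[OF g] by blast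
  obtain S where S: "simple C S" "retract S X"
    using nonzero_object_has_simple_retract[OF grading_obj[OF g X(1)] X(2)] .
  obtain Y where Y: "is_dual C S Y" "isomorphic C S Y" using sd[OF S(1)] by (auto simp: self_dual_def)
  then have o: "S \<in> obj C" "Y \<in> obj C" by (auto simp: is_dual_def)
  have "dim_Mor C (unit_obj C) (S \<boxtimes> S) = dim_Mor C (unit_obj C) (S \<boxtimes> Y)"
    using additive_iso[OF additive_tensor(2)[OF dim_additive_right[OF unit_obj] o(1)] Y(2)] .
  also have "\<dots> = dim_Mor C (Y \<boxtimes> unit_obj C) Y" using dim_dual[OF Y(1) unit_obj o(2)] by simp
  also have "\<dots> = dim_Mor C Y Y"
    using additive_iso[OF dim_additive_left[OF o(2)] isomorphic_run[OF o(2)]] .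
  also have "\<dots> = dim_Mor C S S"
    using additive_iso[OF dim_additive_left[OF o(1)] Y(2)] additive_iso[OF dim_additive_right[OF o(2)] Y(2)] by simp
  also have "\<dots> > 0" using dim_simples[OF S(1) S(1)] isomorphic_refl[OF o(1)] by simp
  finally have pos: "dim_Mor C (unit_obj C) (S \<boxtimes> S) > 0" .
  show ?thesis
    using degree_one_if_unit_occurs[OF _ grading_tensor[OF g g X(1) X(1)] retract_tensor[OF S(2) S(2)] pos] g
    by blast
qed

end

theorem universal_grading_group_exponent:
  fixes U :: "'g monoid"
  assumes U: "universal_grading C U D"
  shows "(\<And>S. simple C S \<Longrightarrow> obj_order C S dvd n) \<Longrightarrow> group_exponent U dvd n"
    and "(\<And>S. simple C S \<Longrightarrow> self_dual C S) \<Longrightarrow> elementary_abelian_2_group U"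
proof -
  have grad: "faithful_grading C U D" and "D \<one>\<^bsub>U\<^esub> = adjoint_objs C"
    using U unfolding universal_grading_def by blast+
  then have unit: "unit_obj C \<in> D \<one>\<^bsub>U\<^esub>"
    by (simp add: adjoint_objs_def fusion_subcategoryD(2))
  interpret group U by (rule grading_group[OF grad unit])
  show "group_exponent U dvd n" if ord: "\<And>S. simple C S \<Longrightarrow> obj_order C S dvd n"
  proof (cases "n = 0")
    case False
    then show ?thesis
      by (intro exponent_dvd degree_pow_order[OF grad unit]) (use ord in auto)
  qed simp
  show "elementary_abelian_2_group U" if "\<And>S. simple C S \<Longrightarrow> self_dual C S"
    using that by (intro elementary_abelian_2_groupI degree_square_self_dual[OF grad unit])
qed

end

theorem corollary4p4:
  fixes C :: "('o, 'm, 'k::{alg_closed_field, field_char_0}) lin_tensor_cat"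
  assumes "fusion_category C"
  shows
    "(\<forall>(U :: 'g monoid) D. universal_grading C U D \<longrightarrow>
        (\<forall>n::nat. (\<forall>X. simple C X \<longrightarrow> obj_order C X dvd n) \<longrightarrow> group_exponent U dvd n) \<and>
        ((\<forall>X. simple C X \<longrightarrow> self_dual C X) \<longrightarrow> elementary_abelian_2_group U)) \<and>
     (\<forall>p::nat. prime p \<longrightarrow> nilpotent_category C \<longrightarrow>
        (\<forall>X. simple C X \<longrightarrow> (\<exists>a. obj_order C X = p ^ a)) \<longrightarrow>
        (\<exists>m. FPdim C = real (p ^ m)))"
proof -
  interpret fusion_category C by (rule assms)
  show ?thesis
    using universal_grading_group_exponent FPdim_prime_power by blast
qed

end
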